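(* Let $(G,\omega_1)$ and $(H,\omega_2)$ be weighted locally compact groups, $1\le p<\infty$, with $L^p(G,\omega_1)$ and $L^p(H,\omega_2)$ convolution Banach algebras. Let $T:L^p(G,\omega_1)\to L^p(H,\omega_2)$ be a bicontinuous biseparating algebra isomorphism. Then there exists a standard isomorphism $(\gamma,\phi)$ from $(G,\omega_1)$ to $(H,\omega_2)$ such that $T=T_{\gamma,\phi}$.
   Context: A weighted locally compact group is a pair $(G,\omega)$ with $G$ locally compact and $\omega:G\to\mathbb{R}^+$ positive continuous, $\omega(xy)\le\omega(x)\omega(y)$, $\omega(e_G)=1$. $L^p(G,\omega)$ is the space of measurable $f$ with $\|f\|_{p,\omega}=\left(\int_G|f|^p\omega^p\,d\lambda\right)^{1/p}<\infty$. An operator $T$ is disjointness preserving if $f\cdot g=0$ implies $Tf\cdot Tg=0$; biseparating if it is a bijection and $T,T^{-1}$ are disjointness preserving; bicontinuous if $T,T^{-1}$ are bounded. A standard isomorphism $(\gamma,\phi)$ from $(G,\omega_1)$ onto $(H,\omega_2)$ consists of a topological group isomorphism $\phi:G\to H$ and a continuous character $\gamma:G\to\mathbb{C}\setminus\{0\}$ with $0<\inf_{x\in G}|\gamma(x)|\frac{\omega_2(\phi(x))}{\omega_1(x)}$ and $\sup_{x\in G}|\gamma(x)|\frac{\omega_2(\phi(x))}{\omega_1(x)}<\infty$. For such a pair, with Haar measures $\lambda_1,\lambda_2$ on $G,H$, let $c$ be the constant with $c=\lambda_1(E)/\lambda_2(\phi(E))$ for every non-null measurable $E\subset G$, and define $T_{\gamma,\phi}:L^p(G,\omega_1)\to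 L^p(H,\omega_2)$ by $T_{\gamma,\phi}(f)=c\,(\gamma\circ\phi^{-1})\cdot(f\circ\phi^{-1})$. *)

theory Defs
  imports "HOL-Analysis.Analysis"
begin

text \<open>Conventions. A locally compact group is modelled as a type of class
  topological_group_add (a possibly non-abelian group, written additively:
  x + y is the product, - x the inverse, 0 the identity) which is Hausdorff
  and locally compact.  Functions on groups are complex valued; elements of
  the weighted L^p spaces are represented by Borel measurable functions, and
  all identities between such elements are understood almost everywhere.\<close>

definition lc_group :: "'g::{topological_group_add,t2_space} itself \<Rightarrow> bool" where
  "lc_group _ \<longleftrightarrow> locally_compact_space (euclidean :: 'g topology)"

definition weight :: "('g::topological_group_add \<Rightarrow> real) \<Rightarrow> bool" where
  "weight \<omega> \<longleftrightarrow> continuous_on UNIV \<omega> \<and> (\<forall>x. 0 < \<omega> x) \<and>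
     (\<forall>x y. \<omega> (x + y) \<le> \<omega> x * \<omega> y) \<and> \<omega> 0 = 1"

definition haar_measure :: "'g::{topological_group_add,t2_space} measure \<Rightarrow> bool" where
  "haar_measure M \<longleftrightarrow>
     sets M = sets borel \<and>
     (\<forall>x. \<forall>A\<in>sets borel. emeasure M ((+) x ` A) = emeasure M A) \<and>
     (\<forall>K. compact K \<longrightarrow> emeasure M K < \<infinity>) \<and>
     (\<forall>U. open U \<and> U \<noteq> {} \<longrightarrow> 0 < emeasure M U) \<and>
     (\<forall>A\<in>sets borel. emeasure M A = (INF U\<in>{U. open U \<and> A \<subseteq> U}. emeasure M U)) \<and>
     (\<forall>U. open U \<longrightarrow> emeasure M U = (SUP K\<in>{K. compact K \<and> K \<subseteq> U}. emeasure M K))"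

definition Lp_w :: "'g measure \<Rightarrow> ('g \<Rightarrow> real) \<Rightarrow> real \<Rightarrow> ('g \<Rightarrow> complex) set" where
  "Lp_w M \<omega> p = {f. f \<in> borel_measurable M \<and>
       integrable M (\<lambda>x. norm (f x) powr p * \<omega> x powr p)}"

definition Lp_norm :: "'g measure \<Rightarrow> ('g \<Rightarrow> real) \<Rightarrow> real \<Rightarrow> ('g \<Rightarrow> complex) \<Rightarrow> real" where
  "Lp_norm M \<omega> p f = (\<integral>x. norm (f x) powr p * \<omega> x powr p \<partial>M) powr (1 / p)"

definition conv :: "'g::group_add measure \<Rightarrow> ('g \<Rightarrow> complex) \<Rightarrow> ('g \<Rightarrow> complex) \<Rightarrow> 'g \<Rightarrow> complex" where
  "conv M f g x = (\<integral>y. f y * g (- y + x) \<partial>M)"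

definition conv_algebra :: "'g::group_add measure \<Rightarrow> ('g \<Rightarrow> real) \<Rightarrow> real \<Rightarrow> bool" where
  "conv_algebra M \<omega> p \<longleftrightarrow>
     (\<forall>f\<in>Lp_w M \<omega> p. \<forall>g\<in>Lp_w M \<omega> p.
        (AE x in M. integrable M (\<lambda>y. f y * g (- y + x))) \<and> conv M f g \<in> Lp_w M \<omega> p)"

definition ae_eq :: "'a measure \<Rightarrow> ('a \<Rightarrow> complex) \<Rightarrow> ('a \<Rightarrow> complex) \<Rightarrow> bool" where
  "ae_eq M f g \<longleftrightarrow> (AE x in M. f x = g x)"

definition alg_iso :: "'g::group_add measure \<Rightarrow> ('g \<Rightarrow> real) \<Rightarrow> 'h::group_add measure \<Rightarrow> ('h \<Rightarrow> real)
     \<Rightarrow> real \<Rightarrow> (('g \<Rightarrow> complex) \<Rightarrow> ('h \<Rightarrow> complex)) \<Rightarrow> bool" where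
  "alg_iso M1 \<omega>1 M2 \<omega>2 p T \<longleftrightarrow>
     (\<forall>f\<in>Lp_w M1 \<omega>1 p. T f \<in> Lp_w M2 \<omega>2 p) \<and>
     (\<forall>f\<in>Lp_w M1 \<omega>1 p. \<forall>g\<in>Lp_w M1 \<omega>1 p. ae_eq M1 f g \<longrightarrow> ae_eq M2 (T f) (T g)) \<and>
     (\<forall>f\<in>Lp_w M1 \<omega>1 p. \<forall>g\<in>Lp_w M1 \<omega>1 p.
        ae_eq M2 (T (\<lambda>x. f x + g x)) (\<lambda>y. T f y + T g y)) \<and>
     (\<forall>f\<in>Lp_w M1 \<omega>1 p. \<forall>a::complex. ae_eq M2 (T (\<lambda>x. a * f x)) (\<lambda>y. a * T f y)) \<and>
     (\<forall>f\<in>Lp_w M1 \<omega>1 p. \<forall>g\<in>Lp_w M1 \<omega>1 p. ae_eq M2 (T f) (T g) \<longrightarrow> ae_eq M1 f g) \<and>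
     (\<forall>h\<in>Lp_w M2 \<omega>2 p. \<exists>f\<in>Lp_w M1 \<omega>1 p. ae_eq M2 (T f) h) \<and>
     (\<forall>f\<in>Lp_w M1 \<omega>1 p. \<forall>g\<in>Lp_w M1 \<omega>1 p.
        ae_eq M2 (T (conv M1 f g)) (conv M2 (T f) (T g)))"

definition bicontinuous :: "'g measure \<Rightarrow> ('g \<Rightarrow> real) \<Rightarrow> 'h measure \<Rightarrow> ('h \<Rightarrow> real)
     \<Rightarrow> real \<Rightarrow> (('g \<Rightarrow> complex) \<Rightarrow> ('h \<Rightarrow> complex)) \<Rightarrow> bool" where
  "bicontinuous M1 \<omega>1 M2 \<omega>2 p T \<longleftrightarrow>
     (\<exists>C. \<forall>f\<in>Lp_w M1 \<omega>1 p. Lp_norm M2 \<omega>2 p (T f) \<le> C * Lp_norm M1 \<omega>1 p f) \<and>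
     (\<exists>C. \<forall>f\<in>Lp_w M1 \<omega>1 p. Lp_norm M1 \<omega>1 p f \<le> C * Lp_norm M2 \<omega>2 p (T f))"

definition biseparating :: "'g measure \<Rightarrow> ('g \<Rightarrow> real) \<Rightarrow> 'h measure \<Rightarrow> ('h \<Rightarrow> real)
     \<Rightarrow> real \<Rightarrow> (('g \<Rightarrow> complex) \<Rightarrow> ('h \<Rightarrow> complex)) \<Rightarrow> bool" where
  "biseparating M1 \<omega>1 M2 \<omega>2 p T \<longleftrightarrow>
     (\<forall>f\<in>Lp_w M1 \<omega>1 p. \<forall>g\<in>Lp_w M1 \<omega>1 p.
        ae_eq M1 (\<lambda>x. f x * g x) (\<lambda>_. 0) \<longrightarrow> ae_eq M2 (\<lambda>y. T f y * T g y) (\<lambda>_. 0)) \<and>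
     (\<forall>f\<in>Lp_w M1 \<omega>1 p. \<forall>g\<in>Lp_w M1 \<omega>1 p.
        ae_eq M2 (\<lambda>y. T f y * T g y) (\<lambda>_. 0) \<longrightarrow> ae_eq M1 (\<lambda>x. f x * g x) (\<lambda>_. 0))"

definition standard_iso :: "('g::topological_group_add \<Rightarrow> real) \<Rightarrow> ('h::topological_group_add \<Rightarrow> real)
     \<Rightarrow> ('g \<Rightarrow> complex) \<Rightarrow> ('g \<Rightarrow> 'h) \<Rightarrow> bool" where
  "standard_iso \<omega>1 \<omega>2 \<gamma> \<phi> \<longleftrightarrow>
     bij \<phi> \<and> continuous_on UNIV \<phi> \<and> continuous_on UNIV (inv \<phi>) \<and>
     (\<forall>x y. \<phi> (x + y) = \<phi> x + \<phi> y) \<and>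
     continuous_on UNIV \<gamma> \<and> (\<forall>x. \<gamma> x \<noteq> 0) \<and> (\<forall>x y. \<gamma> (x + y) = \<gamma> x * \<gamma> y) \<and>
     0 < (INF x. norm (\<gamma> x) * \<omega>2 (\<phi> x) / \<omega>1 x) \<and>
     bdd_above (range (\<lambda>x. norm (\<gamma> x) * \<omega>2 (\<phi> x) / \<omega>1 x))"

definition haar_const :: "'g measure \<Rightarrow> 'h measure \<Rightarrow> ('g \<Rightarrow> 'h) \<Rightarrow> real \<Rightarrow> bool" where
  "haar_const M1 M2 \<phi> c \<longleftrightarrow>
     (\<forall>E\<in>sets M1. emeasure M1 E \<noteq> 0 \<longrightarrow> emeasure M1 E = ennreal c * emeasure M2 (\<phi> ` E))"

definition T_std :: "real \<Rightarrow> ('g \<Rightarrow> complex) \<Rightarrow> ('g \<Rightarrow> 'h) \<Rightarrow> ('g \<Rightarrow> complex) \<Rightarrow> 'h \<Rightarrow> complex" where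
  "T_std c \<gamma> \<phi> f y = complex_of_real c * \<gamma> (inv \<phi> y) * f (inv \<phi> y)"

end

theory Submission
  imports Defs
begin

text \<open>
  Let $S = T L_a T^{-1}$, where $L_a$ is a translation of $G$.  Since $L_a$ commutes with right convolutions, so does
  $S$, and $S$ is again biseparating.  Convolving $|Sf|$ with bump functions shows that the quotient of two supports
  is not enlarged by $S$; letting one of the supports shrink to a point, the images have a point $b$ in common, and
  $L_{-b} S$ does not enlarge supports at all.  Such a local operator satisfies $f \cdot Ug = g \cdot Uf$, and, commuting
  with convolutions, it is a scalar.  Hence $T L_a = \gamma(a)\, L_{\phi(a)} T$.  Uniqueness makes $\phi$ a homomorphism and
  $\gamma$ a character, continuity of translation makes them continuous, and the same argument for $T^{-1}$ inverts
  $\phi$.  Finally, for continuous $f$ and $k$ with compact support, $f * T^{-1}k$ is a limit of combinations of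
  translates of $T^{-1}k$; applying $T$ turns them into Riemann sums of $T_{\gamma,\phi} f * k$, so $Tf = T_{\gamma,\phi} f$.
\<close>

subsection \<open>Compactly supported functions\<close>

definition Cc :: "('a::topological_space \<Rightarrow> 'b::real_normed_vector) set" where
  "Cc = {k. continuous_on UNIV k \<and> (\<exists>K. compact K \<and> (\<forall>x. x \<notin> K \<longrightarrow> k x = 0))}"

lemma CcI: "continuous_on UNIV k \<Longrightarrow> compact K \<Longrightarrow> (\<And>x. x \<notin> K \<Longrightarrow> k x = 0) \<Longrightarrow> k \<in> Cc"
  unfolding Cc_def by blast

lemma CcE:
  assumes "k \<in> Cc"
  obtains K where "compact K" "\<And>x. x \<notin> K \<Longrightarrow> k x = 0"
  using assms unfolding Cc_def by blast

lemma Cc_continuous: "k \<in> Cc \<Longrightarrow> continuous_on UNIV k"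
  by (simp add: Cc_def)

lemma Cc_measurable: "k \<in> Cc \<Longrightarrow> k \<in> borel_measurable borel"
  by (intro borel_measurable_continuous_onI Cc_continuous)

lemma Cc_bounded:
  assumes "k \<in> Cc"
  obtains B where "0 < B" "\<And>x. norm (k x) \<le> B"
proof -
  obtain K where K: "compact K" "\<And>x. x \<notin> K \<Longrightarrow> k x = 0"
    using assms by (rule CcE) blast
  have "bounded (k ` K)"
    using K(1) Cc_continuous[OF assms] continuous_on_subset
    by (intro compact_imp_bounded compact_continuous_image) blast+
  then obtain B where B: "0 < B" "\<And>x. x \<in> K \<Longrightarrow> norm (k x) \<le> B"
    unfolding bounded_pos by auto
  then show thesis
    using that[of B] K(2) by (metis less_imp_le norm_zero)
qed

lemma Cc_of_real:
  fixes k :: "'a::topological_space \<Rightarrow> real"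
  assumes "k \<in> Cc"
  shows "(\<lambda>x. of_real (k x) :: 'b::real_normed_algebra_1) \<in> Cc"
  using assms by (auto simp: Cc_def intro!: continuous_intros)

lemma Cc_mult:
  fixes k g :: "'a::topological_space \<Rightarrow> 'b::real_normed_algebra"
  assumes "k \<in> Cc" "continuous_on UNIV g"
  shows "(\<lambda>x. k x * g x) \<in> Cc"
  using assms by (auto simp: Cc_def intro!: continuous_intros)

lemma Cc_add:
  fixes k g :: "'a::topological_space \<Rightarrow> 'b::real_normed_vector"
  assumes "k \<in> Cc" "g \<in> Cc"
  shows "(\<lambda>x. k x + g x) \<in> Cc"
proof -
  obtain K L where KL: "compact K" "compact L" "\<And>x. x \<notin> K \<Longrightarrow> k x = 0" "\<And>x. x \<notin> L \<Longrightarrow> g x = 0"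
    using assms by (metis CcE)
  show ?thesis
    by (rule CcI[of _ "K \<union> L"]) (use assms[THEN Cc_continuous] KL in \<open>auto intro!: continuous_intros\<close>)
qed

lemma Cc_compose:
  fixes k :: "'b::t2_space \<Rightarrow> 'c::real_normed_vector" and f :: "'a::topological_space \<Rightarrow> 'b"
  assumes k: "k \<in> Cc" and f: "continuous_on UNIV f" and g: "continuous_on UNIV g" and gf: "\<And>x. g (f x) = x"
  shows "(\<lambda>x. k (f x)) \<in> Cc"
proof -
  obtain K where K: "compact K" "\<And>x. x \<notin> K \<Longrightarrow> k x = 0"
    using k by (rule CcE) blast
  show ?thesis
  proof (rule CcI)
    show "continuous_on UNIV (\<lambda>x. k (f x))"
      by (rule continuous_on_compose2[OF Cc_continuous[OF k] f]) simp
    show "compact (g ` K)"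
      by (intro compact_continuous_image continuous_on_subset[OF g] K) simp
    show "k (f x) = 0" if "x \<notin> g ` K" for x
      using that K(2) gf by (metis imageI)
  qed
qed

lemma Cc_tensor:
  fixes f :: "'a::topological_space \<Rightarrow> 'c::real_normed_algebra" and g :: "'b::topological_space \<Rightarrow> 'c"
  assumes "f \<in> Cc" "g \<in> Cc"
  shows "(\<lambda>z. f (fst z) * g (snd z)) \<in> Cc"
proof -
  obtain K L where KL: "compact K" "compact L" "\<And>x. x \<notin> K \<Longrightarrow> f x = 0" "\<And>y. y \<notin> L \<Longrightarrow> g y = 0"
    using assms by (metis CcE)
  show ?thesis
  proof (rule CcI)
    show "continuous_on UNIV (\<lambda>z. f (fst z) * g (snd z))"
      by (intro continuous_on_mult continuous_on_compose2[OF assms(1)[THEN Cc_continuous]]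
          continuous_on_compose2[OF assms(2)[THEN Cc_continuous]] continuous_intros) auto
    show "compact (K \<times> L)"
      using KL by (intro compact_Times)
    show "f (fst z) * g (snd z) = 0" if "z \<notin> K \<times> L" for z
      using that KL by (cases z) auto
  qed
qed

lemma Cc_Times_supportE:
  fixes F :: "'a::topological_space \<times> 'b::topological_space \<Rightarrow> 'c::real_normed_vector"
  assumes "F \<in> Cc"
  obtains K L where "compact K" "compact L" "\<And>x y. x \<notin> K \<Longrightarrow> F (x, y) = 0" "\<And>x y. y \<notin> L \<Longrightarrow> F (x, y) = 0"
proof -
  obtain Q where Q: "compact Q" "\<And>z. z \<notin> Q \<Longrightarrow> F z = 0"
    using assms by (rule CcE) blast
  have "compact (fst ` Q)" "compact (snd ` Q)"
    by (auto intro!: compact_continuous_image Q continuous_intros)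
  moreover have "F (x, y) = 0" if "x \<notin> fst ` Q" for x y
    using that Q(2) by force
  moreover have "F (x, y) = 0" if "y \<notin> snd ` Q" for x y
    using that Q(2) by force
  ultimately show thesis
    using that by metis
qed

lemma continuous_on_compact_tube:
  fixes F :: "'a::topological_space \<times> 'b::topological_space \<Rightarrow> 'c::metric_space"
  assumes "continuous_on UNIV F" "compact L" "0 < e"
  obtains V where "open V" "x \<in> V" "\<And>x' y. x' \<in> V \<Longrightarrow> y \<in> L \<Longrightarrow> dist (F (x', y)) (F (x, y)) \<le> e"
  by (rule continuous_on_prod_compactE[of UNIV L F x e])
    (use assms continuous_on_subset[OF assms(1)] in \<open>auto intro: that\<close>)

subsection \<open>Bump functions on locally compact groups\<close>

lemma Hausdorff_space_euclidean_t2: "Hausdorff_space (euclidean :: 'a::t2_space topology)"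
  unfolding Hausdorff_space_def by (metis disjnt_def hausdorff open_openin)

lemma lc_group_compact_nbhd:
  fixes x :: "'g::{topological_group_add,t2_space}"
  assumes "lc_group TYPE('g)" "open U" "x \<in> U"
  obtains V K where "open V" "compact K" "x \<in> V" "V \<subseteq> K" "K \<subseteq> U"
proof -
  have "neighbourhood_base_of (compactin (euclidean :: 'g topology)) euclidean"
    using assms(1) locally_compact_space_neighbourhood_base Hausdorff_space_euclidean_t2
    unfolding lc_group_def by blast
  then show thesis
    using that assms unfolding neighbourhood_base_of by (metis open_openin compactin_euclidean_iff)
qed

lemma lc_group_compact_nbhd_of_compact:
  fixes K :: "'g::{topological_group_add,t2_space} set"
  assumes lc: "lc_group TYPE('g)" and K: "compact K" and U: "open U" "K \<subseteq> U"
  obtains V L where "open V" "compact L" "K \<subseteq> V" "V \<subseteq> L" "L \<subseteq> U"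
proof -
  have "\<forall>x\<in>K. \<exists>V L. open V \<and> compact L \<and> x \<in> V \<and> V \<subseteq> L \<and> L \<subseteq> U"
    using lc_group_compact_nbhd[OF lc U(1)] U(2) by (metis subsetD)
  then obtain V L
    where VL: "\<And>x. x \<in> K \<Longrightarrow> open (V x) \<and> compact (L x) \<and> x \<in> V x \<and> V x \<subseteq> L x \<and> L x \<subseteq> U"
    by metis
  obtain X where X: "X \<subseteq> K" "finite X" "K \<subseteq> (\<Union>x\<in>X. V x)"
    by (rule compactE_image[OF K, of K V]) (use VL in auto)
  show thesis
  proof (rule that[of "\<Union>x\<in>X. V x" "\<Union>x\<in>X. L x"])
    show "open (\<Union>x\<in>X. V x)" using X VL by (intro open_UN) blast
    show "compact (\<Union>x\<in>X. L x)" using X VL by (intro compact_UN) blast+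
    show "K \<subseteq> (\<Union>x\<in>X. V x)" by (fact X)
    show "(\<Union>x\<in>X. V x) \<subseteq> (\<Union>x\<in>X. L x)" "(\<Union>x\<in>X. L x) \<subseteq> U"
      using X VL by (meson UN_mono order_refl subsetD, meson UN_least subsetD)
  qed
qed

definition bump :: "'a::topological_space set \<Rightarrow> 'a set \<Rightarrow> ('a \<Rightarrow> real) \<Rightarrow> bool" where
  "bump K U k \<longleftrightarrow> k \<in> Cc \<and> (\<forall>x. 0 \<le> k x \<and> k x \<le> 1) \<and> (\<forall>x\<in>K. k x = 1) \<and> (\<forall>x. x \<notin> U \<longrightarrow> k x = 0)"

lemma
  assumes "bump K U k"
  shows bump_Cc: "k \<in> Cc" and bump_nonneg: "0 \<le> k x" and bump_le_1: "k x \<le> 1"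
    and bump_eq_1: "x \<in> K \<Longrightarrow> k x = 1" and bump_eq_0: "x \<notin> U \<Longrightarrow> k x = 0"
  using assms by (auto simp: bump_def)

lemma bump_exists:
  fixes K :: "'g::{topological_group_add,t2_space} set"
  assumes lc: "lc_group TYPE('g)" and K: "compact K" and U: "open U" "K \<subseteq> U"
  obtains k where "bump K U k"
proof -
  obtain V L where VL: "open V" "compact L" "K \<subseteq> V" "V \<subseteq> L" "L \<subseteq> U"
    using lc_group_compact_nbhd_of_compact[OF assms] .
  have regular: "completely_regular_space (euclidean :: 'g topology)"
    using lc locally_compact_regular_imp_completely_regular_space Hausdorff_space_euclidean_t2
    unfolding lc_group_def by blast
  obtain k where k: "continuous_map (euclidean :: 'g topology) (top_of_set {0..1::real}) k"
      "k ` (- V) \<subseteq> {0}" "k ` K \<subseteq> {1}"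
    by (rule Urysohn_completely_regular_compact_closed[OF _ regular, of 0 1 K "- V"])
      (use VL K in \<open>auto simp: disjnt_def closed_Compl\<close>)
  then have cont: "continuous_on UNIV k" and range: "0 \<le> k x \<and> k x \<le> 1" for x
    by (auto simp: continuous_map_in_subtopology)
  have off_V: "k x = 0" if "x \<notin> V" for x
    using k(2) that by blast
  have "k \<in> Cc"
    by (rule CcI[OF cont VL(2)]) (use off_V VL in blast)
  then have "bump K U k"
    using range off_V k(3) VL unfolding bump_def by blast
  then show thesis
    by (rule that)
qed

subsection \<open>Topological groups\<close>

lemma
  fixes a :: "'g::topological_group_add"
  shows continuous_on_plus_left: "continuous_on S ((+) a)"
    and continuous_on_uminus: "continuous_on S (uminus :: 'g \<Rightarrow> 'g)"
    and continuous_on_minus_plus: "continuous_on S (\<lambda>y. - y + a)"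
  by (auto intro!: continuous_intros)

lemma open_vimage_plus:
  fixes a :: "'g::topological_group_add"
  shows "open U \<Longrightarrow> open ((+) a -` U)"
  by (rule open_vimage[OF _ continuous_on_plus_left])

lemma Cc_plus_left:
  fixes k :: "'g::{topological_group_add,t2_space} \<Rightarrow> 'b::real_normed_vector"
  shows "k \<in> Cc \<Longrightarrow> (\<lambda>y. k (a + y)) \<in> Cc"
  by (rule Cc_compose[where g = "(+) (- a)"]) (auto intro!: continuous_intros simp: add.assoc[symmetric])

lemma Cc_uminus:
  fixes k :: "'g::{topological_group_add,t2_space} \<Rightarrow> 'b::real_normed_vector"
  shows "k \<in> Cc \<Longrightarrow> (\<lambda>y. k (- y)) \<in> Cc"
  by (rule Cc_compose[where g = uminus]) (auto intro!: continuous_intros)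

lemma Cc_uminus_plus:
  fixes k :: "'g::{topological_group_add,t2_space} \<Rightarrow> 'b::real_normed_vector"
  assumes "k \<in> Cc"
  shows "(\<lambda>y. k (- y + a)) \<in> Cc"
  using Cc_plus_left[OF Cc_uminus[OF assms], of "- a"] by (simp add: minus_add)

lemma compact_plus:
  fixes K L :: "'g::topological_group_add set"
  assumes "compact K" "compact L"
  shows "compact {x + y |x y. x \<in> K \<and> y \<in> L}"
proof -
  have "{x + y |x y. x \<in> K \<and> y \<in> L} = (\<lambda>z. fst z + snd z) ` (K \<times> L)"
    by force
  then show ?thesis
    using assms by (auto intro!: compact_continuous_image compact_Times continuous_intros)
qed

lemma compact_uminus:
  fixes K :: "'g::topological_group_add set"
  shows "compact K \<Longrightarrow> compact (uminus ` K)"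
  by (intro compact_continuous_image) (auto intro!: continuous_intros)

lemma nbhd_plus:
  fixes x y :: "'g::topological_group_add"
  assumes "open W" "x + y \<in> W"
  obtains U V where "open U" "open V" "x \<in> U" "y \<in> V" "\<And>u v. u \<in> U \<Longrightarrow> v \<in> V \<Longrightarrow> u + v \<in> W"
proof -
  let ?plus = "\<lambda>z :: 'g \<times> 'g. fst z + snd z"
  have "open (?plus -` W)"
    by (rule open_vimage[OF assms(1)]) (auto intro!: continuous_intros)
  then obtain U V where "open U" "open V" "(x, y) \<in> U \<times> V" "U \<times> V \<subseteq> ?plus -` W"
    by (rule open_prod_elim[of _ "(x, y)"]) (use assms in auto)
  then show thesis
    using that[of U V] by (auto simp: subset_iff)
qed

lemma nbhd_diff:
  fixes W :: "'g::topological_group_add set"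
  assumes "open W" "0 \<in> W"
  obtains V where "open V" "0 \<in> V" "\<And>u v. u \<in> V \<Longrightarrow> v \<in> V \<Longrightarrow> u - v \<in> W"
proof -
  obtain U V where UV: "open U" "open V" "0 \<in> U" "0 \<in> V" "\<And>u v. u \<in> U \<Longrightarrow> v \<in> V \<Longrightarrow> u + v \<in> W"
    using nbhd_plus[of W 0 0] assms by auto
  have "open (uminus -` V)"
    by (rule open_vimage[OF UV(2) continuous_on_uminus])
  then show thesis
    using UV that[of "U \<inter> uminus -` V"]
    by (auto simp: open_Int diff_conv_add_uminus simp del: add_uminus_conv_diff)
qed

lemma additive_continuous_on_UNIV:
  fixes f :: "'g::topological_group_add \<Rightarrow> 'h::topological_group_add"
  assumes add: "\<And>x y. f (x + y) = f x + f y"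
    and nbhd_0: "\<And>W. open W \<Longrightarrow> 0 \<in> W \<Longrightarrow> \<forall>\<^sub>F a in nhds 0. f a \<in> W"
  shows "continuous_on UNIV f"
proof -
  have "open (f -` W)" if W: "open W" for W
  proof (subst open_subopen, rule ballI)
    fix x assume x: "x \<in> f -` W"
    have "\<forall>\<^sub>F a in nhds 0. f a \<in> (+) (f x) -` W"
      by (rule nbhd_0[OF open_vimage_plus[OF W]]) (use x in simp)
    then obtain V where V: "open V" "0 \<in> V" "\<And>a. a \<in> V \<Longrightarrow> f x + f a \<in> W"
      unfolding eventually_nhds by auto
    have "z \<in> f -` W" if "z \<in> (+) (- x) -` V" for z
      using V(3)[of "- x + z"] that unfolding add[symmetric] by (simp add: add.assoc[symmetric])
    then show "\<exists>V'. open V' \<and> x \<in> V' \<and> V' \<subseteq> f -` W"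
      using V by (intro exI[of _ "(+) (- x) -` V"]) (auto intro: open_vimage_plus)
  qed
  then show ?thesis
    by (simp add: continuous_on_open_vimage)
qed

subsection \<open>Measures that are finite on compact sets\<close>

lemma integrable_if_nn_integral_norm_le:
  fixes f :: "'a \<Rightarrow> 'b::{banach,second_countable_topology}"
  assumes "f \<in> borel_measurable M" "0 \<le> b" "(\<integral>\<^sup>+x. ennreal (norm (f x)) \<partial>M) \<le> ennreal b"
  shows "integrable M f" and "(\<integral>x. norm (f x) \<partial>M) \<le> b"
proof -
  show int: "integrable M f"
    using assms by (intro integrableI_bounded) (auto intro: le_less_trans)
  show "(\<integral>x. norm (f x) \<partial>M) \<le> b"
    using assms nn_integral_eq_integral[OF integrable_norm[OF int]] by (simp add: ennreal_le_iff)
qed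

locale compact_finite =
  fixes N :: "'a::t2_space measure"
  assumes sets_eq_borel [simp, measurable_cong]: "sets N = sets borel"
    and emeasure_compact_finite: "compact K \<Longrightarrow> emeasure N K < \<infinity>"
begin

lemma space_eq_UNIV [simp]: "space N = UNIV"
  using sets_eq_imp_space_eq[OF sets_eq_borel] by simp

lemma borel_measurable_eq [simp]: "borel_measurable N = borel_measurable borel"
  by (rule measurable_cong_sets) simp_all

lemma integrable_bounded_compact_support:
  fixes f :: "'a \<Rightarrow> 'b::{banach,second_countable_topology}"
  assumes "f \<in> borel_measurable borel" "compact K" "\<And>x. x \<in> K \<Longrightarrow> norm (f x) \<le> B" "\<And>x. x \<notin> K \<Longrightarrow> f x = 0"
  shows "integrable N f"
  by (rule integrableI_bounded_set[where A = K and B = B])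
    (use assms emeasure_compact_finite in \<open>auto simp: borel_compact\<close>)

lemma integrable_Cc:
  fixes k :: "'a \<Rightarrow> 'b::{banach,second_countable_topology}"
  assumes k: "k \<in> Cc"
  shows "integrable N k"
proof -
  obtain K where "compact K" "\<And>x. x \<notin> K \<Longrightarrow> k x = 0"
    using k by (rule CcE) blast
  moreover obtain B where "\<And>x. norm (k x) \<le> B"
    using k by (rule Cc_bounded) blast
  ultimately show ?thesis
    using integrable_bounded_compact_support Cc_measurable[OF k] by blast
qed

definition locally_integrable :: "('a \<Rightarrow> 'b::{banach,second_countable_topology}) \<Rightarrow> bool" where
  "locally_integrable h \<longleftrightarrow> (\<forall>K. compact K \<longrightarrow> set_integrable N K h)"

lemma integrable_mult_Cc:
  fixes h g :: "'a \<Rightarrow> 'b::{real_normed_field,banach,second_countable_topology}"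
  assumes h: "locally_integrable h" and g: "g \<in> Cc"
  shows "integrable N (\<lambda>y. h y * g y)"
proof -
  obtain K where K: "compact K" "\<And>y. y \<notin> K \<Longrightarrow> g y = 0"
    using g by (rule CcE) blast
  obtain B where B: "0 < B" "\<And>y. norm (g y) \<le> B"
    using g by (rule Cc_bounded) blast
  have int: "integrable N (\<lambda>y. indicator K y *\<^sub>R h y)"
    using h K(1) by (simp add: locally_integrable_def set_integrable_def)
  have "integrable N (\<lambda>y. (indicator K y *\<^sub>R h y) * g y)"
  proof (rule Bochner_Integration.integrable_bound[OF integrable_mult_left[OF integrable_norm[OF int], of B]])
    show "(\<lambda>y. (indicator K y *\<^sub>R h y) * g y) \<in> borel_measurable N"
      using borel_measurable_integrable[OF int] Cc_measurable[OF g] by (intro borel_measurable_times) auto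
    show "AE y in N. norm ((indicator K y *\<^sub>R h y) * g y) \<le> norm (norm (indicator K y *\<^sub>R h y) * B)"
      using B(1) by (auto simp: norm_mult mult.assoc intro!: AE_I2 mult_left_mono B(2))
  qed
  moreover have "(indicator K y *\<^sub>R h y) * g y = h y * g y" for y
    using K(2) by (cases "y \<in> K") auto
  ultimately show ?thesis
    by simp
qed

end

lemma norm_integral_le:
  fixes f :: "'a \<Rightarrow> 'b::{banach,second_countable_topology}"
  assumes "integrable M f" "integrable M g" "\<And>x. x \<in> space M \<Longrightarrow> norm (f x) \<le> g x"
  shows "norm (\<integral>x. f x \<partial>M) \<le> (\<integral>x. g x \<partial>M)"
  by (rule order_trans[OF integral_norm_bound integral_mono]) (use assms in auto)

lemma (in compact_finite) integral_density_indicator: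
  fixes f :: "'a \<Rightarrow> 'b::{banach,second_countable_topology}"
  assumes "f \<in> borel_measurable borel" "A \<in> sets borel" "\<And>x. x \<notin> A \<Longrightarrow> f x = 0"
  shows "(\<integral>x. f x \<partial>density N (indicator A :: 'a \<Rightarrow> real)) = (\<integral>x. f x \<partial>N)"
proof -
  have "(\<integral>x. f x \<partial>density N (indicator A :: 'a \<Rightarrow> real)) = (\<integral>x. indicator A x *\<^sub>R f x \<partial>N)"
    using assms by (intro integral_density) auto
  also have "\<dots> = (\<integral>x. f x \<partial>N)"
    using assms(3) by (intro Bochner_Integration.integral_cong) (auto simp: indicator_def)
  finally show ?thesis .
qed

lemma (in compact_finite) norm_integral_diff_compact_le:
  fixes h :: "'a \<Rightarrow> 'b::{real_normed_field,banach,second_countable_topology}"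
  assumes h: "locally_integrable h" and f: "f \<in> Cc" and g: "g \<in> Cc" and L: "compact L"
    and close: "\<And>y. y \<in> L \<Longrightarrow> norm (f y - g y) \<le> d" and off_L: "\<And>y. y \<notin> L \<Longrightarrow> f y = g y"
  shows "norm ((\<integral>y. h y * f y \<partial>N) - (\<integral>y. h y * g y \<partial>N)) \<le> (LINT y:L|N. norm (h y)) * d"
proof -
  note int = integrable_mult_Cc[OF h]
  have "set_integrable N L (\<lambda>y. norm (h y))"
    using set_integrable_norm h L unfolding locally_integrable_def by blast
  then have int_L: "integrable N (\<lambda>y. indicator L y * norm (h y) * d)"
    by (intro integrable_mult_left) (simp add: set_integrable_def)
  have "norm ((\<integral>y. h y * f y \<partial>N) - (\<integral>y. h y * g y \<partial>N)) = norm (\<integral>y. h y * f y - h y * g y \<partial>N)"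
    by (simp add: int f g)
  also have "\<dots> \<le> (\<integral>y. indicator L y * norm (h y) * d \<partial>N)"
  proof (rule norm_integral_le[OF Bochner_Integration.integrable_diff[OF int[OF f] int[OF g]] int_L])
    fix y
    show "norm (h y * f y - h y * g y) \<le> indicator L y * norm (h y) * d"
      using close[of y] off_L[of y]
      by (cases "y \<in> L") (auto simp: norm_mult mult_left_mono simp flip: right_diff_distrib)
  qed
  finally show ?thesis
    by (simp add: set_lebesgue_integral_def)
qed

lemma (in compact_finite) norm_integral_mult_Cc_le:
  fixes h :: "'a \<Rightarrow> 'b::{real_normed_field,banach,second_countable_topology}"
  assumes "locally_integrable h" "f \<in> Cc" "compact L" "\<And>y. y \<notin> L \<Longrightarrow> f y = 0" "\<And>y. norm (f y) \<le> B"
  shows "norm (\<integral>y. h y * f y \<partial>N) \<le> (LINT y:L|N. norm (h y)) * B"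
proof -
  have "(\<lambda>_. 0 :: 'b) \<in> Cc"
    by (rule CcI[where K = "{}"]) simp_all
  from norm_integral_diff_compact_le[OF assms(1,2) this assms(3), of B] show ?thesis
    using assms(4,5) by simp
qed

lemma (in compact_finite) continuous_on_param_integral:
  fixes F :: "'b::t2_space \<times> 'a \<Rightarrow> 'c::{real_normed_field,banach,second_countable_topology}"
  assumes F: "continuous_on UNIV F" and h: "locally_integrable h"
    and supp: "\<And>x. \<exists>V L. open V \<and> x \<in> V \<and> compact L \<and> (\<forall>x'\<in>V. \<forall>y. y \<notin> L \<longrightarrow> F (x', y) = 0)"
  shows "continuous_on UNIV (\<lambda>x. \<integral>y. h y * F (x, y) \<partial>N)"
proof (rule continuous_at_imp_continuous_on, rule ballI)
  fix x
  obtain V L where V: "open V" "x \<in> V" and L: "compact L" "\<And>x' y. x' \<in> V \<Longrightarrow> y \<notin> L \<Longrightarrow> F (x', y) = 0"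
    using supp[of x] by blast
  have F_Cc: "(\<lambda>y. F (x', y)) \<in> Cc" if "x' \<in> V" for x'
    by (rule CcI[OF _ L(1) L(2)[OF that]])
      (auto intro!: continuous_on_compose2[OF F] continuous_intros)
  define B where "B = (LINT y:L|N. norm (h y))"
  have B: "0 \<le> B"
    unfolding B_def set_lebesgue_integral_def by (intro integral_nonneg_AE) simp
  show "isCont (\<lambda>x. \<integral>y. h y * F (x, y) \<partial>N) x"
    unfolding isCont_def
  proof (rule tendstoI)
    fix e :: real assume e: "0 < e"
    then have "0 < e / (B + 1)"
      using B by simp
    then obtain W where W: "open W" "x \<in> W" "\<And>x' y. x' \<in> W \<Longrightarrow> y \<in> L \<Longrightarrow> dist (F (x', y)) (F (x, y)) \<le> e / (B + 1)"
      using continuous_on_compact_tube[OF F L(1)] by metis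
    have "dist (\<integral>y. h y * F (x', y) \<partial>N) (\<integral>y. h y * F (x, y) \<partial>N) < e" if x': "x' \<in> W \<inter> V" for x'
    proof -
      have "dist (\<integral>y. h y * F (x', y) \<partial>N) (\<integral>y. h y * F (x, y) \<partial>N) \<le> B * (e / (B + 1))"
        unfolding dist_norm B_def
        by (rule norm_integral_diff_compact_le[OF h F_Cc F_Cc L(1)])
          (use x' V W(3) L(2) in \<open>auto simp: dist_norm B_def\<close>)
      also have "\<dots> < e"
        using B e by (simp add: field_simps)
      finally show ?thesis .
    qed
    then show "\<forall>\<^sub>F x' in at x. dist (\<integral>y. h y * F (x', y) \<partial>N) (\<integral>y. h y * F (x, y) \<partial>N) < e"
      unfolding eventually_at_topological using W V by (intro exI[of _ "W \<inter> V"]) auto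
  qed
qed

subsection \<open>Riemann sums\<close>

definition subordinate_partition ::
  "'a set \<Rightarrow> ('a \<Rightarrow> 'a::topological_space set) \<Rightarrow> nat \<Rightarrow> (nat \<Rightarrow> 'a) \<Rightarrow> (nat \<Rightarrow> 'a set) \<Rightarrow> bool" where
  "subordinate_partition K V n t A \<longleftrightarrow>
     (\<forall>i<n. t i \<in> K \<and> A i \<in> sets borel \<and> A i \<subseteq> V (t i)) \<and> disjoint_family_on A {..<n} \<and> (\<Union>i<n. A i) = K"

lemma subordinate_partition_exists:
  fixes K :: "'a::t2_space set"
  assumes K: "compact K" and V: "\<And>x. open (V x)" "\<And>x. x \<in> V x"
  obtains n t A where "subordinate_partition K V n t A"
proof -
  obtain X where X: "X \<subseteq> K" "finite X" "K \<subseteq> (\<Union>x\<in>X. V x)"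
    by (rule compactE_image[OF K, of K V]) (use V in auto)
  obtain m :: nat and t where t: "bij_betw t {0..<m} X"
    using ex_bij_betw_nat_finite[OF X(2)] by metis
  define A where "A i = K \<inter> disjointed (\<lambda>j. V (t j)) i" for i
  have "A i \<in> sets borel" for i
    unfolding A_def disjointed_def using K V(1)
    by (intro sets.Int sets.Diff sets.finite_UN borel_compact borel_open) auto
  then have "t i \<in> K \<and> A i \<in> sets borel \<and> A i \<subseteq> V (t i)" if "i < m" for i
    using bij_betwE[OF t] that X(1) by (auto simp: A_def disjointed_def)
  moreover have "disjoint_family_on A {..<m}"
    using disjoint_family_disjointed[of "\<lambda>j. V (t j)"] by (auto simp: A_def disjoint_family_on_def)
  moreover have "(\<Union>i<m. A i) = K"
  proof -
    have "(\<Union>i<m. A i) = K \<inter> (\<Union>i\<in>{0..<m}. V (t i))"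
      by (simp only: A_def lessThan_atLeast0 Int_UN_distrib[symmetric] finite_UN_disjointed_eq)
    moreover have "(\<Union>i\<in>{0..<m}. V (t i)) = (\<Union>x\<in>X. V x)"
      using bij_betw_imp_surj_on[OF t] by auto
    ultimately show ?thesis
      by (simp only: Int_absorb2[OF X(3)])
  qed
  ultimately show thesis
    using that[of m t A] by (simp add: subordinate_partition_def)
qed

lemma subordinate_partition_mono:
  "subordinate_partition K V n t A \<Longrightarrow> (\<And>x. V x \<subseteq> W x) \<Longrightarrow> subordinate_partition K W n t A"
  unfolding subordinate_partition_def by blast

lemma sum_indicator_disjoint_family:
  fixes u :: "nat \<Rightarrow> 'b::real_vector"
  assumes "disjoint_family_on A {..<n}" "j < n" "x \<in> A j"
  shows "(\<Sum>i<n. indicator (A i) x *\<^sub>R u i) = u j"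
proof -
  have "(\<Sum>i<n. indicator (A i) x *\<^sub>R u i) = (\<Sum>i<n. if i = j then u j else 0)"
    using assms by (intro sum.cong) (auto simp: disjoint_family_on_def indicator_def)
  then show ?thesis
    using assms(2) by simp
qed

definition riemann_sum ::
  "'a measure \<Rightarrow> ('a \<Rightarrow> 'b::{real_normed_field,banach,second_countable_topology}) \<Rightarrow> nat \<Rightarrow> (nat \<Rightarrow> 'a) \<Rightarrow>
    (nat \<Rightarrow> 'a set) \<Rightarrow> ('a \<Rightarrow> 'b) \<Rightarrow> 'b" where
  "riemann_sum M f n t A F = (\<Sum>i<n. (LINT x:A i|M. f x) * F (t i))"

lemma (in compact_finite) sum_norm_set_integral_le:
  fixes f :: "'a \<Rightarrow> 'b::{real_normed_field,banach,second_countable_topology}"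
  assumes f: "integrable N f" and P: "subordinate_partition K V n t A"
  shows "(\<Sum>i<n. norm (LINT x:A i|N. f x)) \<le> (\<integral>x. norm (f x) \<partial>N)"
proof -
  have int: "integrable N (\<lambda>x. indicator (A i) x *\<^sub>R f x)" if "i \<in> {..<n}" for i
    using P that f by (intro integrable_mult_indicator) (auto simp: subordinate_partition_def)
  have "(\<Sum>i<n. norm (LINT x:A i|N. f x)) \<le> (\<Sum>i<n. \<integral>x. norm (indicator (A i) x *\<^sub>R f x) \<partial>N)"
    unfolding set_lebesgue_integral_def by (intro sum_mono integral_norm_bound)
  also have "\<dots> = (\<integral>x. (\<Sum>i<n. norm (indicator (A i) x *\<^sub>R f x)) \<partial>N)"
    by (rule Bochner_Integration.integral_sum[symmetric]) (intro integrable_norm int)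
  also have "\<dots> \<le> (\<integral>x. norm (f x) \<partial>N)"
  proof (intro integral_mono Bochner_Integration.integrable_sum integrable_norm int f)
    fix x
    show "(\<Sum>i<n. norm (indicator (A i) x *\<^sub>R f x)) \<le> norm (f x)"
    proof (cases "\<exists>j<n. x \<in> A j")
      case True
      then obtain j where "j < n" "x \<in> A j"
        by blast
      then have "(\<Sum>i<n. indicator (A i) x *\<^sub>R norm (f x)) = norm (f x)"
        using P by (intro sum_indicator_disjoint_family) (auto simp: subordinate_partition_def)
      then show ?thesis
        by (simp only: norm_scaleR abs_indicator real_scaleR_def)
    next
      case False
      then have "(\<Sum>i<n. norm (indicator (A i) x *\<^sub>R f x)) = 0"
        by (intro sum.neutral) auto
      then show ?thesis
        by (simp only: norm_ge_zero)
    qed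
  qed
  finally show ?thesis .
qed

lemma (in compact_finite) norm_integral_diff_riemann_sum_le:
  fixes f F :: "'a \<Rightarrow> 'b::{real_normed_field,banach,second_countable_topology}"
  assumes f: "integrable N f" and fF: "integrable N (\<lambda>x. f x * F x)" and off_K: "\<And>x. x \<notin> K \<Longrightarrow> f x = 0"
    and P: "subordinate_partition K V n t A"
    and close: "\<And>x x'. x' \<in> V x \<Longrightarrow> norm (F x' - F x) \<le> d"
  shows "norm ((\<integral>x. f x * F x \<partial>N) - riemann_sum N f n t A F) \<le> d * (\<integral>x. norm (f x) \<partial>N)"
proof -
  let ?S = "\<lambda>x. \<Sum>i<n. indicator (A i) x *\<^sub>R (f x * F (t i))"
  have A: "A i \<in> sets borel" "A i \<subseteq> V (t i)" if "i < n" for i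
    using P that by (auto simp: subordinate_partition_def)
  have int: "integrable N (\<lambda>x. indicator (A i) x *\<^sub>R (f x * F (t i)))" if "i \<in> {..<n}" for i
    using that A f by (intro integrable_mult_indicator integrable_mult_left) auto
  have riemann_eq: "riemann_sum N f n t A F = (\<integral>x. ?S x \<partial>N)"
    unfolding riemann_sum_def
    by (subst Bochner_Integration.integral_sum[OF int])
      (auto simp: set_lebesgue_integral_def simp flip: integral_mult_left_zero mult_scaleR_left)
  have le: "norm (f x * F x - ?S x) \<le> d * norm (f x)" for x
  proof (cases "x \<in> K")
    case True
    then obtain j where j: "j < n" "x \<in> A j"
      using P by (auto simp: subordinate_partition_def)
    then have "?S x = f x * F (t j)"
      using P by (intro sum_indicator_disjoint_family) (auto simp: subordinate_partition_def)
    then have "norm (f x * F x - ?S x) = norm (f x) * norm (F x - F (t j))"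
      by (simp add: norm_mult flip: right_diff_distrib)
    also have "\<dots> \<le> norm (f x) * d"
      using A j by (intro mult_left_mono close) auto
    finally show ?thesis
      by (simp add: mult.commute)
  qed (simp add: off_K)
  have int_S: "integrable N ?S"
    by (rule Bochner_Integration.integrable_sum[OF int])
  have "norm ((\<integral>x. f x * F x \<partial>N) - riemann_sum N f n t A F) = norm (\<integral>x. f x * F x - ?S x \<partial>N)"
    unfolding riemann_eq Bochner_Integration.integral_diff[OF fF int_S] ..
  also have "\<dots> \<le> (\<integral>x. d * norm (f x) \<partial>N)"
    by (intro norm_integral_le le integrable_mult_right integrable_norm f Bochner_Integration.integrable_diff fF int_S)
  finally show ?thesis
    by simp
qed

subsection \<open>Fubini's theorem for compactly supported functions\<close>

text \<open>The Borel sigma-algebra of a product may exceed the product of the Borel sigma-algebras; functions with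
  compact support are nevertheless uniform limits of finite sums of rectangles.\<close>

lemma norm_step_function_diff_le:
  fixes F :: "'a::topological_space \<Rightarrow> 'b::real_normed_vector"
  assumes P: "subordinate_partition K V n t A" and d: "0 \<le> d"
    and close: "\<And>x x'. x' \<in> V x \<Longrightarrow> norm (F x' - F x) \<le> d" and off_K: "\<And>x. x \<notin> K \<Longrightarrow> F x = 0"
  shows "norm ((\<Sum>i<n. indicator (A i) x *\<^sub>R F (t i)) - F x) \<le> d"
proof (cases "x \<in> K")
  case True
  then obtain j where j: "j < n" "x \<in> A j"
    using P by (auto simp: subordinate_partition_def)
  then have "norm (F x - F (t j)) \<le> d"
    using P by (intro close) (auto simp: subordinate_partition_def)
  then show ?thesis
    using P j sum_indicator_disjoint_family[of A n j x "\<lambda>i. F (t i)"]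
    by (simp add: subordinate_partition_def norm_minus_commute)
next
  case False
  then have "(\<Sum>i<n. indicator (A i) x *\<^sub>R F (t i)) = 0"
    using P by (intro sum.neutral) (auto simp: subordinate_partition_def indicator_def)
  then show ?thesis
    using False off_K d by simp
qed

lemma Cc_pair_measurable_approximation:
  fixes F :: "'a::t2_space \<times> 'b::t2_space \<Rightarrow> 'c::{real_normed_vector,second_countable_topology}"
  assumes F: "F \<in> Cc" and e: "0 < e"
  obtains S where "S \<in> borel_measurable (borel \<Otimes>\<^sub>M borel)" "\<And>z. norm (S z - F z) \<le> e"
proof -
  obtain K L where K: "compact K" "\<And>x y. x \<notin> K \<Longrightarrow> F (x, y) = 0"
    and L: "compact L" "\<And>x y. y \<notin> L \<Longrightarrow> F (x, y) = 0"
    using F by (rule Cc_Times_supportE) blast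
  have "\<exists>V. open V \<and> x \<in> V \<and> (\<forall>x'\<in>V. \<forall>y\<in>L. dist (F (x', y)) (F (x, y)) \<le> e)" for x
    using continuous_on_compact_tube[OF Cc_continuous[OF F] L(1) e] by metis
  then obtain V where V: "\<And>x. open (V x)" "\<And>x. x \<in> V x"
    and V_close: "\<And>x x' y. x' \<in> V x \<Longrightarrow> y \<in> L \<Longrightarrow> dist (F (x', y)) (F (x, y)) \<le> e"
    by metis
  have close: "norm (F (x', y) - F (x, y)) \<le> e" if "x' \<in> V x" for x x' y
    using V_close[OF that, of y] L(2)[of y] e by (cases "y \<in> L") (auto simp: dist_norm)
  obtain n t A where P: "subordinate_partition K V n t A"
    using subordinate_partition_exists[OF K(1)] V by blast
  have A: "A i \<in> sets borel" if "i \<in> {..<n}" for i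
    using P that by (simp add: subordinate_partition_def)
  have F_section: "(\<lambda>y. F (x, y)) \<in> borel_measurable borel" for x
    by (intro borel_measurable_continuous_onI continuous_on_compose2[OF Cc_continuous[OF F]] continuous_intros) auto
  show thesis
  proof (rule that[of "\<lambda>z. \<Sum>i<n. indicator (A i) (fst z) *\<^sub>R F (t i, snd z)"])
    show "(\<lambda>z. \<Sum>i<n. indicator (A i) (fst z) *\<^sub>R F (t i, snd z)) \<in> borel_measurable (borel \<Otimes>\<^sub>M borel)"
      by (intro borel_measurable_sum borel_measurable_scaleR measurable_compose[OF measurable_fst]
          measurable_compose[OF measurable_snd F_section] borel_measurable_indicator A)
    show "norm ((\<Sum>i<n. indicator (A i) (fst z) *\<^sub>R F (t i, snd z)) - F z) \<le> e" for z
      using norm_step_function_diff_le[where F = "\<lambda>x. F (x, snd z)" and x = "fst z", OF P less_imp_le[OF e] close K(2)]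
      by simp
  qed
qed

lemma Cc_pair_measurable:
  fixes F :: "'a::t2_space \<times> 'b::t2_space \<Rightarrow> 'c::{real_normed_vector,second_countable_topology}"
  assumes F: "F \<in> Cc"
  shows "F \<in> borel_measurable (borel \<Otimes>\<^sub>M borel)"
proof -
  have "\<exists>S. S \<in> borel_measurable (borel \<Otimes>\<^sub>M borel) \<and> (\<forall>z. norm (S z - F z) \<le> 1 / real (Suc m))" for m
    using Cc_pair_measurable_approximation[OF F, of "1 / real (Suc m)"] by (metis of_nat_0_less_iff zero_less_Suc zero_less_divide_1_iff)
  then obtain S where S: "\<And>m. S m \<in> borel_measurable (borel \<Otimes>\<^sub>M borel)"
    and approx: "\<And>m z. norm (S m z - F z) \<le> 1 / real (Suc m)"
    by metis
  show ?thesis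
  proof (rule borel_measurable_LIMSEQ_metric[OF S])
    show "(\<lambda>m. S m z) \<longlonglongrightarrow> F z" for z
      by (rule LIM_zero_cancel, rule Lim_null_comparison[OF _ LIMSEQ_Suc[OF lim_inverse_n']])
        (intro always_eventually allI approx)
  qed
qed

lemma (in compact_finite) finite_measure_density_compact:
  assumes "compact K"
  shows "finite_measure (density N (indicator K :: _ \<Rightarrow> real))"
  using emeasure_compact_finite[OF assms] assms
  by (intro finite_measureI) (simp add: emeasure_restricted ennreal_indicator borel_compact)

lemma (in compact_finite) borel_measurable_integral_Cc:
  fixes F :: "'b::t2_space \<times> 'a \<Rightarrow> 'c::{real_normed_field,banach,second_countable_topology}"
  assumes F: "F \<in> Cc"
  shows "(\<lambda>x. \<integral>y. F (x, y) \<partial>N) \<in> borel_measurable borel"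
proof -
  obtain K L where L: "compact L" "\<And>x y. y \<notin> L \<Longrightarrow> F (x, y) = 0"
    using F by (rule Cc_Times_supportE) blast
  have one: "locally_integrable (\<lambda>_. 1 :: 'c)"
    using emeasure_compact_finite by (auto simp: locally_integrable_def set_integrable_def borel_compact)
  have "continuous_on UNIV (\<lambda>x. \<integral>y. 1 * F (x, y) \<partial>N)"
    by (rule continuous_on_param_integral[OF Cc_continuous[OF F] one]) (use L in blast)
  then show ?thesis
    by (simp add: borel_measurable_continuous_onI)
qed

lemma Fubini_Cc_finite_measure:
  fixes F :: "'a::t2_space \<times> 'b::t2_space \<Rightarrow> 'c::{real_normed_field,banach,second_countable_topology}"
  assumes M: "finite_measure M" and N: "finite_measure N"
    and sets: "sets M = sets borel" "sets N = sets borel" and F: "F \<in> Cc"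
  shows "(\<integral>x. \<integral>y. F (x, y) \<partial>N \<partial>M) = (\<integral>y. \<integral>x. F (x, y) \<partial>M \<partial>N)"
proof -
  interpret M: finite_measure M by fact
  interpret N: finite_measure N by fact
  interpret pair_sigma_finite M N ..
  obtain B where B: "\<And>z. norm (F z) \<le> B"
    using F by (rule Cc_bounded) blast
  have "F \<in> borel_measurable (M \<Otimes>\<^sub>M N)"
    using Cc_pair_measurable[OF F] unfolding measurable_cong_sets[OF sets_pair_measure_cong[OF sets] refl] .
  moreover have "finite_measure (M \<Otimes>\<^sub>M N)"
    by (rule finite_measure_pair_measure) unfold_locales
  ultimately have "integrable (M \<Otimes>\<^sub>M N) F"
    using B by (intro finite_measure.integrable_const_bound[where B = B]) auto
  then show ?thesis
    using Fubini_integral[of "\<lambda>x y. F (x, y)"] by simp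
qed

lemma Fubini_Cc:
  fixes F :: "'a::t2_space \<times> 'b::t2_space \<Rightarrow> 'c::{real_normed_field,banach,second_countable_topology}"
  assumes "compact_finite M" and "compact_finite N" and F: "F \<in> Cc"
  shows "(\<integral>x. \<integral>y. F (x, y) \<partial>N \<partial>M) = (\<integral>y. \<integral>x. F (x, y) \<partial>M \<partial>N)"
proof -
  interpret M: compact_finite M by fact
  interpret N: compact_finite N by fact
  obtain K L where K: "compact K" "\<And>x y. x \<notin> K \<Longrightarrow> F (x, y) = 0"
    and L: "compact L" "\<And>x y. y \<notin> L \<Longrightarrow> F (x, y) = 0"
    using F by (rule Cc_Times_supportE) blast
  define M' N' where "M' = density M (indicator K :: _ \<Rightarrow> real)" and "N' = density N (indicator L :: _ \<Rightarrow> real)"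
  interpret M': finite_measure M'
    unfolding M'_def by (rule M.finite_measure_density_compact[OF K(1)])
  interpret N': finite_measure N'
    unfolding N'_def by (rule N.finite_measure_density_compact[OF L(1)])
  have swap: "(\<integral>x. \<integral>y. F (x, y) \<partial>N' \<partial>M') = (\<integral>y. \<integral>x. F (x, y) \<partial>M' \<partial>N')"
    by (rule Fubini_Cc_finite_measure[OF M'.finite_measure_axioms N'.finite_measure_axioms _ _ F]) (simp_all add: M'_def N'_def)
  have sections: "(\<lambda>x. F (x, y)) \<in> borel_measurable borel" "(\<lambda>y. F (x, y)) \<in> borel_measurable borel" for x y
    by (intro borel_measurable_continuous_onI continuous_on_compose2[OF Cc_continuous[OF F]] continuous_intros; simp)+
  have N'_eq: "(\<integral>y. F (x, y) \<partial>N') = (\<integral>y. F (x, y) \<partial>N)" for x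
    unfolding N'_def by (rule N.integral_density_indicator[OF sections(2) borel_compact[OF L(1)] L(2)])
  have M'_eq: "(\<integral>x. F (x, y) \<partial>M') = (\<integral>x. F (x, y) \<partial>M)" for y
    unfolding M'_def by (rule M.integral_density_indicator[OF sections(1) borel_compact[OF K(1)] K(2)])
  have "(\<lambda>z. F (snd z, fst z)) \<in> Cc"
    by (rule Cc_compose[OF F, where g = "\<lambda>z. (snd z, fst z)"]) (auto intro!: continuous_intros)
  from M.borel_measurable_integral_Cc[OF this]
  have inner_M: "(\<lambda>y. \<integral>x. F (x, y) \<partial>M) \<in> borel_measurable borel"
    by simp
  have "(\<integral>x. \<integral>y. F (x, y) \<partial>N' \<partial>M') = (\<integral>x. \<integral>y. F (x, y) \<partial>N \<partial>M)"
    unfolding N'_eq unfolding M'_def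
    by (rule M.integral_density_indicator[OF N.borel_measurable_integral_Cc[OF F] borel_compact[OF K(1)]]) (simp add: K(2))
  moreover have "(\<integral>y. \<integral>x. F (x, y) \<partial>M' \<partial>N') = (\<integral>y. \<integral>x. F (x, y) \<partial>M \<partial>N)"
    unfolding M'_eq unfolding N'_def
    by (rule N.integral_density_indicator[OF inner_M borel_compact[OF L(1)]]) (simp add: L(2))
  ultimately show ?thesis
    using swap by (simp only:)
qed

subsection \<open>Haar measure\<close>

locale haar_group =
  fixes M :: "'g::{topological_group_add,t2_space} measure"
  assumes lc: "lc_group TYPE('g)" and haar: "haar_measure M"
begin

lemma
  shows sets_haar: "sets M = sets borel"
    and emeasure_plus_image: "A \<in> sets borel \<Longrightarrow> emeasure M ((+) x ` A) = emeasure M A"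
    and emeasure_compact: "compact K \<Longrightarrow> emeasure M K < \<infinity>"
    and emeasure_open_pos: "open U \<Longrightarrow> U \<noteq> {} \<Longrightarrow> 0 < emeasure M U"
    and outer_regular: "A \<in> sets borel \<Longrightarrow> emeasure M A = (INF U\<in>{U. open U \<and> A \<subseteq> U}. emeasure M U)"
    and inner_regular_open: "open U \<Longrightarrow> emeasure M U = (SUP K\<in>{K. compact K \<and> K \<subseteq> U}. emeasure M K)"
proof -
  note haar_conjuncts = haar[unfolded haar_measure_def]
  show "sets M = sets borel"
    using haar_conjuncts by (rule conjunct1)
  show "emeasure M ((+) x ` A) = emeasure M A" if "A \<in> sets borel"
    using haar_conjuncts that by (elim conjE) (erule allE, erule (1) bspec)
  show "emeasure M K < \<infinity>" if "compact K"
    using haar_conjuncts that by (elim conjE) (erule allE, erule (1) mp)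
  show "0 < emeasure M U" if "open U" "U \<noteq> {}"
    using haar_conjuncts that by (elim conjE) (erule allE, erule mp, rule conjI)
  show "emeasure M A = (INF U\<in>{U. open U \<and> A \<subseteq> U}. emeasure M U)" if "A \<in> sets borel"
    using haar_conjuncts that by (elim conjE) (erule (1) bspec)
  show "emeasure M U = (SUP K\<in>{K. compact K \<and> K \<subseteq> U}. emeasure M K)" if "open U"
    using haar_conjuncts that by (elim conjE) (erule allE, erule (1) mp)
qed

end

sublocale haar_group \<subseteq> compact_finite M
  by unfold_locales (fact sets_haar emeasure_compact)+

context haar_group
begin

subsubsection \<open>Translation invariance\<close>

lemma measurable_plus [measurable]: "(+) x \<in> M \<rightarrow>\<^sub>M M"
  using borel_measurable_continuous_onI[OF continuous_on_plus_left] by (simp cong: measurable_cong_sets)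

lemma distr_plus: "distr M M ((+) x) = M"
proof (rule measure_eqI)
  fix A assume "A \<in> sets (distr M M ((+) x))"
  then have A: "A \<in> sets borel"
    by simp
  have "(+) x -` A = (+) (- x) ` A"
  proof (intro set_eqI iffI)
    show "y \<in> (+) (- x) ` A" if "y \<in> (+) x -` A" for y
      using that by (intro image_eqI[of _ _ "x + y"]) (auto simp: add.assoc[symmetric])
  qed (auto simp: add.assoc[symmetric])
  then show "emeasure (distr M M ((+) x)) A = emeasure M A"
    using A emeasure_plus_image[of A "- x"] by (simp add: emeasure_distr)
qed simp

lemma integral_plus:
  fixes f :: "'g \<Rightarrow> 'b::{banach,second_countable_topology}"
  assumes "f \<in> borel_measurable borel"
  shows "(\<integral>y. f (x + y) \<partial>M) = (\<integral>y. f y \<partial>M)"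
  using integral_distr[OF measurable_plus, of f x] assms by (simp add: distr_plus)

lemma integrable_plus:
  fixes f :: "'g \<Rightarrow> 'b::{banach,second_countable_topology}"
  assumes "integrable M f"
  shows "integrable M (\<lambda>y. f (x + y))"
  using integrable_distr[OF measurable_plus, unfolded distr_plus, OF assms] .

lemma nn_integral_plus: "u \<in> borel_measurable borel \<Longrightarrow> (\<integral>\<^sup>+y. u (x + y) \<partial>M) = (\<integral>\<^sup>+y. u y \<partial>M)"
  using nn_integral_distr[OF measurable_plus, of u x] by (simp add: distr_plus)

lemma AE_plus: "(AE y in M. P y) \<Longrightarrow> (AE y in M. P (x + y))"
  using AE_distrD[OF measurable_plus, unfolded distr_plus] .

subsubsection \<open>Regularity\<close>

lemma outer_regular_diff:
  assumes A: "A \<in> sets borel" "emeasure M A < \<infinity>" and e: "0 < e"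
  obtains U where "open U" "A \<subseteq> U" "emeasure M (U - A) < e"
proof -
  have "(INF U\<in>{U. open U \<and> A \<subseteq> U}. emeasure M U) < emeasure M A + e"
    using A(2) e ennreal_add_left_cancel_less[of "emeasure M A" 0 e]
    unfolding outer_regular[OF A(1), symmetric] by simp
  then obtain U where U: "open U" "A \<subseteq> U" "emeasure M U < emeasure M A + e"
    unfolding INF_less_iff by auto
  have "emeasure M A + emeasure M (U - A) = emeasure M U"
    using U A by (subst plus_emeasure) (auto simp: Un_absorb1)
  then have "emeasure M (U - A) < e"
    using U(3) by (metis ennreal_add_left_cancel_less)
  then show thesis
    by (rule that[OF U(1,2)])
qed

lemma inner_regular_open_diff:
  assumes U: "open U" "emeasure M U < \<infinity>" and e: "0 < e"
  obtains K where "compact K" "K \<subseteq> U" "emeasure M (U - K) < e"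
proof -
  obtain K where K: "compact K" "K \<subseteq> U" "emeasure M U < emeasure M K + e"
  proof (cases "emeasure M U < e")
    case True
    then show thesis
      using that[of "{}"] by simp
  next
    case False
    then have "emeasure M U - e < emeasure M U"
      using U(2) e by (intro ennreal_between(1)) auto
    then obtain K where K: "compact K" "K \<subseteq> U" "emeasure M U - e < emeasure M K"
      unfolding inner_regular_open[OF U(1)] less_SUP_iff by auto
    have "emeasure M U < emeasure M K + e"
      using K(3) by (cases "emeasure M U"; cases "emeasure M K"; cases e)
        (use U(2) False in \<open>auto simp: ennreal_minus ennreal_less_iff simp flip: ennreal_plus\<close>)
    then show thesis
      by (rule that[OF K(1,2)])
  qed
  have "emeasure M K + emeasure M (U - K) = emeasure M U"
    using U K by (subst plus_emeasure) (auto simp: Un_absorb1 borel_compact)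
  then have "emeasure M (U - K) < e"
    using K(3) by (metis ennreal_add_left_cancel_less)
  then show thesis
    by (rule that[OF K(1,2)])
qed

lemma inner_regular_diff:
  assumes A: "A \<in> sets borel" "emeasure M A < \<infinity>" and e: "0 < (e::real)"
  obtains K where "compact K" "K \<subseteq> A" "emeasure M (A - K) < e"
proof -
  have e2: "0 < ennreal (e / 2)"
    using e by simp
  obtain U where U: "open U" "A \<subseteq> U" "emeasure M (U - A) < ennreal (e / 2)"
    using outer_regular_diff[OF A e2] by metis
  have "emeasure M U = emeasure M A + emeasure M (U - A)"
    using U A by (subst plus_emeasure) (auto simp: Un_absorb1)
  then have U_finite: "emeasure M U < \<infinity>"
    using A(2) U(3) by (simp add: less_top) (metis ennreal_less_top less_top order_less_trans)
  have "emeasure M (U - A) < ennreal (e / 2)"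
    by (fact U(3))
  then have "(INF V\<in>{V. open V \<and> U - A \<subseteq> V}. emeasure M V) < ennreal (e / 2)"
    using outer_regular[of "U - A"] U A by simp
  then obtain V where V: "open V" "U - A \<subseteq> V" "emeasure M V < ennreal (e / 2)"
    unfolding INF_less_iff by auto
  obtain K where K: "compact K" "K \<subseteq> U" "emeasure M (U - K) < ennreal (e / 2)"
    using inner_regular_open_diff[OF U(1) U_finite e2] by metis
  have "emeasure M (A - (K - V)) \<le> emeasure M ((U - K) \<union> V)"
    using U K V by (intro emeasure_mono) (auto intro!: sets.Un sets.Diff simp: borel_compact)
  also have "\<dots> \<le> emeasure M (U - K) + emeasure M V"
    using U K V by (intro emeasure_subadditive) (auto intro!: sets.Diff simp: borel_compact)
  also have "\<dots> < ennreal (e / 2) + ennreal (e / 2)"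
    by (rule add_strict_mono[OF K(3) V(3)])
  also have "\<dots> = e"
    using e by (simp flip: ennreal_plus)
  finally show thesis
    using that[of "K - V"] K V by (auto simp: compact_diff)
qed

lemma compact_exhaustion_null:
  assumes A: "A \<in> sets borel" "emeasure M A < \<infinity>"
  obtains K where "\<And>m::nat. compact (K m)" "\<And>m. K m \<subseteq> A" "A - (\<Union>m. K m) \<in> null_sets M"
proof -
  have "\<exists>K. compact K \<and> K \<subseteq> A \<and> emeasure M (A - K) < ennreal (1 / real (Suc m))" for m
    by (rule inner_regular_diff[OF A, of "1 / real (Suc m)"]) (simp, blast)
  then obtain K where K: "\<And>m::nat. compact (K m)" "\<And>m. K m \<subseteq> A" "\<And>m. emeasure M (A - K m) < ennreal (1 / real (Suc m))"
    by metis
  have "emeasure M (A - (\<Union>m. K m)) \<le> ennreal (1 / real (Suc m))" for m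
  proof -
    have "emeasure M (A - (\<Union>m. K m)) \<le> emeasure M (A - K m)"
      using A K by (intro emeasure_mono) (auto simp: borel_compact)
    then show ?thesis
      using K(3)[of m] by simp
  qed
  then have "emeasure M (A - (\<Union>m. K m)) \<le> ennreal 0"
    by (intro LIMSEQ_le_const[OF tendsto_ennrealI[OF lim_inverse_n', THEN LIMSEQ_Suc]]) auto
  moreover have "A - (\<Union>m. K m) \<in> sets M"
    using A K by (intro sets.Diff sets.countable_UN) (auto simp: borel_compact)
  ultimately show thesis
    by (intro that[OF K(1,2)]) auto
qed

lemma compact_exhaustion:
  assumes A: "\<And>n::nat. A n \<in> sets borel" "\<And>n. emeasure M (A n) < \<infinity>"
  obtains L where "\<And>j::nat. compact (L j)" "\<And>j. L j \<subseteq> (\<Union>n. A n)"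
    "AE x in M. x \<in> (\<Union>n. A n) \<longrightarrow> (\<forall>\<^sub>F j in sequentially. x \<in> L j)"
proof -
  have "\<exists>K. (\<forall>m::nat. compact (K m) \<and> K m \<subseteq> A n) \<and> A n - (\<Union>m. K m) \<in> null_sets M" for n
    by (rule compact_exhaustion_null[OF A]) blast
  then obtain K where K: "\<And>n m::nat. compact (K n m)" "\<And>n m. K n m \<subseteq> A n"
    and null: "\<And>n. A n - (\<Union>m. K n m) \<in> null_sets M"
    by metis
  define L where "L j = (\<Union>n\<in>{..j}. \<Union>m\<in>{..j}. K n m)" for j
  show thesis
  proof (rule that[of L])
    show "compact (L j)" for j
      unfolding L_def using K by (intro compact_UN) auto
    show "L j \<subseteq> (\<Union>n. A n)" for j
      unfolding L_def using K(2) by blast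
    have "AE x in M. \<forall>n. x \<notin> A n - (\<Union>m. K n m)"
      unfolding AE_all_countable by (intro allI AE_not_in null)
    then show "AE x in M. x \<in> (\<Union>n. A n) \<longrightarrow> (\<forall>\<^sub>F j in sequentially. x \<in> L j)"
    proof eventually_elim
      case (elim x)
      show ?case
      proof
        assume "x \<in> (\<Union>n. A n)"
        then obtain n m where "x \<in> K n m"
          using elim by auto
        then have "x \<in> L j" if "max n m \<le> j" for j
          unfolding L_def using that by auto
        then show "\<forall>\<^sub>F j in sequentially. x \<in> L j"
          by (rule eventually_sequentiallyI)
      qed
    qed
  qed
qed

subsubsection \<open>Continuous functions\<close>

lemma bump_at:
  assumes "open U" "(x::'g) \<in> U"
  obtains k where "bump {x} U k"
  using bump_exists[OF lc, of "{x}" U] assms by (metis compact_sing empty_subsetI insert_subset)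

lemma open_AE_notin: "open W \<Longrightarrow> AE x in M. x \<notin> W \<Longrightarrow> W = {}"
  using emeasure_open_pos[of W] by (subst (asm) AE_iff_measurable[where N = W]) auto

lemma continuous_eq_if_AE_eq:
  fixes f g :: "'g \<Rightarrow> 'b::t2_space"
  assumes "continuous_on UNIV f" "continuous_on UNIV g" "\<And>K. compact K \<Longrightarrow> AE x in M. x \<in> K \<longrightarrow> f x = g x"
  shows "f = g"
proof (rule ccontr)
  assume "f \<noteq> g"
  then obtain x where x: "f x \<noteq> g x"
    by auto
  have differ: "open {x. f x \<noteq> g x}"
    by (rule open_Collect_neq[OF assms(1,2)])
  then obtain V K where VK: "open V" "compact K" "x \<in> V" "V \<subseteq> K" "K \<subseteq> {x. f x \<noteq> g x}"
    using lc_group_compact_nbhd[OF lc differ, of x] x by auto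
  have "AE x in M. x \<notin> V"
    using assms(3)[OF VK(2)] by eventually_elim (use VK in auto)
  then show False
    using open_AE_notin[OF VK(1)] VK(3) by blast
qed

lemma integral_continuous_pos:
  fixes k :: "'g \<Rightarrow> real"
  assumes "continuous_on UNIV k" "\<And>x. 0 \<le> k x" "0 < k x0" "integrable M k"
  shows "0 < (\<integral>x. k x \<partial>M)"
proof -
  have "\<not> (AE x in M. k x = 0)"
  proof
    assume "AE x in M. k x = 0"
    then have "k = (\<lambda>_. 0)"
      by (intro continuous_eq_if_AE_eq) (use assms in auto)
    then show False
      using assms(3) by simp
  qed
  then show ?thesis
    using integral_nonneg_eq_0_iff_AE[OF assms(4)] assms(2) Bochner_Integration.integral_nonneg[of M k]
    by (simp add: less_le)
qed

lemma continuous_eq_0_if_orthogonal_Cc: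
  fixes \<Phi> :: "'g \<Rightarrow> real"
  assumes \<Phi>: "continuous_on UNIV \<Phi>" and orthogonal: "\<And>k. k \<in> Cc \<Longrightarrow> (\<integral>x. k x * \<Phi> x \<partial>M) = 0"
  shows "\<Phi> x = 0"
proof (rule ccontr)
  assume x: "\<Phi> x \<noteq> 0"
  obtain k where k: "bump {x} UNIV k"
    by (rule bump_at[OF open_UNIV UNIV_I])
  have k\<Phi>: "(\<lambda>y. k y * \<Phi> y) \<in> Cc"
    by (rule Cc_mult[OF bump_Cc[OF k] \<Phi>])
  have k\<Phi>\<Phi>: "(\<lambda>y. k y * \<Phi> y * \<Phi> y) \<in> Cc"
    by (rule Cc_mult[OF k\<Phi> \<Phi>])
  have "0 < (\<integral>y. k y * \<Phi> y * \<Phi> y \<partial>M)"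
  proof (rule integral_continuous_pos[OF Cc_continuous[OF k\<Phi>\<Phi>]])
    show "0 \<le> k y * \<Phi> y * \<Phi> y" for y
      using bump_nonneg[OF k] by (simp add: mult.assoc)
    show "0 < k x * \<Phi> x * \<Phi> x"
      using bump_eq_1[OF k] x by (simp add: zero_less_mult_iff) linarith
  qed (rule integrable_Cc[OF k\<Phi>\<Phi>])
  then show False
    using orthogonal[OF k\<Phi>] by simp
qed

lemma continuous_on_integral_plus:
  fixes f :: "'g \<Rightarrow> real"
  assumes f: "f \<in> Cc"
  shows "continuous_on UNIV (\<lambda>y. \<integral>x. f (x + y) \<partial>M)"
proof -
  obtain K where K: "compact K" "\<And>x. x \<notin> K \<Longrightarrow> f x = 0"
    using f by (rule CcE) blast
  have "continuous_on UNIV (\<lambda>y. \<integral>x. 1 * (\<lambda>z. f (snd z + fst z)) (y, x) \<partial>M)"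
  proof (rule continuous_on_param_integral)
    show "continuous_on UNIV (\<lambda>z. f (snd z + fst z))"
      by (rule continuous_on_compose2[OF Cc_continuous[OF f]]) (auto intro!: continuous_intros)
    show "locally_integrable (\<lambda>_. 1 :: real)"
      using emeasure_compact by (auto simp: locally_integrable_def set_integrable_def borel_compact)
    show "\<exists>V L. open V \<and> y \<in> V \<and> compact L \<and> (\<forall>y'\<in>V. \<forall>x. x \<notin> L \<longrightarrow> f (snd (y', x) + fst (y', x)) = 0)" for y
    proof -
      obtain V Q where V: "open V" "compact Q" "y \<in> V" "V \<subseteq> Q"
        by (rule lc_group_compact_nbhd[OF lc open_UNIV UNIV_I])
      let ?L = "{a + b |a b. a \<in> K \<and> b \<in> uminus ` Q}"
      have "f (x + y') = 0" if "y' \<in> V" "x \<notin> ?L" for x y'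
      proof (rule K(2), rule notI)
        assume "x + y' \<in> K"
        then have "(x + y') + - y' \<in> ?L"
          using that(1) V(4) by blast
        then show False
          using that(2) by (simp add: add.assoc)
      qed
      moreover have "compact ?L"
        by (intro compact_plus compact_uminus K V)
      ultimately show ?thesis
        using V by (intro exI[of _ V] exI[of _ ?L]) simp
    qed
  qed
  then show ?thesis
    by simp
qed

subsubsection \<open>Uniqueness\<close>

lemma haar_convolution_identity:
  fixes f k :: "'g \<Rightarrow> real"
  assumes N: "haar_measure N" and f: "f \<in> Cc" and k: "k \<in> Cc"
  shows "(\<integral>y. f y \<partial>N) * (\<integral>x. k x \<partial>M) = (\<integral>y. k (- y) * (\<integral>x. f (x + y) \<partial>M) \<partial>N)"
proof -
  interpret N: haar_group N
    using lc N by unfold_locales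
  note meas = borel_measurable_times[OF borel_measurable_continuous_onI borel_measurable_continuous_onI]
    continuous_on_compose2[OF Cc_continuous[OF f]] continuous_on_compose2[OF Cc_continuous[OF k]] continuous_on_minus_plus
  have "(\<lambda>z. f (fst (snd z, - snd z + fst z)) * k (snd (snd z, - snd z + fst z))) \<in> Cc"
    by (rule Cc_compose[OF Cc_tensor[OF f k], where g = "\<lambda>z. (fst z + snd z, fst z)"])
      (auto intro!: continuous_intros simp: add.assoc[symmetric])
  then have convolution_integrand: "(\<lambda>z. f (snd z) * k (- snd z + fst z)) \<in> Cc"
    by simp
  have "(\<lambda>z. f (fst (fst z + snd z, - snd z)) * k (snd (fst z + snd z, - snd z))) \<in> Cc"
    by (rule Cc_compose[OF Cc_tensor[OF f k], where g = "\<lambda>z. (fst z + snd z, - snd z)"])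
      (auto intro!: continuous_intros simp: add.assoc)
  then have translated_integrand: "(\<lambda>z. f (fst z + snd z) * k (- snd z)) \<in> Cc"
    by simp
  have "(\<integral>y. f y \<partial>N) * (\<integral>x. k x \<partial>M) = (\<integral>y. f y * (\<integral>x. k (- y + x) \<partial>M) \<partial>N)"
    by (simp add: integral_plus[OF Cc_measurable[OF k]])
  also have "\<dots> = (\<integral>y. \<integral>x. f y * k (- y + x) \<partial>M \<partial>N)"
    by simp
  also have "\<dots> = (\<integral>x. \<integral>y. f y * k (- y + x) \<partial>N \<partial>M)"
    using Fubini_Cc[OF compact_finite_axioms N.compact_finite_axioms convolution_integrand] by simp
  also have "\<dots> = (\<integral>x. \<integral>y. f (x + y) * k (- y) \<partial>N \<partial>M)"
  proof -
    have "(\<lambda>y. f y * k (- y + x)) \<in> borel_measurable borel" for x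
      by (intro meas) auto
    from N.integral_plus[OF this]
    have "(\<integral>y. f y * k (- y + x) \<partial>N) = (\<integral>y. f (x + y) * k (- (x + y) + x) \<partial>N)" for x
      by simp
    then show ?thesis
      by (simp add: minus_add add.assoc)
  qed
  also have "\<dots> = (\<integral>y. \<integral>x. f (x + y) * k (- y) \<partial>M \<partial>N)"
    using Fubini_Cc[OF compact_finite_axioms N.compact_finite_axioms translated_integrand] by simp
  finally show ?thesis
    by (simp add: mult.commute)
qed

lemma haar_integral_proportional:
  fixes f g :: "'g \<Rightarrow> real"
  assumes N: "haar_measure N" and f: "f \<in> Cc" and g: "g \<in> Cc"
  shows "(\<integral>x. f x \<partial>M) * (\<integral>x. g x \<partial>N) = (\<integral>x. g x \<partial>M) * (\<integral>x. f x \<partial>N)"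
proof -
  interpret N: haar_group N
    using lc N by unfold_locales
  define J where "J u y = (\<integral>x. u (x + y) \<partial>M)" for u :: "'g \<Rightarrow> real" and y
  define \<Phi> where "\<Phi> y = J f y * (\<integral>x. g x \<partial>N) - J g y * (\<integral>x. f x \<partial>N)" for y
  have J_cont: "continuous_on UNIV (J u)" if "u \<in> Cc" for u
    unfolding J_def by (rule continuous_on_integral_plus[OF that])
  have J_identity: "(\<integral>y. k y * J u y \<partial>N) = (\<integral>y. u y \<partial>N) * (\<integral>x. k (- x) \<partial>M)" if "u \<in> Cc" "k \<in> Cc" for u k
    unfolding J_def using haar_convolution_identity[OF N that(1) Cc_uminus[OF that(2)]] by simp
  have "\<Phi> 0 = 0"
  proof (rule N.continuous_eq_0_if_orthogonal_Cc)
    show "continuous_on UNIV \<Phi>"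
      unfolding \<Phi>_def by (intro continuous_intros J_cont f g)
    fix k :: "'g \<Rightarrow> real" assume k: "k \<in> Cc"
    have int: "integrable N (\<lambda>y. k y * J u y * c)" if "u \<in> Cc" for u c
      by (intro integrable_mult_left N.integrable_Cc Cc_mult[OF k J_cont[OF that]])
    have "(\<integral>y. k y * \<Phi> y \<partial>N) = (\<integral>y. k y * J f y * (\<integral>x. g x \<partial>N) - k y * J g y * (\<integral>x. f x \<partial>N) \<partial>N)"
      by (simp add: \<Phi>_def right_diff_distrib mult.assoc)
    also have "\<dots> = (\<integral>y. k y * J f y \<partial>N) * (\<integral>x. g x \<partial>N) - (\<integral>y. k y * J g y \<partial>N) * (\<integral>x. f x \<partial>N)"
      using int[OF f] int[OF g] by simp
    also have "\<dots> = 0"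
      by (simp add: J_identity f g k)
    finally show "(\<integral>y. k y * \<Phi> y \<partial>N) = 0" .
  qed
  then show ?thesis
    by (simp add: \<Phi>_def J_def)
qed

lemma emeasure_compact_le_if_nn_integral_Cc_le:
  assumes sets_N: "sets N = sets borel"
    and le: "\<And>v. v \<in> Cc \<Longrightarrow> (\<And>x. 0 \<le> v x) \<Longrightarrow> (\<integral>\<^sup>+x. ennreal (v x) \<partial>N) \<le> C * (\<integral>\<^sup>+x. ennreal (v x) \<partial>M)"
    and K: "compact K" "open U" "K \<subseteq> U"
  shows "emeasure N K \<le> C * emeasure M U"
proof -
  obtain k where k: "bump K U k"
    by (rule bump_exists[OF lc K])
  have "emeasure N K = (\<integral>\<^sup>+x. indicator K x \<partial>N)"
    using K sets_N by (simp add: borel_compact)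
  also have "\<dots> \<le> (\<integral>\<^sup>+x. ennreal (k x) \<partial>N)"
    using bump_eq_1[OF k] by (intro nn_integral_mono) (simp add: indicator_def)
  also have "\<dots> \<le> C * (\<integral>\<^sup>+x. ennreal (k x) \<partial>M)"
    by (rule le[OF bump_Cc[OF k] bump_nonneg[OF k]])
  also have "\<dots> \<le> C * (\<integral>\<^sup>+x. indicator U x \<partial>M)"
    using bump_le_1[OF k] bump_eq_0[OF k] by (intro mult_left_mono nn_integral_mono) (auto simp: indicator_def)
  also have "\<dots> = C * emeasure M U"
    using K by simp
  finally show ?thesis .
qed

lemma emeasure_le_if_nn_integral_Cc_le:
  assumes sets_N: "sets N = sets borel"
    and inner: "\<And>U. open U \<Longrightarrow> emeasure N U \<le> (SUP K\<in>{K. compact K \<and> K \<subseteq> U}. emeasure N K)"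
    and C: "0 < C"
    and le: "\<And>v. v \<in> Cc \<Longrightarrow> (\<And>x. 0 \<le> v x) \<Longrightarrow> (\<integral>\<^sup>+x. ennreal (v x) \<partial>N) \<le> ennreal C * (\<integral>\<^sup>+x. ennreal (v x) \<partial>M)"
    and A: "A \<in> sets borel"
  shows "emeasure N A \<le> ennreal C * emeasure M A"
proof -
  have le_open: "emeasure N U \<le> ennreal C * emeasure M U" if U: "open U" for U
    by (rule order_trans[OF inner[OF U] SUP_least])
      (use emeasure_compact_le_if_nn_integral_Cc_le[OF sets_N le _ U] in blast)
  have C_cancel: "ennreal C * (emeasure N A / ennreal C) = emeasure N A"
    using C by (simp add: ennreal_times_divide ennreal_mult_divide_eq mult.commute[of "ennreal C"])
  have "emeasure N A / ennreal C \<le> emeasure M A"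
    unfolding outer_regular[OF A]
  proof (rule INF_greatest)
    fix U assume "U \<in> {U. open U \<and> A \<subseteq> U}"
    then have U: "open U" "A \<subseteq> U"
      by auto
    have "emeasure N A \<le> ennreal C * emeasure M U"
      using U sets_N by (intro order_trans[OF emeasure_mono le_open]) auto
    then show "emeasure N A / ennreal C \<le> emeasure M U"
      using C by (intro divide_le_posI_ennreal) simp_all
  qed
  then have "ennreal C * (emeasure N A / ennreal C) \<le> ennreal C * emeasure M A"
    by (rule mult_left_mono) simp
  then show ?thesis
    unfolding C_cancel .
qed

lemma haar_measure_le:
  assumes N: "haar_measure N" and C: "0 < C"
    and eq: "\<And>v. v \<in> Cc \<Longrightarrow> (\<integral>x. v x \<partial>N) = C * (\<integral>x. v x \<partial>M)" and A: "A \<in> sets borel"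
  shows "emeasure N A \<le> ennreal C * emeasure M A"
proof -
  interpret N: haar_group N
    using lc N by unfold_locales
  show ?thesis
  proof (rule emeasure_le_if_nn_integral_Cc_le[OF N.sets_haar _ C _ A])
    show "emeasure N U \<le> (SUP K\<in>{K. compact K \<and> K \<subseteq> U}. emeasure N K)" if "open U" for U
      using N.inner_regular_open[OF that] by simp
    fix v :: "'g \<Rightarrow> real" assume v: "v \<in> Cc" "\<And>x. 0 \<le> v x"
    then show "(\<integral>\<^sup>+x. ennreal (v x) \<partial>N) \<le> ennreal C * (\<integral>\<^sup>+x. ennreal (v x) \<partial>M)"
      using eq[OF v(1)] C
      by (simp add: nn_integral_eq_integral[OF integrable_Cc] nn_integral_eq_integral[OF N.integrable_Cc] ennreal_mult)
  qed
qed

theorem haar_measure_unique: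
  assumes N: "haar_measure N"
  obtains c where "0 < c" "\<And>A. A \<in> sets borel \<Longrightarrow> emeasure N A = ennreal c * emeasure M A"
proof -
  interpret N: haar_group N
    using lc N by unfold_locales
  obtain k where k: "bump {0 :: 'g} UNIV k"
    by (rule bump_at[OF open_UNIV UNIV_I])
  have pos: "0 < (\<integral>x. k x \<partial>N)" "0 < (\<integral>x. k x \<partial>M)"
    using bump_Cc[OF k] bump_nonneg[OF k] bump_eq_1[OF k, of 0]
    by (auto intro!: N.integral_continuous_pos[of k 0] integral_continuous_pos[of k 0] N.integrable_Cc integrable_Cc Cc_continuous)
  define c where "c = (\<integral>x. k x \<partial>N) / (\<integral>x. k x \<partial>M)"
  have c: "0 < c"
    using pos by (simp add: c_def)
  have eq: "(\<integral>x. v x \<partial>N) = c * (\<integral>x. v x \<partial>M)" if "v \<in> Cc" for v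
    using haar_integral_proportional[OF N that bump_Cc[OF k]] pos by (simp add: c_def field_simps)
  then have eq': "(\<integral>x. v x \<partial>M) = (1 / c) * (\<integral>x. v x \<partial>N)" if "v \<in> Cc" for v
    using that c by simp
  have "emeasure N A = ennreal c * emeasure M A" if A: "A \<in> sets borel" for A
  proof (rule antisym)
    show "emeasure N A \<le> ennreal c * emeasure M A"
      by (rule haar_measure_le[OF N c eq A])
    have "emeasure M A \<le> ennreal (1 / c) * emeasure N A"
      using c by (intro N.haar_measure_le[OF haar _ eq' A]) simp_all
    then have "ennreal c * emeasure M A \<le> ennreal c * (ennreal (1 / c) * emeasure N A)"
      by (rule mult_left_mono) simp
    also have "\<dots> = emeasure N A"
      using c by (simp add: mult.assoc[symmetric] flip: ennreal_mult'')
    finally show "ennreal c * emeasure M A \<le> emeasure N A" .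
  qed
  then show thesis
    by (rule that[OF c])
qed

subsubsection \<open>Inversion\<close>

lemma Cc_integral_plus_ge:
  assumes K: "compact K"
  obtains f :: "'g \<Rightarrow> real" and m where "f \<in> Cc" "\<And>x. 0 \<le> f x" "0 < m" "\<And>y. y \<in> K \<Longrightarrow> m \<le> (\<integral>x. f (x + y) \<partial>M)"
proof -
  obtain V L where V: "open V" "compact L" "(0::'g) \<in> V" "V \<subseteq> L"
    by (rule lc_group_compact_nbhd[OF lc open_UNIV UNIV_I])
  have "emeasure M V \<le> emeasure M L"
    using V by (intro emeasure_mono) (auto simp: borel_compact)
  then have "0 < emeasure M L"
    using emeasure_open_pos[of V] V by (auto intro: less_le_trans)
  then have L_pos: "0 < measure M L"
    using emeasure_compact[OF V(2)] by (simp add: measure_def enn2real_positive_iff)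
  have "compact {x + y |x y. x \<in> L \<and> y \<in> K}"
    by (intro compact_plus V K)
  then obtain f where f: "bump {x + y |x y. x \<in> L \<and> y \<in> K} UNIV f"
    by (rule bump_exists[OF lc _ open_UNIV subset_UNIV])
  have "measure M L \<le> (\<integral>x. f (x + y) \<partial>M)" if "y \<in> K" for y
  proof -
    have f_translate: "(\<lambda>x. f (x + y)) \<in> Cc"
      by (rule Cc_compose[OF bump_Cc[OF f], where g = "\<lambda>z. z + - y"]) (auto intro!: continuous_intros simp: add.assoc)
    have "measure M L = (\<integral>x. indicator L x \<partial>M)"
      using V(2) by (simp add: borel_compact)
    also have "\<dots> \<le> (\<integral>x. f (x + y) \<partial>M)"
    proof (rule integral_mono[OF _ integrable_Cc[OF f_translate]])
      show "integrable M (indicator L :: 'g \<Rightarrow> real)"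
        using V(2) emeasure_compact by (auto simp: borel_compact)
      have "f (x + y) = 1" if "x \<in> L" for x
        using that \<open>y \<in> K\<close> by (intro bump_eq_1[OF f]) blast
      then show "indicator L x \<le> f (x + y)" for x
        using bump_nonneg[OF f] by (simp add: indicator_def)
    qed
    finally show ?thesis .
  qed
  then show thesis
    by (rule that[OF bump_Cc[OF f] bump_nonneg[OF f] L_pos])
qed

lemma integral_uminus_compact_le:
  assumes K: "compact K"
  obtains C where "0 < C"
    "\<And>v :: 'g \<Rightarrow> real. v \<in> Cc \<Longrightarrow> (\<And>x. 0 \<le> v x) \<Longrightarrow> (LINT y:K|M. v (- y)) \<le> C * (\<integral>y. v y \<partial>M)"
proof -
  obtain f :: "'g \<Rightarrow> real" and m where f: "f \<in> Cc" "\<And>x. 0 \<le> f x"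
    and m: "0 < m" "\<And>y. y \<in> K \<Longrightarrow> m \<le> (\<integral>x. f (x + y) \<partial>M)"
    by (rule Cc_integral_plus_ge[OF K]) blast
  define J where "J y = (\<integral>x. f (x + y) \<partial>M)" for y
  have J: "continuous_on UNIV J" "0 \<le> J y" for y
    unfolding J_def using f by (auto intro: continuous_on_integral_plus Bochner_Integration.integral_nonneg)
  show thesis
  proof (rule that)
    show "0 < (\<integral>y. f y \<partial>M) / m + 1"
      using m(1) f(2) by (intro add_nonneg_pos divide_nonneg_pos Bochner_Integration.integral_nonneg) auto
    fix v :: "'g \<Rightarrow> real" assume v: "v \<in> Cc" "\<And>x. 0 \<le> v x"
    have int: "set_integrable M K (\<lambda>y. v (- y))"
      using integrable_Cc[OF Cc_uminus[OF v(1)]] K unfolding set_integrable_def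
      by (intro integrable_mult_indicator) (auto simp: borel_compact)
    have "(LINT y:K|M. v (- y)) * m = (LINT y:K|M. v (- y) * m)"
      by simp
    also have "\<dots> \<le> (\<integral>y. v (- y) * J y \<partial>M)"
      unfolding set_lebesgue_integral_def
    proof (rule integral_mono)
      show "integrable M (\<lambda>y. indicator K y *\<^sub>R (v (- y) * m))"
        using set_integrable_mult_left[OF int] by (simp add: set_integrable_def)
      show "integrable M (\<lambda>y. v (- y) * J y)"
        by (intro integrable_Cc Cc_mult Cc_uminus v J)
      show "indicator K y *\<^sub>R (v (- y) * m) \<le> v (- y) * J y" for y
        using v(2)[of "- y"] m(2)[of y] J(2)[of y] by (cases "y \<in> K") (auto simp: J_def intro: mult_left_mono)
    qed
    also have "\<dots> = (\<integral>y. f y \<partial>M) * (\<integral>y. v y \<partial>M)"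
      unfolding J_def using haar_convolution_identity[OF haar f(1) v(1)] by simp
    finally have "(LINT y:K|M. v (- y)) \<le> (\<integral>y. f y \<partial>M) / m * (\<integral>y. v y \<partial>M)"
      using m(1) by (simp add: field_simps)
    also have "\<dots> \<le> ((\<integral>y. f y \<partial>M) / m + 1) * (\<integral>y. v y \<partial>M)"
      using v(2) by (intro mult_right_mono Bochner_Integration.integral_nonneg) auto
    finally show "(LINT y:K|M. v (- y)) \<le> ((\<integral>y. f y \<partial>M) / m + 1) * (\<integral>y. v y \<partial>M)" .
  qed
qed

lemma measurable_uminus [measurable]: "(uminus :: 'g \<Rightarrow> 'g) \<in> M \<rightarrow>\<^sub>M M"
  using borel_measurable_continuous_onI[OF continuous_on_uminus] by (simp cong: measurable_cong_sets)

definition reflected :: "'g set \<Rightarrow> 'g measure" where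
  "reflected K = distr (density M (indicator K)) M uminus"

lemma sets_reflected: "sets (reflected K) = sets borel"
  by (simp add: reflected_def)

lemma nn_integral_reflected:
  assumes K: "compact K" and u: "u \<in> borel_measurable borel"
  shows "(\<integral>\<^sup>+y. u y \<partial>reflected K) = (\<integral>\<^sup>+y. indicator K y * u (- y) \<partial>M)"
proof -
  have u': "u \<in> borel_measurable M"
    using u by simp
  have "(\<integral>\<^sup>+y. u y \<partial>reflected K) = (\<integral>\<^sup>+y. u (- y) \<partial>density M (indicator K))"
    unfolding reflected_def using u' by (intro nn_integral_distr) simp_all
  also have "\<dots> = (\<integral>\<^sup>+y. indicator K y * u (- y) \<partial>M)"
    using borel_compact[OF K] by (intro nn_integral_density measurable_compose[OF measurable_uminus u'] borel_measurable_indicator) simp_all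
  finally show ?thesis .
qed

lemma emeasure_reflected:
  assumes "compact K" "B \<in> sets borel"
  shows "emeasure (reflected K) B = emeasure M (K \<inter> uminus -` B)"
proof -
  have "uminus \<in> density M (indicator K) \<rightarrow>\<^sub>M M"
    by simp
  then show ?thesis
    using assms measurable_sets[OF measurable_uminus, of B]
    by (simp add: reflected_def emeasure_distr emeasure_restricted borel_compact)
qed

lemma inner_regular_reflected:
  assumes K: "compact K" and U: "open U"
  shows "emeasure (reflected K) U \<le> (SUP L\<in>{L. compact L \<and> L \<subseteq> U}. emeasure (reflected K) L)"
proof (rule ennreal_le_epsilon)
  fix e :: real assume e: "0 < e"
  let ?A = "K \<inter> uminus -` U"
  have A: "?A \<in> sets borel"
    using K measurable_sets[OF measurable_uminus, of U] U by (auto simp: borel_compact)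
  have "emeasure M ?A < \<infinity>"
    using emeasure_mono[of ?A K M] K emeasure_compact[OF K] by (auto simp: borel_compact intro: le_less_trans)
  then obtain L where L: "compact L" "L \<subseteq> ?A" "emeasure M (?A - L) < e"
    by (rule inner_regular_diff[OF A _ e])
  have "emeasure (reflected K) U = emeasure M L + emeasure M (?A - L)"
    using L A U K by (subst plus_emeasure) (auto simp: emeasure_reflected Un_absorb1 borel_compact)
  also have "emeasure M L = emeasure (reflected K) (uminus ` L)"
    using L K compact_uminus[OF L(1)]
    by (subst emeasure_reflected) (auto simp: borel_compact intro!: arg_cong[where f = "emeasure M"])
  also have "\<dots> \<le> (SUP L\<in>{L. compact L \<and> L \<subseteq> U}. emeasure (reflected K) L)"
    using L compact_uminus[OF L(1)] by (intro SUP_upper) auto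
  finally show "emeasure (reflected K) U \<le> (SUP L\<in>{L. compact L \<and> L \<subseteq> U}. emeasure (reflected K) L) + ennreal e"
    using L(3) by (meson add_mono less_imp_le order_refl order_trans)
qed

lemma nn_integral_uminus_compact_le:
  assumes K: "compact K"
  obtains C where "0 < C"
    "\<And>u. u \<in> borel_measurable borel \<Longrightarrow> (\<integral>\<^sup>+y. indicator K y * u (- y) \<partial>M) \<le> ennreal C * (\<integral>\<^sup>+y. u y \<partial>M)"
proof -
  obtain C where C: "0 < C"
    and C_le: "\<And>v :: 'g \<Rightarrow> real. v \<in> Cc \<Longrightarrow> (\<And>x. 0 \<le> v x) \<Longrightarrow> (LINT y:K|M. v (- y)) \<le> C * (\<integral>y. v y \<partial>M)"
    using integral_uminus_compact_le[OF K] by blast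
  have "emeasure (reflected K) B \<le> ennreal C * emeasure M B" if "B \<in> sets borel" for B
  proof (rule emeasure_le_if_nn_integral_Cc_le[OF sets_reflected inner_regular_reflected[OF K] C _ that])
    fix v :: "'g \<Rightarrow> real" assume v: "v \<in> Cc" "\<And>x. 0 \<le> v x"
    have int: "integrable M (\<lambda>y. indicator K y *\<^sub>R v (- y))"
      using K by (intro integrable_mult_indicator integrable_Cc Cc_uminus v) (simp add: borel_compact)
    have "(\<integral>\<^sup>+y. ennreal (v y) \<partial>reflected K) = (\<integral>\<^sup>+y. ennreal (indicator K y *\<^sub>R v (- y)) \<partial>M)"
      using Cc_measurable[OF v(1)] v(2)
      by (subst nn_integral_reflected[OF K]) (auto simp: ennreal_mult' ennreal_indicator)
    also have "\<dots> = ennreal (LINT y:K|M. v (- y))"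
      unfolding set_lebesgue_integral_def using v(2) by (intro nn_integral_eq_integral int) auto
    also have "\<dots> \<le> ennreal (C * (\<integral>y. v y \<partial>M))"
      by (intro ennreal_leI C_le v)
    also have "\<dots> = ennreal C * (\<integral>\<^sup>+y. ennreal (v y) \<partial>M)"
      using C v(2) by (simp add: nn_integral_eq_integral[OF integrable_Cc[OF v(1)]] ennreal_mult')
    finally show "(\<integral>\<^sup>+y. ennreal (v y) \<partial>reflected K) \<le> ennreal C * (\<integral>\<^sup>+y. ennreal (v y) \<partial>M)" .
  qed
  then have le: "reflected K \<le> scale_measure (ennreal C) M"
    by (subst le_measure) (auto simp: sets_reflected)
  show thesis
  proof (rule that[OF C])
    fix u :: "'g \<Rightarrow> ennreal" assume u: "u \<in> borel_measurable borel"
    have "(\<integral>\<^sup>+y. u y \<partial>reflected K) \<le> (\<integral>\<^sup>+y. u y \<partial>scale_measure (ennreal C) M)"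
      by (rule nn_integral_mono_measure[OF _ le]) (simp add: sets_reflected)
    then show "(\<integral>\<^sup>+y. indicator K y * u (- y) \<partial>M) \<le> ennreal C * (\<integral>\<^sup>+y. u y \<partial>M)"
      using u by (simp add: nn_integral_reflected[OF K] nn_integral_scale_measure)
  qed
qed

lemma AE_uminus_compact:
  assumes K: "compact K" and P: "AE y in M. P y"
  shows "AE y in M. y \<in> K \<longrightarrow> P (- y)"
proof -
  obtain Z where Z: "Z \<in> null_sets M" "{y. \<not> P y} \<subseteq> Z"
    using P by (auto simp: eventually_ae_filter)
  have Z_meas: "(indicator Z :: 'g \<Rightarrow> ennreal) \<in> borel_measurable borel"
    using Z by auto
  obtain C where "(\<integral>\<^sup>+y. indicator K y * indicator Z (- y) \<partial>M) \<le> ennreal C * (\<integral>\<^sup>+y. indicator Z y \<partial>M)"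
    using nn_integral_uminus_compact_le[OF K] Z_meas by blast
  moreover have "(\<integral>\<^sup>+y. indicator Z y \<partial>M) = 0"
    using Z(1) by (simp add: null_sets_def)
  ultimately have "(\<integral>\<^sup>+y. indicator K y * indicator Z (- y) \<partial>M) = 0"
    by simp
  moreover have "(\<lambda>y. indicator K y * indicator Z (- y) :: ennreal) \<in> borel_measurable M"
    using K measurable_compose[OF measurable_uminus, of "indicator Z :: 'g \<Rightarrow> ennreal" borel] Z_meas
    by (intro borel_measurable_times_ennreal borel_measurable_indicator) (auto simp: borel_compact)
  ultimately have "AE y in M. indicator K y * indicator Z (- y) = (0 :: ennreal)"
    by (subst (asm) nn_integral_0_iff_AE) auto
  then show ?thesis
    by eventually_elim (use Z in \<open>auto simp: indicator_def split: if_splits\<close>)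
qed

lemma nn_integral_minus_plus_compact_le:
  assumes K: "compact K"
  obtains C where "0 < C"
    "\<And>u. u \<in> borel_measurable borel \<Longrightarrow> (\<integral>\<^sup>+y. indicator K y * u (- y + x) \<partial>M) \<le> ennreal C * (\<integral>\<^sup>+y. u y \<partial>M)"
proof -
  let ?K = "(+) (- x) ` K"
  have "compact ?K"
    by (rule compact_continuous_image[OF continuous_on_plus_left K])
  then obtain C where C: "0 < C"
    and C_le: "\<And>u. u \<in> borel_measurable borel \<Longrightarrow> (\<integral>\<^sup>+y. indicator ?K y * u (- y) \<partial>M) \<le> ennreal C * (\<integral>\<^sup>+y. u y \<partial>M)"
    using nn_integral_uminus_compact_le by blast
  show thesis
  proof (rule that[OF C])
    fix u :: "'g \<Rightarrow> ennreal" assume u: "u \<in> borel_measurable borel"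
    have "x + y \<in> K \<longleftrightarrow> y \<in> ?K" for y
      by (metis (no_types, opaque_lifting) add.assoc add.left_inverse add.left_neutral add.right_inverse image_iff)
    then have integrand: "indicator K (x + y) * u (- (x + y) + x) = indicator ?K y * u (- y)" for y
      by (simp add: indicator_def minus_add add.assoc)
    have [measurable]: "K \<in> sets borel" "(\<lambda>y. u (- y + x)) \<in> borel_measurable borel"
      by (fact borel_compact[OF K] measurable_compose[OF borel_measurable_continuous_onI[OF continuous_on_minus_plus] u])+
    have "(\<lambda>y. indicator K y * u (- y + x)) \<in> borel_measurable borel"
      by measurable
    from nn_integral_plus[OF this, of x]
    have "(\<integral>\<^sup>+y. indicator K y * u (- y + x) \<partial>M) = (\<integral>\<^sup>+y. indicator ?K y * u (- y) \<partial>M)"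
      by (simp only: integrand)
    also have "\<dots> \<le> ennreal C * (\<integral>\<^sup>+y. u y \<partial>M)"
      by (rule C_le[OF u])
    finally show "(\<integral>\<^sup>+y. indicator K y * u (- y + x) \<partial>M) \<le> ennreal C * (\<integral>\<^sup>+y. u y \<partial>M)" .
  qed
qed

lemma set_integral_minus_plus_le:
  assumes K: "compact K"
  obtains C where "0 < C"
    "\<And>g :: 'g \<Rightarrow> complex. g \<in> borel_measurable borel \<Longrightarrow> set_integrable M ((\<lambda>y. - y + x) ` K) g \<Longrightarrow>
      set_integrable M K (\<lambda>y. g (- y + x)) \<and>
      (LINT y:K|M. norm (g (- y + x))) \<le> C * (LINT y:(\<lambda>y. - y + x) ` K|M. norm (g y))"
proof -
  define L where "L = (\<lambda>y. - y + x) ` K"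
  have L: "L \<in> sets borel"
    unfolding L_def by (intro borel_compact compact_continuous_image continuous_on_minus_plus K)
  obtain C where C: "0 < C" and C_le: "\<And>u. u \<in> borel_measurable borel \<Longrightarrow>
      (\<integral>\<^sup>+y. indicator K y * u (- y + x) \<partial>M) \<le> ennreal C * (\<integral>\<^sup>+y. u y \<partial>M)"
    using nn_integral_minus_plus_compact_le[OF K] by blast
  show thesis
  proof (rule that[OF C], unfold L_def[symmetric])
    fix g :: "'g \<Rightarrow> complex"
    assume g: "g \<in> borel_measurable borel" and int_L: "set_integrable M L g"
    define u where "u y = ennreal (norm (indicator L y *\<^sub>R g y))" for y
    have u: "u \<in> borel_measurable borel"
      unfolding u_def using g L by measurable
    have meas: "(\<lambda>y. indicator K y *\<^sub>R g (- y + x)) \<in> borel_measurable M"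
      unfolding borel_measurable_eq using K measurable_compose[OF borel_measurable_continuous_onI[OF continuous_on_minus_plus] g]
      by (intro borel_measurable_scaleR borel_measurable_indicator) (simp_all add: borel_compact)
    have "(\<integral>\<^sup>+y. ennreal (norm (indicator K y *\<^sub>R g (- y + x))) \<partial>M) = (\<integral>\<^sup>+y. indicator K y * u (- y + x) \<partial>M)"
      by (intro nn_integral_cong) (auto simp: u_def L_def indicator_def)
    also have "\<dots> \<le> ennreal C * (\<integral>\<^sup>+y. u y \<partial>M)"
      by (rule C_le[OF u])
    also have "(\<integral>\<^sup>+y. u y \<partial>M) = ennreal (LINT y:L|M. norm (g y))"
      unfolding u_def using nn_integral_eq_integral[OF integrable_norm[OF int_L[unfolded set_integrable_def]]]
      by (simp add: set_lebesgue_integral_def)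
    also have "ennreal C * \<dots> = ennreal (C * (LINT y:L|M. norm (g y)))"
      using C by (simp add: ennreal_mult')
    finally have le: "(\<integral>\<^sup>+y. ennreal (norm (indicator K y *\<^sub>R g (- y + x))) \<partial>M) \<le> ennreal (C * (LINT y:L|M. norm (g y)))" .
    have "0 \<le> (LINT y:L|M. norm (g y))"
      unfolding set_lebesgue_integral_def by (intro integral_nonneg_AE) simp
    then have "0 \<le> C * (LINT y:L|M. norm (g y))"
      using C by simp
    from integrable_if_nn_integral_norm_le[OF meas this le]
    have "integrable M (\<lambda>y. indicator K y *\<^sub>R g (- y + x))"
      and "(LINT y:K|M. norm (g (- y + x))) \<le> C * (LINT y:L|M. norm (g y))"
      by (simp_all add: set_lebesgue_integral_def)
    then show "set_integrable M K (\<lambda>y. g (- y + x)) \<and> (LINT y:K|M. norm (g (- y + x))) \<le> C * (LINT y:L|M. norm (g y))"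
      by (simp add: set_integrable_def)
  qed
qed

end

subsubsection \<open>Transport along an isomorphism\<close>

locale homeomorphism_pair =
  fixes \<phi> :: "'a::t2_space \<Rightarrow> 'b::t2_space" and \<psi> :: "'b \<Rightarrow> 'a"
  assumes \<phi>_homeo: "continuous_on UNIV \<phi>" and \<psi>_homeo: "continuous_on UNIV \<psi>"
    and \<phi>_\<psi>: "\<phi> (\<psi> y) = y" and \<psi>_\<phi>: "\<psi> (\<phi> x) = x"
begin

lemma \<phi>_measurable: "\<phi> \<in> borel_measurable borel" and \<psi>_measurable: "\<psi> \<in> borel_measurable borel"
  by (intro borel_measurable_continuous_onI \<phi>_homeo \<psi>_homeo)+

lemma bij_\<phi>: "bij \<phi>" and bij_\<psi>: "bij \<psi>"
  using bij_betw_byWitness[of UNIV \<psi> \<phi> UNIV] bij_betw_byWitness[of UNIV \<phi> \<psi> UNIV] by (auto simp: \<phi>_\<psi> \<psi>_\<phi>)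

lemma inv_\<phi>: "inv \<phi> = \<psi>" and inv_\<psi>: "inv \<psi> = \<phi>"
  by (rule inv_equality; simp add: \<phi>_\<psi> \<psi>_\<phi>)+

lemma \<phi>_image: "\<phi> ` A = \<psi> -` A" and \<psi>_image: "\<psi> ` B = \<phi> -` B"
  by (simp_all only: bij_vimage_eq_inv_image[OF bij_\<psi>] bij_vimage_eq_inv_image[OF bij_\<phi>] inv_\<phi> inv_\<psi>)

lemma open_\<psi>_image_iff: "open (\<psi> ` U) \<longleftrightarrow> open U"
  using open_vimage[OF _ \<phi>_homeo, of U] open_vimage[OF _ \<psi>_homeo, of "\<psi> ` U"] inj_vimage_image_eq[OF bij_is_inj[OF bij_\<psi>], of U]
  by (auto simp: \<psi>_image)

lemma compact_\<psi>_image_iff: "compact (\<psi> ` K) \<longleftrightarrow> compact K"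
  using compact_continuous_image[OF continuous_on_subset[OF \<psi>_homeo], of K]
    compact_continuous_image[OF continuous_on_subset[OF \<phi>_homeo], of "\<psi> ` K"]
  by (auto simp: image_image \<phi>_\<psi>)

lemma borel_\<psi>_image: "B \<in> sets borel \<Longrightarrow> \<psi> ` B \<in> sets borel"
  using measurable_sets[OF \<phi>_measurable, of B] by (simp add: \<psi>_image)

lemma \<psi>_image_subset_iff: "\<psi> ` A \<subseteq> \<psi> ` B \<longleftrightarrow> A \<subseteq> B"
  by (rule inj_image_subset_iff[OF bij_is_inj[OF bij_\<psi>]])

lemma Collect_eq_\<psi>_image: "{V. P V \<and> Q V} = (`) \<psi> ` {U. P (\<psi> ` U) \<and> Q (\<psi> ` U)}"
proof (intro set_eqI iffI)
  fix V assume "V \<in> {V. P V \<and> Q V}"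
  moreover have "V = \<psi> ` \<phi> ` V"
    by (simp add: image_image \<psi>_\<phi>)
  ultimately show "V \<in> (`) \<psi> ` {U. P (\<psi> ` U) \<and> Q (\<psi> ` U)}"
    by (metis (mono_tags, lifting) imageI mem_Collect_eq)
qed auto

end

locale haar_group_homeomorphism = haar_group M + homeomorphism_pair \<phi> \<psi>
  for M :: "'g::{topological_group_add,t2_space} measure" and \<phi> :: "'g \<Rightarrow> 'h::{topological_group_add,t2_space}" and \<psi> +
  assumes \<phi>_add: "\<phi> (x + y) = \<phi> x + \<phi> y"
begin

lemma emeasure_distr_eq: "B \<in> sets borel \<Longrightarrow> emeasure (distr M borel \<phi>) B = emeasure M (\<psi> ` B)"
  using \<phi>_measurable by (simp add: emeasure_distr \<psi>_image)

lemma emeasure_distr_plus_image: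
  assumes B: "B \<in> sets borel"
  shows "emeasure (distr M borel \<phi>) ((+) x ` B) = emeasure (distr M borel \<phi>) B"
proof -
  have "(+) x ` B = (+) (- x) -` B"
    by (auto simp: image_iff add.assoc[symmetric]) (metis add.assoc add.left_neutral add.right_inverse)
  then have "(+) x ` B \<in> sets borel"
    using measurable_sets[OF borel_measurable_continuous_onI[OF continuous_on_plus_left] B, of "- x"] by simp
  moreover have "\<psi> ` (+) x ` B = (+) (\<psi> x) ` \<psi> ` B"
    by (simp add: image_image) (metis \<phi>_add \<phi>_\<psi> \<psi>_\<phi>)
  ultimately show ?thesis
    using B by (simp add: emeasure_distr_eq emeasure_plus_image borel_\<psi>_image)
qed

lemma outer_regular_distr:
  assumes B: "B \<in> sets borel"
  shows "emeasure (distr M borel \<phi>) B = (INF U\<in>{U. open U \<and> B \<subseteq> U}. emeasure (distr M borel \<phi>) U)"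
proof -
  have "emeasure (distr M borel \<phi>) B = (INF U\<in>{U. open U \<and> B \<subseteq> U}. emeasure M (\<psi> ` U))"
    unfolding emeasure_distr_eq[OF B] outer_regular[OF borel_\<psi>_image[OF B]]
      Collect_eq_\<psi>_image open_\<psi>_image_iff \<psi>_image_subset_iff image_image ..
  then show ?thesis
    by (simp add: emeasure_distr_eq cong: INF_cong_simp)
qed

lemma inner_regular_distr:
  assumes U: "open U"
  shows "emeasure (distr M borel \<phi>) U = (SUP K\<in>{K. compact K \<and> K \<subseteq> U}. emeasure (distr M borel \<phi>) K)"
proof -
  have "emeasure (distr M borel \<phi>) U = (SUP K\<in>{K. compact K \<and> K \<subseteq> U}. emeasure M (\<psi> ` K))"
    unfolding emeasure_distr_eq[OF borel_open[OF U]] inner_regular_open[OF open_\<psi>_image_iff[THEN iffD2, OF U]]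
      Collect_eq_\<psi>_image compact_\<psi>_image_iff \<psi>_image_subset_iff image_image ..
  then show ?thesis
    by (simp add: emeasure_distr_eq borel_compact cong: SUP_cong_simp)
qed

theorem haar_measure_distr: "haar_measure (distr M borel \<phi>)"
  unfolding haar_measure_def
proof (intro conjI allI ballI impI emeasure_distr_plus_image outer_regular_distr inner_regular_distr)
  show "emeasure (distr M borel \<phi>) K < \<infinity>" if "compact K" for K
    using that emeasure_compact[of "\<psi> ` K"] by (simp add: emeasure_distr_eq compact_\<psi>_image_iff borel_compact)
  show "0 < emeasure (distr M borel \<phi>) U" if "open U \<and> U \<noteq> {}" for U
    using that emeasure_open_pos[of "\<psi> ` U"] by (simp add: emeasure_distr_eq open_\<psi>_image_iff)
qed simp

end

subsection \<open>Weighted Lebesgue spaces\<close>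

lemma powr_convex_nonneg:
  assumes "1 \<le> p"
  shows "convex_on {0..} (\<lambda>x::real. x powr p)"
proof (rule convex_onI)
  fix t x y :: real
  assume t: "0 < t" "t < 1" and xy: "x \<in> {0..}" "y \<in> {0..}"
  have powr_le: "s powr p \<le> s" if "0 < s" "s < 1" for s :: real
    using that assms powr_mono'[of 1 p s] by simp
  show "((1 - t) *\<^sub>R x + t *\<^sub>R y) powr p \<le> (1 - t) * x powr p + t * y powr p"
  proof (cases "x = 0 \<or> y = 0")
    case True
    then show ?thesis
      using powr_le[of t] powr_le[of "1 - t"] t xy
      by (auto simp: powr_mult intro!: mult_right_mono)
  next
    case False
    then have "x \<in> {0<..}" "y \<in> {0<..}"
      using xy by auto
    then show ?thesis
      using convex_onD[OF powr_convex[OF assms], of t x y] t by auto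
  qed
qed (rule convex_real_interval)

lemma sum_indicator_level_sets:
  fixes s :: "'a \<Rightarrow> complex"
  assumes s: "simple_function M s" and x: "x \<in> space M"
  shows "(\<Sum>v\<in>s ` space M - {0}. v * indicator (s -` {v} \<inter> space M) x) = s x"
proof -
  have "(\<Sum>v\<in>s ` space M - {0}. v * indicator (s -` {v} \<inter> space M) x) =
      (\<Sum>v\<in>s ` space M - {0}. if v = s x then v else 0)"
    using x by (intro sum.cong) (auto simp: indicator_def)
  then show ?thesis
    using simple_functionD(1)[OF s] x by simp
qed

locale weighted_Lp =
  fixes M :: "'a measure" and \<omega> :: "'a \<Rightarrow> real" and p :: real
  assumes weight_measurable [measurable]: "\<omega> \<in> borel_measurable M"
    and weight_pos: "0 < \<omega> x"
    and p_ge_1: "1 \<le> p"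
begin

abbreviation "Lp \<equiv> Lp_w M \<omega> p"
abbreviation "Lnorm \<equiv> Lp_norm M \<omega> p"

lemma Lp_measurable [measurable_dest]: "f \<in> Lp \<Longrightarrow> f \<in> borel_measurable M"
  by (simp add: Lp_w_def)

lemma Lp_iff_integrable: "f \<in> Lp \<longleftrightarrow> f \<in> borel_measurable M \<and> integrable M (\<lambda>x. (norm (f x) * \<omega> x) powr p)"
  by (simp add: Lp_w_def powr_mult)

lemma Lp_integrable: "f \<in> Lp \<Longrightarrow> integrable M (\<lambda>x. (norm (f x) * \<omega> x) powr p)"
  by (simp add: Lp_iff_integrable)

lemma Lnorm_nonneg [simp]: "0 \<le> Lnorm f"
  by (simp add: Lp_norm_def)

lemma Lnorm_powr: "Lnorm f powr p = (\<integral>x. (norm (f x) * \<omega> x) powr p \<partial>M)"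
proof -
  have "0 \<le> (\<integral>x. (norm (f x) * \<omega> x) powr p \<partial>M)"
    by simp
  then show ?thesis
    using p_ge_1 by (simp add: Lp_norm_def powr_powr powr_mult del: integral_nonneg_AE)
qed

lemma Lnorm_le_iff: "0 \<le> c \<Longrightarrow> Lnorm f \<le> c \<longleftrightarrow> (\<integral>x. (norm (f x) * \<omega> x) powr p \<partial>M) \<le> c powr p"
  using p_ge_1 powr_mono2[of p "Lnorm f" c] powr_mono2[of "1 / p" "Lnorm f powr p" "c powr p"]
  by (auto simp: powr_powr simp flip: Lnorm_powr)

lemma
  assumes "g \<in> borel_measurable M" "integrable M u" "AE x in M. (norm (g x) * \<omega> x) powr p \<le> u x"
    and "(\<integral>x. u x \<partial>M) \<le> c powr p" "0 \<le> c"
  shows Lp_if_integrable_bound: "g \<in> Lp" and Lnorm_le_if_integrable_bound: "Lnorm g \<le> c"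
proof -
  have int: "integrable M (\<lambda>x. (norm (g x) * \<omega> x) powr p)"
    by (rule Bochner_Integration.integrable_bound[OF assms(2)])
      (use assms(1,3) in \<open>auto elim!: eventually_mono\<close>)
  then show "g \<in> Lp"
    using assms(1) by (simp add: Lp_iff_integrable)
  show "Lnorm g \<le> c"
    using integral_mono_AE[OF int assms(2,3)] assms(4,5) by (simp add: Lnorm_le_iff)
qed

lemma
  assumes f: "f \<in> Lp"
  shows Lp_cmult: "(\<lambda>x. a * f x) \<in> Lp" and Lnorm_cmult: "Lnorm (\<lambda>x. a * f x) = norm a * Lnorm f"
proof -
  have eq: "(norm (a * f x) * \<omega> x) powr p = norm a powr p * (norm (f x) * \<omega> x) powr p" for x
    by (simp add: norm_mult powr_mult)
  show "(\<lambda>x. a * f x) \<in> Lp"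
    using f by (auto simp: Lp_iff_integrable eq intro: borel_measurable_times)
  have "Lnorm (\<lambda>x. a * f x) = (norm a powr p * Lnorm f powr p) powr (1 / p)"
    using p_ge_1 Lnorm_powr[of "\<lambda>x. a * f x", symmetric] Lnorm_powr[of f] by (simp add: eq powr_powr)
  then show "Lnorm (\<lambda>x. a * f x) = norm a * Lnorm f"
    using p_ge_1 by (simp add: powr_mult powr_powr)
qed

lemma
  assumes h: "h \<in> Lp" and g: "g \<in> borel_measurable M" and C: "0 \<le> C"
    and le: "AE x in M. norm (g x) \<le> C * norm (h x)"
  shows Lp_dominated: "g \<in> Lp" and Lnorm_dominated: "Lnorm g \<le> C * Lnorm h"
proof -
  have int: "integrable M (\<lambda>x. C powr p * (norm (h x) * \<omega> x) powr p)"
    using Lp_integrable[OF h] by simp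
  have bound: "AE x in M. (norm (g x) * \<omega> x) powr p \<le> C powr p * (norm (h x) * \<omega> x) powr p"
    using le
  proof eventually_elim
    case (elim x)
    have "norm (g x) * \<omega> x \<le> C * (norm (h x) * \<omega> x)"
      using mult_right_mono[OF elim, of "\<omega> x"] weight_pos[of x] by simp
    then have "(norm (g x) * \<omega> x) powr p \<le> (C * (norm (h x) * \<omega> x)) powr p"
      using p_ge_1 weight_pos[of x] by (intro powr_mono2) auto
    then show ?case
      by (simp add: powr_mult)
  qed
  have integral_eq: "(\<integral>x. C powr p * (norm (h x) * \<omega> x) powr p \<partial>M) = (C * Lnorm h) powr p"
    by (simp only: integral_mult_right_zero powr_mult[of C "Lnorm h"] Lnorm_powr)
  have nonneg: "0 \<le> C * Lnorm h"
    using C by simp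
  show "g \<in> Lp" "Lnorm g \<le> C * Lnorm h"
    by (fact Lp_if_integrable_bound[OF g int bound eq_refl[OF integral_eq] nonneg]
        Lnorm_le_if_integrable_bound[OF g int bound eq_refl[OF integral_eq] nonneg])+
qed

lemma
  assumes "f \<in> borel_measurable M" "g \<in> borel_measurable M" "AE x in M. f x = g x"
  shows Lnorm_cong_AE: "Lnorm f = Lnorm g"
  unfolding Lp_norm_def by (intro arg_cong[where f = "\<lambda>t. t powr (1 / p)"] integral_cong_AE)
    (use assms in \<open>auto elim: eventually_mono\<close>)

lemma Lnorm_eq_0_iff:
  assumes f: "f \<in> Lp"
  shows "Lnorm f = 0 \<longleftrightarrow> (AE x in M. f x = 0)"
proof -
  have "Lnorm f = 0 \<longleftrightarrow> Lnorm f powr p = 0"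
    by simp
  also have "\<dots> \<longleftrightarrow> (AE x in M. (norm (f x) * \<omega> x) powr p = 0)"
    unfolding Lnorm_powr by (intro integral_nonneg_eq_0_iff_AE Lp_integrable[OF f]) simp
  also have "\<dots> \<longleftrightarrow> (AE x in M. f x = 0)"
    using weight_pos by (intro AE_cong) (auto simp: less_imp_neq[symmetric])
  finally show ?thesis .
qed

lemma Lp_zero: "(\<lambda>x. 0) \<in> Lp"
  using p_ge_1 by (simp add: Lp_iff_integrable)

text \<open>Convexity of $t \mapsto t^p$ with weights $a/(a+b)$ and $b/(a+b)$ turns $a + b$ into an upper bound.\<close>

lemma
  assumes f: "f \<in> Lp" "Lnorm f \<le> a" and g: "g \<in> Lp" "Lnorm g \<le> b" and pos: "0 < a" "0 < b"
  shows Lp_add_if_Lnorm_le: "(\<lambda>x. f x + g x) \<in> Lp" and Lnorm_add_le_if_Lnorm_le: "Lnorm (\<lambda>x. f x + g x) \<le> a + b"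
proof -
  define t where "t = b / (a + b)"
  have t: "0 \<le> t" "t \<le> 1" "(a + b) * (1 - t) = a" "(a + b) * t = b"
    using pos by (auto simp: t_def field_simps)
  define u where "u x = (a + b) powr p * ((1 - t) * (norm (f x) * \<omega> x / a) powr p + t * (norm (g x) * \<omega> x / b) powr p)" for x
  have powr_div: "(s / c) powr p = s powr p / c powr p" if "0 \<le> s" "0 < c" for s c :: real
    using that by (simp add: powr_divide)
  have u_eq: "u x = (a + b) powr p *
      ((1 - t) / a powr p * (norm (f x) * \<omega> x) powr p + t / b powr p * (norm (g x) * \<omega> x) powr p)" for x
    using pos weight_pos[of x] by (simp add: u_def powr_div)
  have int_u: "integrable M u"
    unfolding u_eq[abs_def] using Lp_integrable[OF f(1)] Lp_integrable[OF g(1)] by simp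
  have le_u: "(norm (f x + g x) * \<omega> x) powr p \<le> u x" for x
  proof -
    have "norm (f x + g x) * \<omega> x \<le> (norm (f x) + norm (g x)) * \<omega> x"
      using weight_pos[of x] by (intro mult_right_mono norm_triangle_ineq) simp
    also have "\<dots> = ((a + b) * (1 - t)) * (norm (f x) * \<omega> x / a) + ((a + b) * t) * (norm (g x) * \<omega> x / b)"
      using pos unfolding t(3,4) by (simp add: distrib_right)
    also have "\<dots> = (a + b) * ((1 - t) * (norm (f x) * \<omega> x / a) + t * (norm (g x) * \<omega> x / b))"
      by (simp only: distrib_left mult.assoc)
    finally have "(norm (f x + g x) * \<omega> x) powr p \<le>
        (a + b) powr p * ((1 - t) * (norm (f x) * \<omega> x / a) + t * (norm (g x) * \<omega> x / b)) powr p"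
      using p_ge_1 weight_pos[of x] by (simp flip: powr_mult) (intro powr_mono2; simp)
    also have "\<dots> \<le> u x"
      unfolding u_def using convex_onD[OF powr_convex_nonneg[OF p_ge_1], of t "norm (f x) * \<omega> x / a" "norm (g x) * \<omega> x / b"]
        t pos weight_pos[of x] by (intro mult_left_mono) auto
    finally show ?thesis .
  qed
  have "(\<integral>x. u x \<partial>M) = (a + b) powr p * ((1 - t) * (Lnorm f / a) powr p + t * (Lnorm g / b) powr p)"
    unfolding u_eq using Lp_integrable[OF f(1)] Lp_integrable[OF g(1)] pos
    by (simp add: powr_div flip: Lnorm_powr)
  also have "\<dots> \<le> (a + b) powr p * ((1 - t) * 1 + t * 1)"
    using f g t pos p_ge_1 powr_mono2[of p "Lnorm f / a" 1] powr_mono2[of p "Lnorm g / b" 1]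
    by (intro mult_left_mono add_mono) auto
  finally have "(\<integral>x. u x \<partial>M) \<le> (a + b) powr p"
    by simp
  then show "(\<lambda>x. f x + g x) \<in> Lp" "Lnorm (\<lambda>x. f x + g x) \<le> a + b"
    using Lp_measurable[OF f(1)] Lp_measurable[OF g(1)] int_u le_u pos
    by (auto intro!: Lp_if_integrable_bound Lnorm_le_if_integrable_bound)
qed

lemma Lp_add: "f \<in> Lp \<Longrightarrow> g \<in> Lp \<Longrightarrow> (\<lambda>x. f x + g x) \<in> Lp"
  by (rule Lp_add_if_Lnorm_le[where a = "Lnorm f + 1" and b = "Lnorm g + 1"]) (auto intro: add_nonneg_pos)

theorem Minkowski:
  assumes "f \<in> Lp" "g \<in> Lp"
  shows "Lnorm (\<lambda>x. f x + g x) \<le> Lnorm f + Lnorm g"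
proof (rule field_le_epsilon)
  fix e :: real assume "0 < e"
  then have "Lnorm (\<lambda>x. f x + g x) \<le> (Lnorm f + e / 2) + (Lnorm g + e / 2)"
    using assms by (intro Lnorm_add_le_if_Lnorm_le) (auto intro: add_nonneg_pos)
  then show "Lnorm (\<lambda>x. f x + g x) \<le> Lnorm f + Lnorm g + e"
    by simp
qed

lemma
  assumes f: "f \<in> Lp" and g: "g \<in> Lp"
  shows Lp_diff: "(\<lambda>x. f x - g x) \<in> Lp" and Lnorm_diff_le: "Lnorm (\<lambda>x. f x - g x) \<le> Lnorm f + Lnorm g"
  using Lp_add[OF f Lp_cmult[OF g, of "-1"]] Minkowski[OF f Lp_cmult[OF g, of "-1"]] Lnorm_cmult[OF g, of "-1"] by auto

lemma Lnorm_diff_commute: "Lnorm (\<lambda>x. f x - g x) = Lnorm (\<lambda>x. g x - f x)"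
  by (simp add: Lp_norm_def norm_minus_commute)

lemma Lnorm_diff_triangle:
  assumes "f \<in> Lp" "g \<in> Lp" "h \<in> Lp"
  shows "Lnorm (\<lambda>x. f x - h x) \<le> Lnorm (\<lambda>x. f x - g x) + Lnorm (\<lambda>x. g x - h x)"
  using Minkowski[OF Lp_diff[OF assms(1,2)] Lp_diff[OF assms(2,3)]] by simp

lemma
  assumes "finite I" "\<And>i. i \<in> I \<Longrightarrow> g i \<in> Lp"
  shows Lp_sum: "(\<lambda>x. \<Sum>i\<in>I. c i * g i x) \<in> Lp"
    and Lnorm_sum_le: "Lnorm (\<lambda>x. \<Sum>i\<in>I. c i * g i x) \<le> (\<Sum>i\<in>I. norm (c i) * Lnorm (g i))"
proof -
  have "(\<lambda>x. \<Sum>i\<in>I. c i * g i x) \<in> Lp \<and>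
      Lnorm (\<lambda>x. \<Sum>i\<in>I. c i * g i x) \<le> (\<Sum>i\<in>I. norm (c i) * Lnorm (g i))"
    using assms
  proof (induction I rule: finite_induct)
    case empty
    then show ?case
      using Lp_zero Lnorm_eq_0_iff[OF Lp_zero] by simp
  next
    case (insert i I)
    then have g: "g i \<in> Lp" and IH: "(\<lambda>x. \<Sum>i\<in>I. c i * g i x) \<in> Lp"
      "Lnorm (\<lambda>x. \<Sum>i\<in>I. c i * g i x) \<le> (\<Sum>i\<in>I. norm (c i) * Lnorm (g i))"
      by auto
    show ?case
      using Lp_add[OF Lp_cmult[OF g] IH(1), of "c i"] insert.hyps
        order_trans[OF Minkowski[OF Lp_cmult[OF g] IH(1)] add_left_mono[OF IH(2)], of "c i"]
      by (simp add: Lnorm_cmult[OF g])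
  qed
  then show "(\<lambda>x. \<Sum>i\<in>I. c i * g i x) \<in> Lp" "Lnorm (\<lambda>x. \<Sum>i\<in>I. c i * g i x) \<le> (\<Sum>i\<in>I. norm (c i) * Lnorm (g i))"
    by auto
qed

lemma
  assumes f: "f \<in> Lp" and A: "A \<in> sets M"
  shows Lp_indicator_mult: "(\<lambda>x. indicator A x * f x) \<in> Lp"
    and Lnorm_indicator_mult_le: "Lnorm (\<lambda>x. indicator A x * f x) \<le> Lnorm f"
proof -
  have meas: "(\<lambda>x. indicator A x * f x) \<in> borel_measurable M"
    using Lp_measurable[OF f] A by (intro borel_measurable_times borel_measurable_indicator)
  have le: "AE x in M. norm (indicator A x * f x) \<le> 1 * norm (f x)"
    by (auto simp: indicator_def)
  show "(\<lambda>x. indicator A x * f x) \<in> Lp"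
    by (rule Lp_dominated[OF f meas zero_le_one le])
  show "Lnorm (\<lambda>x. indicator A x * f x) \<le> Lnorm f"
    using Lnorm_dominated[OF f meas zero_le_one le] by simp
qed

lemma Lp_norm_of_real: "f \<in> Lp \<Longrightarrow> (\<lambda>x. complex_of_real (norm (f x))) \<in> Lp"
  by (rule Lp_dominated[of f _ 1]) (auto dest: Lp_measurable)

subsubsection \<open>Convergence\<close>

lemma
  assumes u: "\<And>n. u n \<in> Lp" "\<And>n. Lnorm (u n) \<le> R" and f: "f \<in> borel_measurable M"
    and lim: "AE x in M. (\<lambda>n. u n x) \<longlonglongrightarrow> f x"
  shows Lp_Fatou: "f \<in> Lp" and Lnorm_Fatou: "Lnorm f \<le> R"
proof -
  note [measurable] = Lp_measurable[OF u(1)]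
  let ?w = "\<lambda>g x. ennreal ((norm (g x) * \<omega> x) powr p)"
  have R: "0 \<le> R"
    using u(2)[of 0] Lnorm_nonneg[of "u 0"] by linarith
  have u_le: "(\<integral>\<^sup>+x. ?w (u n) x \<partial>M) \<le> ennreal (R powr p)" for n
    using nn_integral_eq_integral[OF Lp_integrable[OF u(1)], of n] u(2)[of n] R
    by (simp add: Lnorm_le_iff ennreal_leI)
  have "(\<integral>\<^sup>+x. ?w f x \<partial>M) \<le> (\<integral>\<^sup>+x. liminf (\<lambda>n. ?w (u n) x) \<partial>M)"
  proof (rule nn_integral_mono_AE, use lim in eventually_elim)
    case (elim x)
    have "(\<lambda>n. ?w (u n) x) \<longlonglongrightarrow> ?w f x"
      using p_ge_1 elim by (intro tendsto_ennrealI tendsto_powr2 tendsto_mult tendsto_norm tendsto_const)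
        (auto intro!: always_eventually mult_nonneg_nonneg less_imp_le[OF weight_pos])
    then show ?case
      by (intro eq_refl lim_imp_Liminf[OF trivial_limit_sequentially, symmetric])
  qed
  also have "\<dots> \<le> liminf (\<lambda>n. \<integral>\<^sup>+x. ?w (u n) x \<partial>M)"
    by (intro nn_integral_liminf) measurable
  also have "\<dots> \<le> liminf (\<lambda>n. ennreal (R powr p))"
    by (intro Liminf_mono always_eventually allI u_le)
  finally have le: "(\<integral>\<^sup>+x. ?w f x \<partial>M) \<le> ennreal (R powr p)"
    by (simp add: Liminf_const)
  have int: "integrable M (\<lambda>x. (norm (f x) * \<omega> x) powr p)"
    using f le by (intro integrableI_nonneg) (auto intro: le_less_trans)
  then show "f \<in> Lp"
    using f by (simp add: Lp_iff_integrable)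
  show "Lnorm f \<le> R"
    using le R by (simp add: Lnorm_le_iff nn_integral_eq_integral[OF int])
qed

lemma Lnorm_tendsto_0_iff: "((\<lambda>i. Lnorm (u i)) \<longlongrightarrow> 0) F \<longleftrightarrow> ((\<lambda>i. \<integral>x. (norm (u i x) * \<omega> x) powr p \<partial>M) \<longlongrightarrow> 0) F"
proof
  assume "((\<lambda>i. Lnorm (u i)) \<longlongrightarrow> 0) F"
  then have "((\<lambda>i. Lnorm (u i) powr p) \<longlongrightarrow> 0) F"
    using p_ge_1 by (intro tendsto_zero_powrI[OF _ tendsto_const]) auto
  then show "((\<lambda>i. \<integral>x. (norm (u i x) * \<omega> x) powr p \<partial>M) \<longlongrightarrow> 0) F"
    by (simp add: Lnorm_powr)
next
  assume "((\<lambda>i. \<integral>x. (norm (u i x) * \<omega> x) powr p \<partial>M) \<longlongrightarrow> 0) F"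
  then have "((\<lambda>i. (Lnorm (u i) powr p) powr (1 / p)) \<longlongrightarrow> 0) F"
    using p_ge_1 unfolding Lnorm_powr by (intro tendsto_zero_powrI[OF _ tendsto_const]) auto
  then show "((\<lambda>i. Lnorm (u i)) \<longlongrightarrow> 0) F"
    using p_ge_1 by (simp add: powr_powr)
qed

lemma Lp_dominated_convergence:
  assumes h: "h \<in> Lp" and u: "\<And>n. u n \<in> borel_measurable M" and f: "f \<in> borel_measurable M"
    and le: "\<And>n. AE x in M. norm (u n x - f x) \<le> C * norm (h x)" and lim: "AE x in M. (\<lambda>n. u n x) \<longlonglongrightarrow> f x"
  shows "(\<lambda>n. Lnorm (\<lambda>x. u n x - f x)) \<longlonglongrightarrow> 0"
proof -
  have "(\<lambda>n. \<integral>x. (norm (u n x - f x) * \<omega> x) powr p \<partial>M) \<longlonglongrightarrow> (\<integral>x. 0 \<partial>M)"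
  proof (rule integral_dominated_convergence)
    show "integrable M (\<lambda>x. \<bar>C\<bar> powr p * (norm (h x) * \<omega> x) powr p)"
      using Lp_integrable[OF h] by simp
    show "(\<lambda>x. (norm (u n x - f x) * \<omega> x) powr p) \<in> borel_measurable M" for n
      using u f by measurable
    show "AE x in M. (\<lambda>n. (norm (u n x - f x) * \<omega> x) powr p) \<longlonglongrightarrow> 0"
      using lim
    proof eventually_elim
      case (elim x)
      have "(\<lambda>n. norm (u n x - f x) * \<omega> x) \<longlonglongrightarrow> 0"
        using elim by (intro tendsto_mult_left_zero tendsto_norm_zero LIM_zero)
      then show ?case
        using p_ge_1 weight_pos[of x] by (intro tendsto_zero_powrI[OF _ tendsto_const]) auto
    qed
    show "AE x in M. norm ((norm (u n x - f x) * \<omega> x) powr p) \<le> \<bar>C\<bar> powr p * (norm (h x) * \<omega> x) powr p" for n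
      using le[of n]
    proof eventually_elim
      case (elim x)
      have "norm (u n x - f x) * \<omega> x \<le> \<bar>C\<bar> * norm (h x) * \<omega> x"
        using elim weight_pos[of x] by (intro mult_right_mono order_trans[OF elim]) auto
      then have "(norm (u n x - f x) * \<omega> x) powr p \<le> (\<bar>C\<bar> * norm (h x) * \<omega> x) powr p"
        using p_ge_1 weight_pos[of x] by (intro powr_mono2) auto
      then show ?case
        by (simp add: powr_mult mult.assoc)
    qed
  qed simp
  then show ?thesis
    by (simp add: Lnorm_tendsto_0_iff)
qed

lemma Lp_tendsto_AE_subseq:
  assumes u: "\<And>n. u n \<in> Lp" and f: "f \<in> Lp" and lim: "(\<lambda>n. Lnorm (\<lambda>x. u n x - f x)) \<longlonglongrightarrow> 0"
  obtains r :: "nat \<Rightarrow> nat" where "strict_mono r" "AE x in M. (\<lambda>n. u (r n) x) \<longlonglongrightarrow> f x"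
proof -
  have "\<exists>r::nat\<Rightarrow>nat. strict_mono r \<and> (AE x in M. (\<lambda>n. (norm (u (r n) x - f x) * \<omega> x) powr p) \<longlonglongrightarrow> 0)"
    using lim Lp_integrable[OF Lp_diff[OF u f]]
    by (intro tendsto_L1_AE_subseq) (simp_all add: Lnorm_tendsto_0_iff)
  then obtain r :: "nat \<Rightarrow> nat" where r: "strict_mono r"
    and conv: "AE x in M. (\<lambda>n. (norm (u (r n) x - f x) * \<omega> x) powr p) \<longlonglongrightarrow> 0"
    by blast
  from conv have "AE x in M. (\<lambda>n. u (r n) x) \<longlonglongrightarrow> f x"
  proof eventually_elim
    case (elim x)
    have "(\<lambda>n. ((norm (u (r n) x - f x) * \<omega> x) powr p) powr (1 / p)) \<longlonglongrightarrow> 0"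
      using p_ge_1 by (intro tendsto_zero_powrI[OF elim tendsto_const]) auto
    then have "(\<lambda>n. norm (u (r n) x - f x) * \<omega> x) \<longlonglongrightarrow> 0"
      using p_ge_1 weight_pos[of x] by (simp add: powr_powr)
    then have "(\<lambda>n. norm (u (r n) x - f x) * \<omega> x / \<omega> x) \<longlonglongrightarrow> 0 / \<omega> x"
      using weight_pos[of x] by (intro tendsto_intros) auto
    then have "(\<lambda>n. norm (u (r n) x - f x)) \<longlonglongrightarrow> 0"
      using weight_pos[of x] by simp
    then show ?case
      using tendsto_norm_zero_iff LIM_zero_iff by blast
  qed
  then show thesis
    by (rule that[OF r])
qed

lemma Lp_simple_approximation:
  assumes f: "f \<in> Lp"
  obtains u where "\<And>n::nat. simple_function M (u n)" "\<And>n. u n \<in> Lp" "(\<lambda>n. Lnorm (\<lambda>x. u n x - f x)) \<longlonglongrightarrow> 0"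
proof -
  obtain u :: "nat \<Rightarrow> 'a \<Rightarrow> complex" where u: "\<And>n. simple_function M (u n)" "\<And>x. x \<in> space M \<Longrightarrow> (\<lambda>n. u n x) \<longlonglongrightarrow> f x"
    "\<And>n x. x \<in> space M \<Longrightarrow> norm (u n x) \<le> 2 * norm (f x)"
    using borel_measurable_implies_sequence_metric[OF Lp_measurable[OF f], of 0]
    unfolding dist_norm diff_zero by blast
  have u_meas: "u n \<in> borel_measurable M" for n
    by (rule borel_measurable_simple_function[OF u(1)])
  have u_Lp: "u n \<in> Lp" for n
    by (rule Lp_dominated[OF f u_meas, of 2]) (use u(3) in auto)
  have "norm (u n x - f x) \<le> 3 * norm (f x)" if "x \<in> space M" for n x
    using norm_triangle_ineq4[of "u n x" "f x"] u(3)[OF that, of n] by simp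
  then have "(\<lambda>n. Lnorm (\<lambda>x. u n x - f x)) \<longlonglongrightarrow> 0"
    using u(2) by (intro Lp_dominated_convergence[OF f u_meas Lp_measurable[OF f]]) auto
  then show thesis
    by (rule that[OF u(1) u_Lp])
qed

lemma Lp_indicator_level_set:
  assumes s: "simple_function M s" "s \<in> Lp" and v: "v \<noteq> 0"
  shows "indicator (s -` {v} \<inter> space M) \<in> Lp"
  by (rule Lp_dominated[OF s(2), where C = "1 / norm v"])
    (use v simple_functionD(2)[OF s(1)] in \<open>auto simp: indicator_def\<close>)

lemma Lp_simple_induct [consumes 2, case_names indicator add AE_cong]:
  assumes s: "simple_function M s" "s \<in> Lp"
    and indicator: "\<And>a A. A \<in> sets M \<Longrightarrow> indicator A \<in> Lp \<Longrightarrow> P (\<lambda>x. a * indicator A x)"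
    and add: "\<And>f g. f \<in> Lp \<Longrightarrow> g \<in> Lp \<Longrightarrow> P f \<Longrightarrow> P g \<Longrightarrow> P (\<lambda>x. f x + g x)"
    and AE_cong: "\<And>f g. f \<in> Lp \<Longrightarrow> g \<in> Lp \<Longrightarrow> P f \<Longrightarrow> AE x in M. f x = g x \<Longrightarrow> P g"
  shows "P s"
proof -
  let ?A = "\<lambda>v. s -` {v} \<inter> space M"
  have P_sum: "(\<lambda>x. \<Sum>v\<in>V. v * indicator (?A v) x) \<in> Lp \<and> P (\<lambda>x. \<Sum>v\<in>V. v * indicator (?A v) x)"
    if "finite V" "0 \<notin> V" for V
    using that
  proof (induction V rule: finite_induct)
    case empty
    have "indicator {} \<in> Lp"
      using Lp_zero by (simp add: indicator_def[abs_def])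
    then show ?case
      using indicator[of "{}" 0] Lp_zero by simp
  next
    case (insert v V)
    then have v: "indicator (?A v) \<in> Lp"
      by (intro Lp_indicator_level_set[OF s]) auto
    show ?case
      unfolding sum.insert[OF insert.hyps]
      by (intro conjI Lp_add add Lp_cmult indicator v simple_functionD(2)[OF s(1)]) (use insert in auto)
  qed
  let ?g = "\<lambda>x. \<Sum>v\<in>s ` space M - {0}. v * indicator (?A v) x"
  have "finite (s ` space M - {0})"
    using simple_functionD(1)[OF s(1)] by simp
  then have g: "?g \<in> Lp" "P ?g"
    using P_sum by blast+
  show ?thesis
    by (rule AE_cong[OF g(1) s(2) g(2)]) (intro AE_I2, use sum_indicator_level_sets[OF s(1)] in simp)
qed

lemma Lp_induct [consumes 1, case_names indicator add limit]:
  assumes f: "f \<in> Lp"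
    and indicator: "\<And>a A. A \<in> sets M \<Longrightarrow> indicator A \<in> Lp \<Longrightarrow> P (\<lambda>x. a * indicator A x)"
    and add: "\<And>f g. f \<in> Lp \<Longrightarrow> g \<in> Lp \<Longrightarrow> P f \<Longrightarrow> P g \<Longrightarrow> P (\<lambda>x. f x + g x)"
    and limit: "\<And>u f. (\<And>n::nat. u n \<in> Lp) \<Longrightarrow> f \<in> Lp \<Longrightarrow> (\<And>n. P (u n)) \<Longrightarrow>
      (\<lambda>n. Lnorm (\<lambda>x. u n x - f x)) \<longlonglongrightarrow> 0 \<Longrightarrow> P f"
  shows "P f"
proof -
  have P_simple: "P s" if "simple_function M s" "s \<in> Lp" for s
    using that
  proof (induction rule: Lp_simple_induct)
    case (AE_cong f g)
    have "Lnorm (\<lambda>x. f x - g x) = 0"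
      using AE_cong.hyps(3) by (simp add: Lnorm_eq_0_iff[OF Lp_diff[OF AE_cong.hyps(1,2)]])
    then have "(\<lambda>n::nat. Lnorm (\<lambda>x. f x - g x)) \<longlonglongrightarrow> 0"
      by simp
    then show ?case
      by (rule limit[OF AE_cong.hyps(1,2) AE_cong.IH])
  qed (fact indicator add)+
  obtain u where u: "\<And>n::nat. simple_function M (u n)" "\<And>n. u n \<in> Lp" "(\<lambda>n. Lnorm (\<lambda>x. u n x - f x)) \<longlonglongrightarrow> 0"
    by (rule Lp_simple_approximation[OF f]) blast
  show ?thesis
    by (rule limit[OF u(2) f P_simple[OF u(1,2)] u(3)])
qed

end

subsection \<open>Bounded operators between weighted Lebesgue spaces\<close>

locale Lp_operator = A: weighted_Lp M \<omega> p + B: weighted_Lp N \<theta> p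
  for M :: "'a measure" and \<omega> and N :: "'b measure" and \<theta> and p +
  fixes T :: "('a \<Rightarrow> complex) \<Rightarrow> 'b \<Rightarrow> complex"
  assumes op_Lp: "f \<in> A.Lp \<Longrightarrow> T f \<in> B.Lp"
    and op_add: "f \<in> A.Lp \<Longrightarrow> g \<in> A.Lp \<Longrightarrow> AE y in N. T (\<lambda>x. f x + g x) y = T f y + T g y"
    and op_cmult: "f \<in> A.Lp \<Longrightarrow> AE y in N. T (\<lambda>x. a * f x) y = a * T f y"
    and op_bounded: "\<exists>C\<ge>0. \<forall>f\<in>A.Lp. B.Lnorm (T f) \<le> C * A.Lnorm f"
begin

lemma op_bound:
  obtains C where "0 \<le> C" "\<And>f. f \<in> A.Lp \<Longrightarrow> B.Lnorm (T f) \<le> C * A.Lnorm f"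
  using op_bounded by blast

lemma op_zero: "AE y in N. T (\<lambda>x. 0) y = 0"
  using op_cmult[OF A.Lp_zero, of 0] by simp

lemma op_diff:
  assumes f: "f \<in> A.Lp" and g: "g \<in> A.Lp"
  shows "AE y in N. T (\<lambda>x. f x - g x) y = T f y - T g y"
proof -
  have "AE y in N. T (\<lambda>x. f x + (-1) * g x) y = T f y - T g y"
    using op_add[OF f A.Lp_cmult[OF g, of "-1"]] op_cmult[OF g, of "-1"] by eventually_elim simp
  then show ?thesis
    by simp
qed

lemma op_sum:
  assumes "finite I" "\<And>i. i \<in> I \<Longrightarrow> f i \<in> A.Lp"
  shows "AE y in N. T (\<lambda>x. \<Sum>i\<in>I. c i * f i x) y = (\<Sum>i\<in>I. c i * T (f i) y)"
  using assms
proof (induction I rule: finite_induct)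
  case empty
  then show ?case
    using op_zero by simp
next
  case (insert i I)
  then have "f i \<in> A.Lp" "(\<lambda>x. \<Sum>i\<in>I. c i * f i x) \<in> A.Lp"
    by (auto intro: A.Lp_sum)
  moreover have "AE y in N. T (\<lambda>x. \<Sum>i\<in>I. c i * f i x) y = (\<Sum>i\<in>I. c i * T (f i) y)"
    using insert by simp
  ultimately have "AE y in N. T (\<lambda>x. c i * f i x + (\<Sum>i\<in>I. c i * f i x)) y = c i * T (f i) y + (\<Sum>i\<in>I. c i * T (f i) y)"
    using op_add[OF A.Lp_cmult[of "f i" "c i"]] op_cmult[of "f i" "c i"] by fastforce
  then show ?case
    unfolding sum.insert[OF insert.hyps] .
qed

lemma Lnorm_op_diff:
  assumes f: "f \<in> A.Lp" and g: "g \<in> A.Lp"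
  shows "B.Lnorm (\<lambda>y. T f y - T g y) = B.Lnorm (T (\<lambda>x. f x - g x))"
  by (rule B.Lnorm_cong_AE[symmetric, OF B.Lp_measurable[OF op_Lp[OF A.Lp_diff[OF f g]]]
        B.Lp_measurable[OF B.Lp_diff[OF op_Lp[OF f] op_Lp[OF g]]] op_diff[OF f g]])

lemma op_cong_AE:
  assumes f: "f \<in> A.Lp" and g: "g \<in> A.Lp" and eq: "AE x in M. f x = g x"
  shows "AE y in N. T f y = T g y"
proof -
  obtain C where C: "0 \<le> C" "\<And>f. f \<in> A.Lp \<Longrightarrow> B.Lnorm (T f) \<le> C * A.Lnorm f"
    using op_bound by blast
  have "A.Lnorm (\<lambda>x. f x - g x) = 0"
    using eq by (simp add: A.Lnorm_eq_0_iff[OF A.Lp_diff[OF f g]])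
  then have "B.Lnorm (\<lambda>y. T f y - T g y) \<le> 0"
    unfolding Lnorm_op_diff[OF f g] using C(2)[OF A.Lp_diff[OF f g]] by simp
  then have "B.Lnorm (\<lambda>y. T f y - T g y) = 0"
    using B.Lnorm_nonneg by (rule order_antisym)
  then show ?thesis
    by (simp add: B.Lnorm_eq_0_iff[OF B.Lp_diff[OF op_Lp[OF f] op_Lp[OF g]]])
qed

lemma op_tendsto:
  assumes u: "\<And>i. u i \<in> A.Lp" and f: "f \<in> A.Lp" and lim: "((\<lambda>i. A.Lnorm (\<lambda>x. u i x - f x)) \<longlongrightarrow> 0) F"
  shows "((\<lambda>i. B.Lnorm (\<lambda>y. T (u i) y - T f y)) \<longlongrightarrow> 0) F"
proof -
  obtain C where C: "0 \<le> C" "\<And>f. f \<in> A.Lp \<Longrightarrow> B.Lnorm (T f) \<le> C * A.Lnorm f"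
    using op_bound by blast
  show ?thesis
  proof (rule Lim_null_comparison[OF always_eventually tendsto_mult_right_zero[OF lim, of C]], rule allI)
    show "norm (B.Lnorm (\<lambda>y. T (u i) y - T f y)) \<le> C * A.Lnorm (\<lambda>x. u i x - f x)" for i
      unfolding Lnorm_op_diff[OF u f] using C(2)[OF A.Lp_diff[OF u f]] by simp
  qed
qed

lemma op_inj_if_bounded_below:
  assumes below: "\<And>f. f \<in> A.Lp \<Longrightarrow> A.Lnorm f \<le> C * B.Lnorm (T f)"
    and f: "f \<in> A.Lp" and g: "g \<in> A.Lp" and eq: "AE y in N. T f y = T g y"
  shows "AE x in M. f x = g x"
proof -
  have "AE y in N. T f y - T g y = 0"
    using eq by eventually_elim simp
  then have "B.Lnorm (T (\<lambda>x. f x - g x)) = 0"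
    using Lnorm_op_diff[OF f g] B.Lnorm_eq_0_iff[OF B.Lp_diff[OF op_Lp[OF f] op_Lp[OF g]]] by simp
  then have "A.Lnorm (\<lambda>x. f x - g x) = 0"
    using below[OF A.Lp_diff[OF f g]] A.Lnorm_nonneg[of "\<lambda>x. f x - g x"] by simp
  then show ?thesis
    by (simp add: A.Lnorm_eq_0_iff[OF A.Lp_diff[OF f g]])
qed

end

lemma Lp_operator_compose:
  assumes "Lp_operator M \<omega> N \<theta> p S" "Lp_operator N \<theta> L \<eta> p T"
  shows "Lp_operator M \<omega> L \<eta> p (\<lambda>f. T (S f))"
proof -
  interpret S: Lp_operator M \<omega> N \<theta> p S by fact
  interpret T: Lp_operator N \<theta> L \<eta> p T by fact
  show ?thesis
  proof unfold_locales
    fix f g assume f: "f \<in> S.A.Lp" and g: "g \<in> S.A.Lp"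
    show "AE z in L. T (S (\<lambda>x. f x + g x)) z = T (S f) z + T (S g) z"
      using T.op_cong_AE[OF S.op_Lp[OF S.A.Lp_add[OF f g]] S.B.Lp_add[OF S.op_Lp[OF f] S.op_Lp[OF g]] S.op_add[OF f g]]
        T.op_add[OF S.op_Lp[OF f] S.op_Lp[OF g]]
      by eventually_elim simp
  next
    fix f and a :: complex assume f: "f \<in> S.A.Lp"
    show "T (S f) \<in> T.B.Lp"
      by (rule T.op_Lp[OF S.op_Lp[OF f]])
    show "AE z in L. T (S (\<lambda>x. a * f x)) z = a * T (S f) z"
      using T.op_cong_AE[OF S.op_Lp[OF S.A.Lp_cmult[OF f]] S.B.Lp_cmult[OF S.op_Lp[OF f]] S.op_cmult[OF f], of a]
        T.op_cmult[OF S.op_Lp[OF f], of a]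
      by eventually_elim simp
  next
    obtain C where C: "0 \<le> C" "\<And>f. f \<in> S.A.Lp \<Longrightarrow> S.B.Lnorm (S f) \<le> C * S.A.Lnorm f"
      using S.op_bound by blast
    obtain D where D: "0 \<le> D" "\<And>f. f \<in> S.B.Lp \<Longrightarrow> T.B.Lnorm (T f) \<le> D * S.B.Lnorm f"
      using T.op_bound by blast
    have "T.B.Lnorm (T (S f)) \<le> (D * C) * S.A.Lnorm f" if "f \<in> S.A.Lp" for f
      using D(2)[OF S.op_Lp[OF that]] mult_left_mono[OF C(2)[OF that] D(1)] by simp
    then show "\<exists>C\<ge>0. \<forall>f\<in>S.A.Lp. T.B.Lnorm (T (S f)) \<le> C * S.A.Lnorm f"
      using C(1) D(1) by (intro exI[of _ "D * C"]) simp
  qed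
qed

lemma Lp_operator_inverse:
  assumes "Lp_operator M \<omega> N \<theta> p T"
    and below: "\<And>f. f \<in> Lp_w M \<omega> p \<Longrightarrow> Lp_norm M \<omega> p f \<le> C * Lp_norm N \<theta> p (T f)" and C: "0 \<le> C"
    and S_Lp: "\<And>h. h \<in> Lp_w N \<theta> p \<Longrightarrow> S h \<in> Lp_w M \<omega> p"
    and T_S: "\<And>h. h \<in> Lp_w N \<theta> p \<Longrightarrow> AE y in N. T (S h) y = h y"
  shows "Lp_operator N \<theta> M \<omega> p S"
proof -
  interpret T: Lp_operator M \<omega> N \<theta> p T by fact
  have inj: "AE x in M. f x = g x" if "f \<in> T.A.Lp" "g \<in> T.A.Lp" "AE y in N. T f y = T g y" for f g
    by (rule T.op_inj_if_bounded_below[OF below that])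
  show ?thesis
  proof unfold_locales
    fix h g assume h: "h \<in> T.B.Lp" and g: "g \<in> T.B.Lp"
    show "AE x in M. S (\<lambda>y. h y + g y) x = S h x + S g x"
    proof (rule inj[OF S_Lp[OF T.B.Lp_add[OF h g]] T.A.Lp_add[OF S_Lp[OF h] S_Lp[OF g]]])
      show "AE y in N. T (S (\<lambda>y. h y + g y)) y = T (\<lambda>x. S h x + S g x) y"
        using T_S[OF h] T_S[OF g] T_S[OF T.B.Lp_add[OF h g]] T.op_add[OF S_Lp[OF h] S_Lp[OF g]]
        by eventually_elim simp
    qed
  next
    fix h and a :: complex assume h: "h \<in> T.B.Lp"
    show "S h \<in> T.A.Lp"
      by (rule S_Lp[OF h])
    show "AE x in M. S (\<lambda>y. a * h y) x = a * S h x"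
    proof (rule inj[OF S_Lp[OF T.B.Lp_cmult[OF h]] T.A.Lp_cmult[OF S_Lp[OF h]]])
      show "AE y in N. T (S (\<lambda>y. a * h y)) y = T (\<lambda>x. a * S h x) y"
        using T_S[OF h] T_S[OF T.B.Lp_cmult[OF h, of a]] T.op_cmult[OF S_Lp[OF h], of a]
        by eventually_elim simp
    qed
  next
    have "T.B.Lnorm (T (S h)) = T.B.Lnorm h" if "h \<in> T.B.Lp" for h
      using that S_Lp by (intro T.B.Lnorm_cong_AE T.B.Lp_measurable T.op_Lp T_S)
    then show "\<exists>C\<ge>0. \<forall>h\<in>T.B.Lp. T.A.Lnorm (S h) \<le> C * T.B.Lnorm h"
      using C below[OF S_Lp] by (intro exI[of _ C]) simp
  qed
qed

lemma Lp_operator_eq_if_eq_on_sequence: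
  assumes "Lp_operator M \<omega> N \<theta> p S" "Lp_operator M \<omega> N \<theta> p T"
    and u: "\<And>n::nat. u n \<in> Lp_w M \<omega> p" and f: "f \<in> Lp_w M \<omega> p"
    and lim: "(\<lambda>n. Lp_norm M \<omega> p (\<lambda>x. u n x - f x)) \<longlonglongrightarrow> 0"
    and eq: "\<And>n. AE y in N. S (u n) y = T (u n) y"
  shows "AE y in N. S f y = T f y"
proof -
  interpret S: Lp_operator M \<omega> N \<theta> p S by fact
  interpret T: Lp_operator M \<omega> N \<theta> p T by fact
  note Lp = S.op_Lp[OF u] S.op_Lp[OF f] T.op_Lp[OF u] T.op_Lp[OF f]
  have "S.B.Lnorm (\<lambda>y. S f y - T f y) \<le>
      S.B.Lnorm (\<lambda>y. S (u n) y - S f y) + S.B.Lnorm (\<lambda>y. T (u n) y - T f y)" for n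
  proof -
    have "S.B.Lnorm (\<lambda>y. S f y - T f y) \<le> S.B.Lnorm (\<lambda>y. S f y - S (u n) y) + S.B.Lnorm (\<lambda>y. S (u n) y - T f y)"
      by (rule S.B.Lnorm_diff_triangle[OF Lp(2,1,4)])
    also have "S.B.Lnorm (\<lambda>y. S (u n) y - T f y) = S.B.Lnorm (\<lambda>y. T (u n) y - T f y)"
      by (rule S.B.Lnorm_cong_AE[OF S.B.Lp_measurable[OF S.B.Lp_diff[OF Lp(1,4)]] S.B.Lp_measurable[OF S.B.Lp_diff[OF Lp(3,4)]]])
        (use eq[of n] in eventually_elim, simp)
    finally show ?thesis
      by (simp only: S.B.Lnorm_diff_commute[of "S f"])
  qed
  then have "S.B.Lnorm (\<lambda>y. S f y - T f y) \<le> 0"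
    using LIMSEQ_le_const[OF tendsto_add[OF S.op_tendsto[OF u f lim] T.op_tendsto[OF u f lim]]] by simp
  then have "S.B.Lnorm (\<lambda>y. S f y - T f y) = 0"
    using S.B.Lnorm_nonneg by (rule order_antisym)
  then show ?thesis
    by (simp add: S.B.Lnorm_eq_0_iff[OF S.B.Lp_diff[OF Lp(2,4)]])
qed

subsection \<open>Weighted Lebesgue spaces on groups\<close>

definition ltrans :: "'g::group_add \<Rightarrow> ('g \<Rightarrow> 'b) \<Rightarrow> 'g \<Rightarrow> 'b" where
  "ltrans a f = (\<lambda>x. f (- a + x))"

lemma ltrans_ltrans: "ltrans a (ltrans b f) = ltrans (a + b) f"
  by (simp add: ltrans_def minus_add add.assoc diff_conv_add_uminus del: add_uminus_conv_diff)

lemma ltrans_0 [simp]: "ltrans 0 f = f"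
  by (simp add: ltrans_def)

lemma ltrans_eq_0_off_plus:
  assumes "\<And>x. x \<notin> K \<Longrightarrow> k x = 0" "a \<in> Q" "x \<notin> {a + y |a y. a \<in> Q \<and> y \<in> K}"
  shows "ltrans a k x = 0"
proof -
  have "a + (- a + x) = x"
    by (simp add: add.assoc[symmetric])
  then have "- a + x \<notin> K"
    using assms(2,3) by force
  then show ?thesis
    by (simp add: ltrans_def assms(1))
qed

lemma ltrans_close_on_compact:
  fixes k :: "'g::{topological_group_add,t2_space} \<Rightarrow> 'b::real_normed_vector"
  assumes k: "k \<in> Cc" and L: "compact L" and d: "0 < d"
  obtains V where "open V" "a \<in> V" "\<And>a' x. a' \<in> V \<Longrightarrow> x \<in> L \<Longrightarrow> norm (ltrans a' k x - ltrans a k x) \<le> d"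
proof -
  have "continuous_on UNIV (\<lambda>z. k (- fst z + snd z))"
    by (rule continuous_on_compose2[OF Cc_continuous[OF k]]) (auto intro!: continuous_intros)
  then obtain V where "open V" "a \<in> V"
    "\<And>a' x. a' \<in> V \<Longrightarrow> x \<in> L \<Longrightarrow> dist (k (- fst (a', x) + snd (a', x))) (k (- fst (a, x) + snd (a, x))) \<le> d"
    by (rule continuous_on_compact_tube[OF _ L d]) blast
  then show thesis
    by (intro that[of V]) (simp_all add: ltrans_def dist_norm)
qed

locale weighted_haar = haar_group M for M :: "'g::{topological_group_add,t2_space} measure" +
  fixes \<omega> :: "'g \<Rightarrow> real" and p :: real
  assumes weight: "weight \<omega>" and one_le_p: "1 \<le> p"
begin

lemma weight_continuous: "continuous_on UNIV \<omega>"
  and weight_plus_le: "\<omega> (x + y) \<le> \<omega> x * \<omega> y"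
  using weight by (auto simp: weight_def)

end

sublocale weighted_haar \<subseteq> weighted_Lp M \<omega> p
proof
  show "\<omega> \<in> borel_measurable M"
    using borel_measurable_continuous_onI[OF weight_continuous] by simp
qed (use weight one_le_p in \<open>auto simp: weight_def\<close>)

context weighted_haar
begin

lemma Lp_borel_measurable: "f \<in> Lp \<Longrightarrow> f \<in> borel_measurable borel"
  using Lp_measurable by simp

lemma weight_bounds_compact:
  assumes K: "compact K"
  obtains a b where "0 < a" "0 < b" "\<And>x. x \<in> K \<Longrightarrow> a \<le> \<omega> x" "\<And>x. x \<in> K \<Longrightarrow> \<omega> x \<le> b"
proof (cases "K = {}")
  case False
  have cont: "continuous_on K \<omega>"
    using weight_continuous continuous_on_subset by blast
  obtain x where x: "x \<in> K" "\<forall>y\<in>K. \<omega> x \<le> \<omega> y"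
    using continuous_attains_inf[OF K False cont] by blast
  obtain z where z: "z \<in> K" "\<forall>y\<in>K. \<omega> y \<le> \<omega> z"
    using continuous_attains_sup[OF K False cont] by blast
  show thesis
    by (rule that[of "\<omega> x" "\<omega> z"]) (use x z weight_pos in auto)
qed (use that[of 1 1] in auto)

subsubsection \<open>Membership\<close>

lemma
  assumes f: "f \<in> Lp"
  shows Lp_ltrans: "ltrans a f \<in> Lp" and Lnorm_ltrans_le: "Lnorm (ltrans a f) \<le> \<omega> a * Lnorm f"
proof -
  let ?u = "\<lambda>x. (norm (f x) * \<omega> x) powr p"
  have meas: "ltrans a f \<in> borel_measurable M"
    using measurable_compose[OF measurable_plus Lp_measurable[OF f]] by (simp add: ltrans_def)
  have int: "integrable M (\<lambda>x. \<omega> a powr p * ?u (- a + x))"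
    by (intro integrable_mult_right integrable_plus Lp_integrable f)
  have bound: "AE x in M. (norm (ltrans a f x) * \<omega> x) powr p \<le> \<omega> a powr p * ?u (- a + x)"
  proof (rule AE_I2)
    fix x
    have "\<omega> x \<le> \<omega> a * \<omega> (- a + x)"
      using weight_plus_le[of a "- a + x"] by (simp add: add.assoc[symmetric])
    then have "norm (ltrans a f x) * \<omega> x \<le> norm (ltrans a f x) * (\<omega> a * \<omega> (- a + x))"
      by (rule mult_left_mono) simp
    then have "(norm (ltrans a f x) * \<omega> x) powr p \<le> (\<omega> a * (norm (f (- a + x)) * \<omega> (- a + x))) powr p"
      using p_ge_1 weight_pos[of x] by (intro powr_mono2) (auto simp: ltrans_def mult_ac)
    then show "(norm (ltrans a f x) * \<omega> x) powr p \<le> \<omega> a powr p * ?u (- a + x)"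
      by (simp add: powr_mult)
  qed
  have "?u \<in> borel_measurable borel"
    using Lp_integrable[OF f, THEN borel_measurable_integrable] by simp
  then have integral: "(\<integral>x. \<omega> a powr p * ?u (- a + x) \<partial>M) = (\<omega> a * Lnorm f) powr p"
    by (simp only: integral_mult_right_zero integral_plus[of ?u] powr_mult[of "\<omega> a" "Lnorm f"] Lnorm_powr)
  have nonneg: "0 \<le> \<omega> a * Lnorm f"
    using weight_pos[of a] by simp
  show "ltrans a f \<in> Lp" "Lnorm (ltrans a f) \<le> \<omega> a * Lnorm f"
    by (fact Lp_if_integrable_bound[OF meas int bound eq_refl[OF integral] nonneg]
        Lnorm_le_if_integrable_bound[OF meas int bound eq_refl[OF integral] nonneg])+
qed

lemma Lp_operator_ltrans: "Lp_operator M \<omega> M \<omega> p (ltrans a)"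
  by unfold_locales
    (use Lp_ltrans Lnorm_ltrans_le weight_pos[of a] in \<open>auto simp: ltrans_def intro!: exI[of _ "\<omega> a"]\<close>)

lemma norm_indicator: "norm (indicator A x :: complex) = indicator A x"
  by (simp add: indicator_def)

lemma Lp_indicator_compact: "compact K \<Longrightarrow> indicator K \<in> Lp"
proof -
  assume K: "compact K"
  obtain b where b: "\<And>x. x \<in> K \<Longrightarrow> \<omega> x \<le> b"
    using weight_bounds_compact[OF K] by metis
  have [measurable]: "K \<in> sets borel" "\<omega> \<in> borel_measurable borel"
    using K weight_measurable by (simp_all add: borel_compact)
  have "integrable M (\<lambda>x. (norm (indicator K x :: complex) * \<omega> x) powr p)"
  proof (rule integrable_bounded_compact_support[OF _ K])
    show "(\<lambda>x. (norm (indicator K x :: complex) * \<omega> x) powr p) \<in> borel_measurable borel"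
      unfolding norm_indicator by measurable
    show "norm ((norm (indicator K x :: complex) * \<omega> x) powr p) \<le> b powr p" if "x \<in> K" for x
      using b[OF that] weight_pos[of x] p_ge_1 that by (auto intro!: powr_mono2)
  qed simp
  then show ?thesis
    using K by (simp add: Lp_iff_integrable borel_compact)
qed

lemma
  assumes f: "f \<in> borel_measurable borel" and K: "compact K" and d: "0 \<le> d"
    and le: "\<And>x. norm (f x) \<le> d * indicator K x"
  shows Lp_compact_support: "f \<in> Lp" and Lnorm_compact_support_le: "Lnorm f \<le> d * Lnorm (indicator K)"
proof -
  have meas: "f \<in> borel_measurable M"
    using f by simp
  have bound: "AE x in M. norm (f x) \<le> d * norm (indicator K x :: complex)"
    using le by (intro AE_I2) (simp only: norm_indicator)
  show "f \<in> Lp" "Lnorm f \<le> d * Lnorm (indicator K)"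
    by (fact Lp_dominated[OF Lp_indicator_compact[OF K] meas d bound]
        Lnorm_dominated[OF Lp_indicator_compact[OF K] meas d bound])+
qed

lemma Lp_Cc: "k \<in> Cc \<Longrightarrow> k \<in> Lp"
proof -
  assume k: "k \<in> Cc"
  obtain K where K: "compact K" "\<And>x. x \<notin> K \<Longrightarrow> k x = 0"
    using k by (rule CcE) blast
  obtain B where B: "0 < B" "\<And>x. norm (k x) \<le> B"
    using k by (rule Cc_bounded) blast
  show ?thesis
    by (rule Lp_compact_support[OF Cc_measurable[OF k] K(1), of B])
      (use B K(2) in \<open>auto simp: indicator_def\<close>)
qed

lemma
  assumes K: "compact K" and a: "0 < a" "\<And>x. x \<in> K \<Longrightarrow> a \<le> \<omega> x" and f: "f \<in> Lp"
  shows set_integrable_if_weight_ge: "set_integrable M K f"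
    and set_integral_norm_le_if_weight_ge: "(LINT x:K|M. norm (f x)) \<le> (measure M K + Lnorm f powr p) / a"
proof -
  let ?u = "\<lambda>x. (indicator K x + (norm (f x) * \<omega> x) powr p) / a"
  have le: "norm (indicator K x *\<^sub>R f x) \<le> ?u x" for x
  proof (cases "x \<in> K")
    case True
    have "a * norm (f x) \<le> norm (f x) * \<omega> x"
      using a(2)[OF True] by (simp add: mult.commute mult_right_mono)
    also have "\<dots> \<le> 1 + (norm (f x) * \<omega> x) powr p"
    proof (cases "norm (f x) * \<omega> x \<le> 1")
      case False
      then show ?thesis
        using powr_mono[of 1 p "norm (f x) * \<omega> x"] p_ge_1 by simp
    qed (simp add: add_increasing2)
    finally show ?thesis
      using True a(1) by (simp add: field_simps)
  qed (use a(1) in simp)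
  have int_K: "integrable M (indicator K :: 'g \<Rightarrow> real)"
    using K emeasure_compact[OF K] by (simp add: borel_compact)
  have int_u: "integrable M ?u"
    using int_K Lp_integrable[OF f] by simp
  have int: "integrable M (\<lambda>x. indicator K x *\<^sub>R f x)"
  proof (rule Bochner_Integration.integrable_bound[OF int_u])
    show "(\<lambda>x. indicator K x *\<^sub>R f x) \<in> borel_measurable M"
      using Lp_measurable[OF f] K by (intro borel_measurable_scaleR borel_measurable_indicator) (simp_all add: borel_compact)
    show "AE x in M. norm (indicator K x *\<^sub>R f x) \<le> norm (?u x)"
      using order_trans[OF le abs_ge_self] by (intro AE_I2) (simp only: real_norm_def)
  qed
  then show "set_integrable M K f"
    by (simp add: set_integrable_def)
  have "(LINT x:K|M. norm (f x)) = (\<integral>x. norm (indicator K x *\<^sub>R f x) \<partial>M)"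
    by (simp add: set_lebesgue_integral_def)
  also have "\<dots> \<le> (\<integral>x. ?u x \<partial>M)"
    by (intro integral_mono integrable_norm int int_u le)
  also have "\<dots> = (measure M K + Lnorm f powr p) / a"
    using int_K Lp_integrable[OF f] K by (simp add: Lnorm_powr borel_compact)
  finally show "(LINT x:K|M. norm (f x)) \<le> (measure M K + Lnorm f powr p) / a" .
qed

lemma Lp_set_integrable:
  assumes "compact K" "f \<in> Lp"
  shows "set_integrable M K f"
  using weight_bounds_compact[OF assms(1)] set_integrable_if_weight_ge[OF assms(1) _ _ assms(2)] by metis

text \<open>A substitute for Hoelder's inequality: the previous bound, applied to the normalised function.\<close>

lemma Lp_set_integral_bound:
  assumes K: "compact K"
  shows "\<exists>C\<ge>0. \<forall>f\<in>Lp. (LINT x:K|M. norm (f x)) \<le> C * Lnorm f"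
proof -
  obtain a where a: "0 < a" "\<And>x. x \<in> K \<Longrightarrow> a \<le> \<omega> x"
    using weight_bounds_compact[OF K] by metis
  have "(LINT x:K|M. norm (f x)) \<le> ((measure M K + 1) / a) * Lnorm f" if f: "f \<in> Lp" for f
  proof (cases "Lnorm f = 0")
    case True
    then have "AE x in M. f x = 0"
      by (simp add: Lnorm_eq_0_iff[OF f])
    then have "AE x in M. indicator K x *\<^sub>R norm (f x) = 0"
      by eventually_elim simp
    then have "(LINT x:K|M. norm (f x)) = 0"
      unfolding set_lebesgue_integral_def by (rule integral_eq_zero_AE)
    then show ?thesis
      using True by simp
  next
    case False
    define c where "c = Lnorm f"
    have c: "0 < c"
      using False Lnorm_nonneg[of f] unfolding c_def by linarith
    have "Lnorm (\<lambda>x. complex_of_real (1 / c) * f x) = 1"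
      using c by (subst Lnorm_cmult[OF f]) (simp add: norm_divide flip: c_def)
    then have "(LINT x:K|M. norm (complex_of_real (1 / c) * f x)) \<le> (measure M K + 1) / a"
      using set_integral_norm_le_if_weight_ge[OF K a Lp_cmult[OF f], of "complex_of_real (1 / c)"] by simp
    also have "(LINT x:K|M. norm (complex_of_real (1 / c) * f x)) = (LINT x:K|M. norm (f x)) / c"
      using c by (simp add: norm_mult norm_divide)
    finally show ?thesis
      using c by (simp add: divide_le_eq flip: c_def)
  qed
  then show ?thesis
    using a(1) by (intro exI[of _ "(measure M K + 1) / a"]) simp
qed

lemma Lp_locally_integrable: "f \<in> Lp \<Longrightarrow> locally_integrable f"
  by (simp add: locally_integrable_def Lp_set_integrable)

lemma integral_mult_Cc_bound:
  assumes k: "k \<in> Cc"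
  obtains C where "0 \<le> C" "\<And>f. f \<in> Lp \<Longrightarrow> norm (\<integral>x. f x * k x \<partial>M) \<le> C * Lnorm f"
proof -
  obtain K where K: "compact K" "\<And>x. x \<notin> K \<Longrightarrow> k x = 0"
    using k by (rule CcE) blast
  obtain B where B: "0 < B" "\<And>x. norm (k x) \<le> B"
    using k by (rule Cc_bounded) blast
  obtain C where C: "0 \<le> C" "\<And>f. f \<in> Lp \<Longrightarrow> (LINT x:K|M. norm (f x)) \<le> C * Lnorm f"
    using Lp_set_integral_bound[OF K(1)] by blast
  show thesis
  proof (rule that[of "C * B"])
    show "0 \<le> C * B"
      using B C by simp
    fix f assume f: "f \<in> Lp"
    have "norm (\<integral>x. f x * k x \<partial>M) \<le> (LINT x:K|M. norm (f x)) * B"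
      by (rule norm_integral_mult_Cc_le[OF Lp_locally_integrable[OF f] k K B(2)])
    also have "\<dots> \<le> C * Lnorm f * B"
      using C(2)[OF f] B by (intro mult_right_mono) auto
    finally show "norm (\<integral>x. f x * k x \<partial>M) \<le> C * B * Lnorm f"
      by (simp add: mult_ac)
  qed
qed

subsubsection \<open>Exhaustion by compact sets\<close>

lemma Lp_exhaustion:
  assumes f: "f \<in> Lp"
  obtains L where "\<And>j::nat. compact (L j)" "\<And>j. L j \<subseteq> {x. f x \<noteq> 0}"
    "AE x in M. f x \<noteq> 0 \<longrightarrow> (\<forall>\<^sub>F j in sequentially. x \<in> L j)"
proof -
  let ?u = "\<lambda>x. (norm (f x) * \<omega> x) powr p"
  define A where "A n = {x. 1 / real (Suc n) \<le> ?u x}" for n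
  have "?u \<in> borel_measurable borel"
    using Lp_integrable[OF f, THEN borel_measurable_integrable] by simp
  then have A_borel: "A n \<in> sets borel" for n
    unfolding A_def by measurable
  have A_finite: "emeasure M (A n) < \<infinity>" for n
  proof -
    have "emeasure M {x \<in> space M. 1 / real (Suc n) \<le> ?u x} \<le> ennreal (1 / (1 / real (Suc n)) * (\<integral>x. ?u x \<partial>M))"
      by (rule integral_Markov_inequality[OF Lp_integrable[OF f]]) auto
    then show ?thesis
      by (simp add: A_def le_less_trans)
  qed
  have A_Union: "(\<Union>n. A n) = {x. f x \<noteq> 0}"
  proof (intro set_eqI iffI)
    fix x assume "x \<in> {x. f x \<noteq> 0}"
    then have "0 < ?u x"
      using weight_pos[of x] by simp
    then obtain n where "1 / real (Suc n) < ?u x"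
      using nat_approx_posE by metis
    then show "x \<in> (\<Union>n. A n)"
      by (auto simp: A_def intro: less_imp_le)
  next
    fix x assume "x \<in> (\<Union>n. A n)"
    then obtain n where "1 / real (Suc n) \<le> ?u x"
      by (auto simp: A_def)
    moreover have "0 < 1 / real (Suc n)"
      by simp
    ultimately have "0 < ?u x"
      by (rule less_le_trans[rotated])
    then show "x \<in> {x. f x \<noteq> 0}"
      by auto
  qed
  show thesis
    by (rule compact_exhaustion[of A, OF A_borel A_finite, unfolded A_Union mem_Collect_eq]) (rule that)
qed

lemma AE_if_AE_compact:
  assumes f: "f \<in> Lp" and P: "\<And>K. compact K \<Longrightarrow> K \<subseteq> {x. f x \<noteq> 0} \<Longrightarrow> AE x in M. x \<in> K \<longrightarrow> P x"
  shows "AE x in M. f x \<noteq> 0 \<longrightarrow> P x"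
proof -
  obtain L where L: "\<And>j::nat. compact (L j)" "\<And>j. L j \<subseteq> {x. f x \<noteq> 0}"
    "AE x in M. f x \<noteq> 0 \<longrightarrow> (\<forall>\<^sub>F j in sequentially. x \<in> L j)"
    by (rule Lp_exhaustion[OF f]) blast
  have "AE x in M. \<forall>j. x \<in> L j \<longrightarrow> P x"
    unfolding AE_all_countable by (intro allI P L(1,2))
  with L(3) show ?thesis
  proof eventually_elim
    case (elim x)
    then show ?case
      by (auto dest: eventually_happens'[OF sequentially_bot])
  qed
qed

lemma Lp_cutoff:
  assumes f: "f \<in> Lp"
  obtains L where "\<And>j::nat. compact (L j)" "\<And>j. L j \<subseteq> {x. f x \<noteq> 0}"
    "(\<lambda>j. Lnorm (\<lambda>x. indicator (L j) x * f x - f x)) \<longlonglongrightarrow> 0"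
proof -
  obtain L where L: "\<And>j::nat. compact (L j)" "\<And>j. L j \<subseteq> {x. f x \<noteq> 0}"
    "AE x in M. f x \<noteq> 0 \<longrightarrow> (\<forall>\<^sub>F j in sequentially. x \<in> L j)"
    by (rule Lp_exhaustion[OF f]) blast
  have "AE x in M. (\<lambda>j. indicator (L j) x * f x) \<longlonglongrightarrow> f x"
    using L(3)
  proof eventually_elim
    case (elim x)
    have "\<forall>\<^sub>F j in sequentially. indicator (L j) x * f x = f x"
    proof (cases "f x = 0")
      case False
      then have "\<forall>\<^sub>F j in sequentially. x \<in> L j"
        using elim by simp
      then show ?thesis
        by eventually_elim simp
    qed simp
    then show ?case
      by (rule tendsto_eventually)
  qed
  then have "(\<lambda>j. Lnorm (\<lambda>x. indicator (L j) x * f x - f x)) \<longlonglongrightarrow> 0"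
  proof (rule Lp_dominated_convergence[OF f _ Lp_measurable[OF f], rotated 2])
    show "(\<lambda>x. indicator (L j) x * f x) \<in> borel_measurable M" for j
      using L(1) f by (intro Lp_measurable Lp_indicator_mult) (simp_all add: borel_compact)
    show "AE x in M. norm (indicator (L j) x * f x - f x) \<le> 1 * norm (f x)" for j
      by (auto simp: indicator_def)
  qed
  then show thesis
    by (rule that[OF L(1,2)])
qed

subsubsection \<open>Density of the continuous functions with compact support\<close>

lemma Lnorm_indicator_diff_bump_le:
  assumes k: "bump A U k" and A: "A \<in> sets borel" and U: "U - A \<in> sets borel" "emeasure M (U - A) < \<infinity>"
    and b: "0 \<le> b" "\<And>x. x \<in> U \<Longrightarrow> \<omega> x \<le> b"
  shows "Lnorm (\<lambda>x. indicator A x - complex_of_real (k x)) \<le> b * measure M (U - A) powr (1 / p)"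
proof (rule Lnorm_le_if_integrable_bound[where u = "\<lambda>x. b powr p * indicator (U - A) x"])
  show "(\<lambda>x. indicator A x - complex_of_real (k x)) \<in> borel_measurable M"
    using Cc_measurable[OF Cc_of_real[OF bump_Cc[OF k]]] A
    by (intro borel_measurable_diff borel_measurable_indicator) simp_all
  show "integrable M (\<lambda>x. b powr p * indicator (U - A) x)"
    using U by (intro integrable_mult_right) simp
  show "AE x in M. (norm (indicator A x - complex_of_real (k x)) * \<omega> x) powr p \<le> b powr p * indicator (U - A) x"
  proof (rule AE_I2)
    fix x
    show "(norm (indicator A x - complex_of_real (k x)) * \<omega> x) powr p \<le> b powr p * indicator (U - A) x"
    proof (cases "x \<in> U - A")
      case True
      then have "norm (indicator A x - complex_of_real (k x)) * \<omega> x \<le> 1 * b"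
        using bump_nonneg[OF k, of x] bump_le_1[OF k, of x] b weight_pos[of x] by (intro mult_mono) auto
      then have "(norm (indicator A x - complex_of_real (k x)) * \<omega> x) powr p \<le> (1 * b) powr p"
        using p_ge_1 weight_pos[of x] by (intro powr_mono2) auto
      then show ?thesis
        using True by simp
    next
      case False
      then have "indicator A x = complex_of_real (k x)"
        using bump_eq_1[OF k] bump_eq_0[OF k] by (auto simp: indicator_def)
      then show ?thesis
        by simp
    qed
  qed
  show "(\<integral>x. b powr p * indicator (U - A) x \<partial>M) \<le> (b * measure M (U - A) powr (1 / p)) powr p"
    using U(1) b(1) p_ge_1 by (simp add: powr_mult powr_powr)
qed (use b(1) in simp)

lemma Cc_approx_indicator_compact:
  assumes A: "compact A" and e: "0 < e"
  shows "\<exists>k\<in>Cc. Lnorm (\<lambda>x. indicator A x - k x) < e"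
proof -
  obtain W K where W: "open W" "compact K" "A \<subseteq> W" "W \<subseteq> K"
    using lc_group_compact_nbhd_of_compact[OF lc A open_UNIV subset_UNIV] by metis
  obtain b where b: "0 < b" "\<And>x. x \<in> K \<Longrightarrow> \<omega> x \<le> b"
    using weight_bounds_compact[OF W(2)] by metis
  define d where "d = (e / (2 * b)) powr p"
  have d: "0 < d"
    using e b by (simp add: d_def)
  have A_borel: "A \<in> sets borel"
    by (rule borel_compact[OF A])
  obtain V where V: "open V" "A \<subseteq> V" "emeasure M (V - A) < ennreal d"
    using outer_regular_diff[OF A_borel emeasure_compact[OF A], of "ennreal d"] d by (metis ennreal_less_zero_iff)
  define U where "U = V \<inter> W"
  have U: "open U" "A \<subseteq> U" "U \<subseteq> K" "U - A \<in> sets borel"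
    using V W A_borel by (auto simp: U_def)
  have U_less: "emeasure M (U - A) < ennreal d"
    using V(1,3) A_borel by (intro le_less_trans[OF emeasure_mono[of "U - A" "V - A"]]) (auto simp: U_def)
  then have U_finite: "emeasure M (U - A) < \<infinity>"
    by (rule less_trans) simp
  then have "measure M (U - A) < d"
    using U_less d by (simp add: emeasure_eq_ennreal_measure ennreal_less_iff)
  then have "measure M (U - A) powr (1 / p) \<le> e / (2 * b)"
    using powr_mono2[of "1 / p" "measure M (U - A)" d] p_ge_1 e b(1) by (simp add: d_def powr_powr)
  then have "b * measure M (U - A) powr (1 / p) \<le> b * (e / (2 * b))"
    using b(1) by (intro mult_left_mono) simp_all
  moreover obtain k where k: "bump A U k"
    by (rule bump_exists[OF lc A U(1,2)])
  then have "Lnorm (\<lambda>x. indicator A x - complex_of_real (k x)) \<le> b * measure M (U - A) powr (1 / p)"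
    using b U(3) by (intro Lnorm_indicator_diff_bump_le[OF k A_borel U(4) U_finite]) auto
  ultimately have "Lnorm (\<lambda>x. indicator A x - complex_of_real (k x)) < e"
    using e b(1) by simp
  then show ?thesis
    using Cc_of_real[OF bump_Cc[OF k]] by (rule bexI)
qed

lemma Cc_approx_limit:
  assumes u: "\<And>n. u n \<in> Lp" and f: "f \<in> Lp" and lim: "(\<lambda>n. Lnorm (\<lambda>x. u n x - f x)) \<longlonglongrightarrow> 0"
    and approx: "\<And>n e. 0 < e \<Longrightarrow> \<exists>k\<in>Cc. Lnorm (\<lambda>x. u n x - k x) < e" and e: "0 < e"
  shows "\<exists>k\<in>Cc. Lnorm (\<lambda>x. f x - k x) < e"
proof -
  obtain n where n: "Lnorm (\<lambda>x. u n x - f x) < e / 2"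
    using order_tendstoD(2)[OF lim, of "e / 2"] e by (auto simp: eventually_sequentially)
  obtain k where k: "k \<in> Cc" "Lnorm (\<lambda>x. u n x - k x) < e / 2"
    using approx[of "e / 2" n] e by auto
  have "Lnorm (\<lambda>x. f x - k x) \<le> Lnorm (\<lambda>x. f x - u n x) + Lnorm (\<lambda>x. u n x - k x)"
    by (rule Lnorm_diff_triangle[OF f u Lp_Cc[OF k(1)]])
  also have "\<dots> < e"
    using n k(2) Lnorm_diff_commute[of f "u n"] by simp
  finally show ?thesis
    using k(1) by blast
qed

lemma Cc_approx_indicator:
  assumes A: "indicator A \<in> Lp" and e: "0 < e"
  shows "\<exists>k\<in>Cc. Lnorm (\<lambda>x. indicator A x - k x) < e"
proof -
  obtain L where L: "\<And>j::nat. compact (L j)" "\<And>j. L j \<subseteq> {x. (indicator A x :: complex) \<noteq> 0}"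
    "(\<lambda>j. Lnorm (\<lambda>x. indicator (L j) x * indicator A x - indicator A x)) \<longlonglongrightarrow> 0"
    by (rule Lp_cutoff[OF A]) blast
  have "indicator (L j) x * indicator A x = (indicator (L j) x :: complex)" for j x
    using L(2)[of j] by (auto simp: indicator_def)
  then have "(\<lambda>j. Lnorm (\<lambda>x. indicator (L j) x - indicator A x)) \<longlonglongrightarrow> 0"
    using L(3) by (simp only:)
  then show ?thesis
    by (rule Cc_approx_limit[OF Lp_indicator_compact[OF L(1)] A _ Cc_approx_indicator_compact[OF L(1)] e])
qed

theorem Cc_dense: "f \<in> Lp \<Longrightarrow> 0 < e \<Longrightarrow> \<exists>k\<in>Cc. Lnorm (\<lambda>x. f x - k x) < e"
proof (induction f arbitrary: e rule: Lp_induct)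
  case (indicator a A)
  then have "0 < e / (norm a + 1)"
    by (simp add: add_nonneg_pos)
  then obtain k where k: "k \<in> Cc" "Lnorm (\<lambda>x. indicator A x - k x) < e / (norm a + 1)"
    using Cc_approx_indicator[OF indicator(2)] by blast
  have "Lnorm (\<lambda>x. a * (indicator A x - k x)) = norm a * Lnorm (\<lambda>x. indicator A x - k x)"
    by (rule Lnorm_cmult[OF Lp_diff[OF indicator(2) Lp_Cc[OF k(1)]]])
  also have "\<dots> \<le> norm a * (e / (norm a + 1))"
    using k(2) by (intro mult_left_mono) auto
  also have "\<dots> < e"
    using indicator(3) by (simp add: pos_divide_less_eq add_pos_nonneg algebra_simps)
  finally have "Lnorm (\<lambda>x. a * indicator A x - k x * a) < e"
    by (simp add: right_diff_distrib mult.commute)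
  then show ?case
    using Cc_mult[OF k(1) continuous_on_const, of a] by (rule bexI)
next
  case (add f g)
  obtain k where k: "k \<in> Cc" "Lnorm (\<lambda>x. f x - k x) < e / 2"
    using add.IH(1)[of "e / 2"] add.prems by auto
  obtain l where l: "l \<in> Cc" "Lnorm (\<lambda>x. g x - l x) < e / 2"
    using add.IH(2)[of "e / 2"] add.prems by auto
  have "Lnorm (\<lambda>x. (f x - k x) + (g x - l x)) < e"
    using Minkowski[OF Lp_diff[OF add.hyps(1) Lp_Cc[OF k(1)]] Lp_diff[OF add.hyps(2) Lp_Cc[OF l(1)]]] k(2) l(2) by simp
  then have "Lnorm (\<lambda>x. f x + g x - (k x + l x)) < e"
    by (simp add: algebra_simps)
  then show ?case
    using Cc_add[OF k(1) l(1)] by (rule bexI)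
next
  case (limit u f)
  show ?case
    by (rule Cc_approx_limit[OF limit.hyps(1,2,3) limit.IH limit.prems])
qed

lemma Cc_sequence:
  assumes f: "f \<in> Lp"
  obtains k where "\<And>n::nat. k n \<in> Cc" "(\<lambda>n. Lnorm (\<lambda>x. k n x - f x)) \<longlonglongrightarrow> 0"
proof -
  have "\<exists>k\<in>Cc. Lnorm (\<lambda>x. f x - k x) < 1 / real (Suc n)" for n
    by (rule Cc_dense[OF f]) simp
  then obtain k where k: "\<And>n::nat. k n \<in> Cc" "\<And>n. Lnorm (\<lambda>x. f x - k n x) < 1 / real (Suc n)"
    by metis
  have "(\<lambda>n. Lnorm (\<lambda>x. k n x - f x)) \<longlonglongrightarrow> 0"
    by (rule Lim_null_comparison[OF _ LIMSEQ_Suc[OF lim_inverse_n']], rule always_eventually, rule allI)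
      (use k(2) Lnorm_diff_commute[of f] in \<open>simp add: less_imp_le\<close>)
  then show thesis
    by (rule that[OF k(1)])
qed

end

subsection \<open>Continuity of translation\<close>

lemma (in weighted_haar) ltrans_tendsto_Cc:
  assumes k: "k \<in> Cc"
  shows "((\<lambda>a. Lnorm (\<lambda>x. ltrans a k x - k x)) \<longlongrightarrow> 0) (nhds 0)"
proof (rule tendstoI)
  fix e :: real assume e: "0 < e"
  obtain K where K: "compact K" "\<And>x. x \<notin> K \<Longrightarrow> k x = 0"
    using k by (rule CcE) blast
  obtain V Q where V: "open V" "compact Q" "(0::'g) \<in> V" "V \<subseteq> Q"
    by (rule lc_group_compact_nbhd[OF lc open_UNIV UNIV_I])
  define L where "L = {a + x |a x. a \<in> Q \<and> x \<in> K}"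
  have L: "compact L"
    unfolding L_def by (rule compact_plus[OF V(2) K(1)])
  have off_L: "ltrans a k x = 0" if "a \<in> V" "x \<notin> L" for a x
    using that V(4) unfolding L_def by (intro ltrans_eq_0_off_plus[OF K(2)]) auto
  define d where "d = e / (Lnorm (indicator L) + 1)"
  have pos: "0 < Lnorm (indicator L) + 1"
    by (rule add_nonneg_pos) simp_all
  then have d: "0 < d"
    using e by (simp add: d_def)
  obtain W where W: "open W" "(0::'g) \<in> W"
    and W_close: "\<And>a x. a \<in> W \<Longrightarrow> x \<in> L \<Longrightarrow> norm (ltrans a k x - ltrans 0 k x) \<le> d"
    by (rule ltrans_close_on_compact[OF k L d]) blast
  have "dist (Lnorm (\<lambda>x. ltrans a k x - k x)) 0 < e" if a: "a \<in> V \<inter> W" for a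
  proof -
    have "Lnorm (\<lambda>x. ltrans a k x - k x) \<le> d * Lnorm (indicator L)"
    proof (rule Lnorm_compact_support_le[OF _ L])
      show "(\<lambda>x. ltrans a k x - k x) \<in> borel_measurable borel"
        by (rule Lp_borel_measurable[OF Lp_diff[OF Lp_ltrans Lp_Cc]]) (fact Lp_Cc[OF k] k)+
      show "norm (ltrans a k x - k x) \<le> d * indicator L x" for x
        using W_close[of a x] a off_L[of a x] off_L[OF V(3), of x] by (cases "x \<in> L") auto
    qed (use d in simp)
    also have "\<dots> < d * (Lnorm (indicator L) + 1)"
      using d by simp
    also have "\<dots> = e"
      using pos by (simp add: d_def)
    finally show ?thesis
      by simp
  qed
  then show "\<forall>\<^sub>F a in nhds 0. dist (Lnorm (\<lambda>x. ltrans a k x - k x)) 0 < e"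
    unfolding eventually_nhds using V W by (intro exI[of _ "V \<inter> W"]) auto
qed

context weighted_haar
begin

theorem ltrans_tendsto:
  assumes f: "f \<in> Lp"
  shows "((\<lambda>a. Lnorm (\<lambda>x. ltrans a f x - f x)) \<longlongrightarrow> 0) (nhds 0)"
proof (rule tendstoI)
  fix e :: real assume e: "0 < e"
  obtain V Q where V: "open V" "compact Q" "(0::'g) \<in> V" "V \<subseteq> Q"
    by (rule lc_group_compact_nbhd[OF lc open_UNIV UNIV_I])
  obtain b where b: "0 < b" "\<And>x. x \<in> Q \<Longrightarrow> \<omega> x \<le> b"
    using weight_bounds_compact[OF V(2)] by metis
  define d where "d = e / (2 * (b + 1))"
  have d: "0 < d" "(b + 1) * d = e / 2"
    using e b(1) by (simp_all add: d_def field_simps)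
  obtain k where k: "k \<in> Cc" "Lnorm (\<lambda>x. f x - k x) < d"
    using Cc_dense[OF f d(1)] by blast
  note k_Lp = Lp_Cc[OF k(1)]
  have close: "Lnorm (\<lambda>x. ltrans a f x - f x) \<le> e / 2 + Lnorm (\<lambda>x. ltrans a k x - k x)" if a: "a \<in> V" for a
  proof -
    have "Lnorm (ltrans a (\<lambda>x. f x - k x)) \<le> b * d"
      using Lnorm_ltrans_le[OF Lp_diff[OF f k_Lp], of a] mult_mono[OF b(2)[of a], of "Lnorm (\<lambda>x. f x - k x)" d]
        a V(4) k(2) b(1)
      by auto
    moreover have "Lnorm (\<lambda>x. ltrans a f x - f x) \<le> Lnorm (\<lambda>x. ltrans a f x - ltrans a k x) +
        (Lnorm (\<lambda>x. ltrans a k x - k x) + Lnorm (\<lambda>x. k x - f x))"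
      using Lnorm_diff_triangle[OF Lp_ltrans[OF f, of a] Lp_ltrans[OF k_Lp, of a] f]
        Lnorm_diff_triangle[OF Lp_ltrans[OF k_Lp, of a] k_Lp f]
      by linarith
    ultimately have "Lnorm (\<lambda>x. ltrans a f x - f x) \<le> (b + 1) * d + Lnorm (\<lambda>x. ltrans a k x - k x)"
      using k(2) Lnorm_diff_commute[of k f] by (simp add: ltrans_def distrib_right)
    then show ?thesis
      by (simp only: d(2))
  qed
  have "\<forall>\<^sub>F a in nhds 0. Lnorm (\<lambda>x. ltrans a k x - k x) < e / 2"
    using e by (intro order_tendstoD(2)[OF ltrans_tendsto_Cc[OF k(1)]]) simp
  moreover have "\<forall>\<^sub>F a in nhds 0. a \<in> V"
    using V by (intro eventually_nhds_in_open)
  ultimately show "\<forall>\<^sub>F a in nhds 0. dist (Lnorm (\<lambda>x. ltrans a f x - f x)) 0 < e"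
  proof eventually_elim
    case (elim a)
    then show ?case
      using close[of a] by simp
  qed
qed

subsection \<open>Convolution with compactly supported functions\<close>

lemma borel_measurable_reflect:
  fixes g :: "'g \<Rightarrow> 'b::topological_space"
  shows "g \<in> borel_measurable borel \<Longrightarrow> (\<lambda>y. g (- y + x)) \<in> borel_measurable borel"
  by (rule measurable_compose[OF borel_measurable_continuous_onI[OF continuous_on_minus_plus]])

lemma conv_Cc_integrable:
  assumes "f \<in> Lp" "k \<in> Cc"
  shows "integrable M (\<lambda>y. f y * k (- y + x))"
  by (rule integrable_mult_Cc[OF Lp_locally_integrable Cc_uminus_plus]) fact+

lemma conv_Cc_continuous:
  assumes f: "f \<in> Lp" and k: "k \<in> Cc"
  shows "continuous_on UNIV (conv M f k)"
proof -
  obtain K where K: "compact K" "\<And>x. x \<notin> K \<Longrightarrow> k x = 0"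
    using k by (rule CcE) blast
  have "continuous_on UNIV (\<lambda>x. \<integral>y. f y * (\<lambda>z. k (- snd z + fst z)) (x, y) \<partial>M)"
  proof (rule continuous_on_param_integral[OF _ Lp_locally_integrable[OF f]])
    show "continuous_on UNIV (\<lambda>z. k (- snd z + fst z))"
      by (rule continuous_on_compose2[OF Cc_continuous[OF k]]) (auto intro!: continuous_intros)
    show "\<exists>V L. open V \<and> x \<in> V \<and> compact L \<and> (\<forall>x'\<in>V. \<forall>y. y \<notin> L \<longrightarrow> k (- snd (x', y) + fst (x', y)) = 0)" for x
    proof -
      obtain V Q where V: "open V" "compact Q" "x \<in> V" "V \<subseteq> Q"
        by (rule lc_group_compact_nbhd[OF lc open_UNIV UNIV_I])
      let ?L = "{a + b |a b. a \<in> Q \<and> b \<in> uminus ` K}"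
      have "k (- y + x') = 0" if "x' \<in> V" "y \<notin> ?L" for x' y
      proof (rule K(2), rule notI)
        assume "- y + x' \<in> K"
        then have "x' + - (- y + x') \<in> ?L"
          using that(1) V(4) by blast
        then show False
          using that(2) by (simp add: minus_add add.assoc[symmetric] del: add_uminus_conv_diff)
      qed
      moreover have "compact ?L"
        by (intro compact_plus compact_uminus K V)
      ultimately show ?thesis
        using V by (intro exI[of _ V] exI[of _ ?L]) simp
    qed
  qed
  then show ?thesis
    by (simp add: conv_def[abs_def])
qed

lemma conv_cmult_left: "conv M (\<lambda>x. a * f x) k x = a * conv M f k x"
  unfolding conv_def by (simp add: mult.assoc)

lemma conv_diff_left:
  assumes "f \<in> Lp" "g \<in> Lp" "k \<in> Cc"
  shows "conv M (\<lambda>x. f x - g x) k x = conv M f k x - conv M g k x"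
  unfolding conv_def using conv_Cc_integrable[OF assms(1,3)] conv_Cc_integrable[OF assms(2,3)]
  by (simp add: left_diff_distrib)

lemma conv_Cc_tendsto:
  assumes u: "\<And>i. u i \<in> Lp" and f: "f \<in> Lp" and lim: "((\<lambda>i. Lnorm (\<lambda>x. u i x - f x)) \<longlongrightarrow> 0) F" and k: "k \<in> Cc"
  shows "((\<lambda>i. conv M (u i) k x) \<longlongrightarrow> conv M f k x) F"
proof -
  obtain C where C: "0 \<le> C" "\<And>f. f \<in> Lp \<Longrightarrow> norm (\<integral>y. f y * k (- y + x) \<partial>M) \<le> C * Lnorm f"
    by (rule integral_mult_Cc_bound[OF Cc_uminus_plus[OF k]]) blast
  show ?thesis
  proof (rule LIM_zero_cancel, rule Lim_null_comparison[OF always_eventually tendsto_mult_right_zero[OF lim, of C]], rule allI)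
    show "norm (conv M (u i) k x - conv M f k x) \<le> C * Lnorm (\<lambda>x. u i x - f x)" for i
      using C(2)[OF Lp_diff[OF u f]] unfolding conv_diff_left[OF u f k, symmetric] by (simp add: conv_def)
  qed
qed

lemma conv_ltrans:
  assumes f: "f \<in> borel_measurable borel" and g: "g \<in> borel_measurable borel"
  shows "conv M (ltrans a f) g = ltrans a (conv M f g)"
proof
  fix x
  have "(\<lambda>y. f (- a + y) * g (- y + x)) \<in> borel_measurable borel"
    using g by (intro borel_measurable_times borel_measurable_reflect
        measurable_compose[OF borel_measurable_continuous_onI[OF continuous_on_plus_left] f])
  from integral_plus[OF this, of a] show "conv M (ltrans a f) g x = ltrans a (conv M f g) x"
    by (simp add: conv_def ltrans_def add.assoc[symmetric] minus_add diff_conv_add_uminus del: add_uminus_conv_diff)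
qed

lemma conv_cong_left:
  assumes [measurable]: "f \<in> borel_measurable borel" "f' \<in> borel_measurable borel" "g \<in> borel_measurable borel"
    and "AE x in M. f x = f' x"
  shows "conv M f g = conv M f' g"
proof
  fix x
  have [measurable]: "(\<lambda>y. g (- y + x)) \<in> borel_measurable borel"
    by (rule borel_measurable_reflect) fact
  show "conv M f g x = conv M f' g x"
    unfolding conv_def by (rule integral_cong_AE) (use assms(4) in auto)
qed

lemma conv_cong_right:
  assumes f: "f \<in> Lp" and g: "g \<in> borel_measurable borel" "g' \<in> borel_measurable borel"
    and eq: "AE x in M. g x = g' x"
  shows "conv M f g = conv M f g'"
proof
  fix x
  have "AE y in M. f y \<noteq> 0 \<longrightarrow> g (- y + x) = g' (- y + x)"
  proof (rule AE_if_AE_compact[OF f])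
    fix K :: "'g set" assume "compact K"
    then have "compact ((+) (- x) ` K)"
      by (rule compact_continuous_image[OF continuous_on_plus_left])
    from AE_plus[OF AE_uminus_compact[OF this eq], of "- x"]
    show "AE y in M. y \<in> K \<longrightarrow> g (- y + x) = g' (- y + x)"
      by eventually_elim (simp add: minus_add)
  qed
  moreover have "(\<lambda>y. f y * g (- y + x)) \<in> borel_measurable M" "(\<lambda>y. f y * g' (- y + x)) \<in> borel_measurable M"
    using borel_measurable_reflect[of g] borel_measurable_reflect[of g'] Lp_borel_measurable[OF f] g
    by (simp_all add: borel_measurable_times)
  ultimately show "conv M f g x = conv M f g' x"
    unfolding conv_def by (intro integral_cong_AE) (auto elim: eventually_mono)
qed

end

subsection \<open>Compactly supported functions separate points\<close>

definition clip :: "complex \<Rightarrow> complex" where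
  "clip z = z / complex_of_real (max 1 (norm z))"

lemma continuous_on_clip: "continuous_on UNIV clip"
  unfolding clip_def by (intro continuous_intros) auto

lemma norm_clip_le: "norm (clip z) \<le> 1"
  by (auto simp: clip_def norm_divide divide_le_eq_1)

lemma clip_eq: "norm z \<le> 1 \<Longrightarrow> clip z = z"
  by (simp add: clip_def max_absorb1)

context weighted_haar
begin

lemma bounded_approx_Cc:
  fixes w :: "'g \<Rightarrow> complex"
  assumes w: "w \<in> borel_measurable borel" and K: "compact K" and le: "\<And>x. norm (w x) \<le> indicator K x"
  obtains v L where "compact L" "\<And>n::nat. v n \<in> Cc" "\<And>n x. norm (v n x) \<le> indicator L x"
    "AE x in M. (\<lambda>n. v n x) \<longlonglongrightarrow> w x"
proof -
  have w_Lp: "w \<in> Lp"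
    by (rule Lp_compact_support[OF w K, of 1]) (use le in simp_all)
  obtain k where k: "\<And>n::nat. k n \<in> Cc" "(\<lambda>n. Lnorm (\<lambda>x. k n x - w x)) \<longlonglongrightarrow> 0"
    by (rule Cc_sequence[OF w_Lp]) blast
  obtain r :: "nat \<Rightarrow> nat" where r: "AE x in M. (\<lambda>n. k (r n) x) \<longlonglongrightarrow> w x"
    by (rule Lp_tendsto_AE_subseq[OF Lp_Cc[OF k(1)] w_Lp k(2)]) blast
  obtain b where b: "bump K UNIV b"
    by (rule bump_exists[OF lc K open_UNIV subset_UNIV])
  obtain L where L: "compact L" "\<And>x. x \<notin> L \<Longrightarrow> b x = 0"
    using bump_Cc[OF b] by (rule CcE) blast
  define v where "v n x = complex_of_real (b x) * clip (k (r n) x)" for n x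
  show thesis
  proof (rule that[OF L(1), of v])
    show "v n \<in> Cc" for n
      unfolding v_def using continuous_on_compose2[OF continuous_on_clip Cc_continuous[OF k(1)]]
      by (intro Cc_mult[OF Cc_of_real[OF bump_Cc[OF b]]]) auto
    show "norm (v n x) \<le> indicator L x" for n x
      using mult_mono[OF bump_le_1[OF b, of x] norm_clip_le[of "k (r n) x"]] bump_nonneg[OF b, of x] L(2)[of x]
      by (cases "x \<in> L") (simp_all add: v_def norm_mult)
    show "AE x in M. (\<lambda>n. v n x) \<longlonglongrightarrow> w x"
      using r
    proof eventually_elim
      case (elim x)
      have "norm (w x) \<le> 1" "x \<notin> K \<Longrightarrow> w x = 0"
        using le[of x] by (cases "x \<in> K"; simp)+
      then have "complex_of_real (b x) * clip (w x) = w x"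
        using bump_eq_1[OF b, of x] by (cases "x \<in> K") (simp_all add: clip_eq)
      then show ?case
        using tendsto_mult_left[OF continuous_on_tendsto_compose[OF continuous_on_clip elim], of "complex_of_real (b x)"]
        by (simp add: v_def)
    qed
  qed
qed

lemma orthogonal_bounded_if_orthogonal_Cc:
  assumes h: "h \<in> Lp" and orthogonal: "\<And>v. v \<in> Cc \<Longrightarrow> (\<integral>x. h x * v x \<partial>M) = 0"
    and w: "w \<in> borel_measurable borel" and K: "compact K" and le: "\<And>x. norm (w x) \<le> indicator K x"
  shows "(\<integral>x. h x * w x \<partial>M) = 0"
proof -
  have [measurable]: "h \<in> borel_measurable M"
    by (rule Lp_measurable[OF h])
  obtain v L where L: "compact L" and v: "\<And>n::nat. v n \<in> Cc" "\<And>n x. norm (v n x) \<le> indicator L x"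
    "AE x in M. (\<lambda>n. v n x) \<longlonglongrightarrow> w x"
    by (rule bounded_approx_Cc[OF w K le]) blast
  have "(\<lambda>n. \<integral>x. h x * v n x \<partial>M) \<longlonglongrightarrow> (\<integral>x. h x * w x \<partial>M)"
  proof (rule integral_dominated_convergence)
    show "integrable M (\<lambda>x. norm (indicator L x *\<^sub>R h x))"
      by (rule integrable_norm) (use Lp_set_integrable[OF L h] in \<open>simp add: set_integrable_def\<close>)
    show "(\<lambda>x. h x * w x) \<in> borel_measurable M" "(\<lambda>x. h x * v n x) \<in> borel_measurable M" for n
      using w Cc_measurable[OF v(1)[of n]] by simp_all
    show "AE x in M. norm (h x * v n x) \<le> norm (indicator L x *\<^sub>R h x)" for n
      by (intro AE_I2) (simp add: norm_mult mult.commute[of "indicator L _"] mult_left_mono v(2))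
    show "AE x in M. (\<lambda>n. h x * v n x) \<longlonglongrightarrow> h x * w x"
      using v(3) by eventually_elim (rule tendsto_mult_left)
  qed
  then show ?thesis
    unfolding orthogonal[OF v(1)] by (simp add: LIMSEQ_const_iff)
qed

lemma AE_eq_0_if_orthogonal_Cc:
  assumes h: "h \<in> Lp" and orthogonal: "\<And>v. v \<in> Cc \<Longrightarrow> (\<integral>x. h x * v x \<partial>M) = 0"
  shows "AE x in M. h x = 0"
proof -
  have [measurable]: "h \<in> borel_measurable borel"
    by (rule Lp_borel_measurable[OF h])
  have [measurable]: "cnj \<in> borel_measurable borel"
    by (intro borel_measurable_continuous_onI continuous_intros)
  have "AE x in M. h x \<noteq> 0 \<longrightarrow> h x = 0"
  proof (rule AE_if_AE_compact[OF h])
    fix K :: "'g set" assume K: "compact K"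
    then have [measurable]: "K \<in> sets borel"
      by (rule borel_compact)
    define w where "w x = indicator K x * cnj (sgn (h x))" for x
    have "(\<integral>x. h x * w x \<partial>M) = 0"
    proof (rule orthogonal_bounded_if_orthogonal_Cc[OF h orthogonal _ K])
      show "w \<in> borel_measurable borel"
        unfolding w_def sgn_div_norm by measurable
      show "norm (w x) \<le> indicator K x" for x
        by (auto simp: w_def norm_sgn indicator_def)
    qed
    moreover have "h x * w x = complex_of_real (indicator K x * norm (h x))" for x
    proof -
      have "h x * cnj (sgn (h x)) = complex_of_real (norm (h x))"
        by (cases "h x = 0") (simp_all add: sgn_eq complex_norm_square[symmetric] power2_eq_square)
      then show ?thesis
        by (simp add: w_def indicator_def)
    qed
    ultimately have "complex_of_real (\<integral>x. indicator K x * norm (h x) \<partial>M) = 0"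
      by (simp only: integral_complex_of_real)
    moreover have "integrable M (\<lambda>x. indicator K x * norm (h x))"
      using set_integrable_norm[OF Lp_set_integrable[OF K h]] by (simp add: set_integrable_def)
    ultimately have "AE x in M. indicator K x * norm (h x) = 0"
      by (subst integral_nonneg_eq_0_iff_AE[symmetric]) simp_all
    then show "AE x in M. x \<in> K \<longrightarrow> h x = 0"
      by eventually_elim auto
  qed
  then show ?thesis
    by eventually_elim blast
qed

lemma conv_determines:
  assumes f: "f \<in> Lp" and g: "g \<in> Lp" and eq: "\<And>k. k \<in> Cc \<Longrightarrow> conv M f k 0 = conv M g k 0"
  shows "AE x in M. f x = g x"
proof -
  have "AE x in M. f x - g x = 0"
  proof (rule AE_eq_0_if_orthogonal_Cc[OF Lp_diff[OF f g]])
    fix v :: "'g \<Rightarrow> complex" assume v: "v \<in> Cc"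
    have "conv M (\<lambda>x. f x - g x) (\<lambda>y. v (- y)) 0 = 0"
      using conv_diff_left[OF f g Cc_uminus[OF v], of 0] eq[OF Cc_uminus[OF v]] by simp
    then show "(\<integral>x. (f x - g x) * v x \<partial>M) = 0"
      by (simp add: conv_def)
  qed
  then show ?thesis
    by eventually_elim simp
qed

end

subsection \<open>Essential support\<close>

lemma AE_compact_if_AE_locally:
  assumes K: "compact K" and local: "\<And>y. y \<in> K \<Longrightarrow> \<exists>U. open U \<and> y \<in> U \<and> (AE z in M. z \<in> U \<longrightarrow> P z)"
  shows "AE z in M. z \<in> K \<longrightarrow> P z"
proof -
  obtain U where U: "\<And>y. y \<in> K \<Longrightarrow> open (U y) \<and> y \<in> U y \<and> (AE z in M. z \<in> U y \<longrightarrow> P z)"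
    using local by metis
  obtain Y where Y: "Y \<subseteq> K" "finite Y" "K \<subseteq> (\<Union>y\<in>Y. U y)"
    by (rule compactE_image[OF K, of K U]) (use U in auto)
  have "AE z in M. \<forall>y\<in>Y. z \<in> U y \<longrightarrow> P z"
    using U Y by (intro AE_finite_allI) auto
  then show ?thesis
    by eventually_elim (use Y in blast)
qed

context weighted_haar
begin

definition esupp :: "('g \<Rightarrow> complex) \<Rightarrow> 'g set" where
  "esupp f = {y. \<forall>U. open U \<and> y \<in> U \<longrightarrow> \<not> (AE z in M. z \<in> U \<longrightarrow> f z = 0)}"

lemma closed_esupp: "closed (esupp f)"
  unfolding closed_def
proof (subst open_subopen, rule ballI)
  fix y assume "y \<in> - esupp f"
  then obtain U where "open U" "y \<in> U" "AE z in M. z \<in> U \<longrightarrow> f z = 0"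
    by (auto simp: esupp_def)
  then show "\<exists>T. open T \<and> y \<in> T \<and> T \<subseteq> - esupp f"
    by (intro exI[of _ U]) (auto simp: esupp_def)
qed

lemma esupp_subset:
  assumes "closed C" "AE x in M. x \<notin> C \<longrightarrow> f x = 0"
  shows "esupp f \<subseteq> C"
proof
  fix y assume "y \<in> esupp f"
  then have "\<not> (open (- C) \<and> y \<in> - C)"
    using assms(2) by (auto simp: esupp_def)
  then show "y \<in> C"
    using assms(1) by auto
qed

lemma AE_esupp:
  assumes f: "f \<in> Lp"
  shows "AE z in M. z \<notin> esupp f \<longrightarrow> f z = 0"
proof -
  have "(\<lambda>z. indicator (- esupp f) z * f z) \<in> Lp"
    using closed_esupp by (intro Lp_indicator_mult[OF f]) simp
  then have "AE z in M. indicator (- esupp f) z * f z \<noteq> 0 \<longrightarrow> f z = 0"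
  proof (rule AE_if_AE_compact)
    fix K assume K: "compact K" "K \<subseteq> {z. indicator (- esupp f) z * f z \<noteq> 0}"
    show "AE z in M. z \<in> K \<longrightarrow> f z = 0"
    proof (rule AE_compact_if_AE_locally[OF K(1)])
      fix y assume "y \<in> K"
      then have "y \<notin> esupp f"
        using K(2) by auto
      then show "\<exists>U. open U \<and> y \<in> U \<and> (AE z in M. z \<in> U \<longrightarrow> f z = 0)"
        by (auto simp: esupp_def)
    qed
  qed
  then show ?thesis
    by eventually_elim auto
qed

lemma esupp_eq_empty_iff:
  assumes f: "f \<in> Lp"
  shows "esupp f = {} \<longleftrightarrow> (AE x in M. f x = 0)"
  using AE_esupp[OF f] esupp_subset[of "{}" f] by auto

lemma conv_pos:
  fixes u k :: "'g \<Rightarrow> real"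
  assumes u: "(\<lambda>x. complex_of_real (u x)) \<in> Lp" "\<And>x. 0 \<le> u x" and y: "y \<in> esupp (\<lambda>x. complex_of_real (u x))"
    and k: "k \<in> Cc" "\<And>x. 0 \<le> k x" "0 < k s"
  shows "conv M (\<lambda>x. complex_of_real (u x)) (\<lambda>x. complex_of_real (k x)) (y + s) \<noteq> 0"
proof
  let ?W = "{z. 0 < k (- z + (y + s))}"
  assume zero: "conv M (\<lambda>x. complex_of_real (u x)) (\<lambda>x. complex_of_real (k x)) (y + s) = 0"
  have "integrable M (\<lambda>z. complex_of_real (u z * k (- z + (y + s))))"
    using conv_Cc_integrable[OF u(1) Cc_of_real[OF k(1)]] by simp
  then have int: "integrable M (\<lambda>z. u z * k (- z + (y + s)))"
    by (simp only: complex_of_real_integrable_eq)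
  have "(\<integral>z. u z * k (- z + (y + s)) \<partial>M) = 0"
    using zero by (simp only: conv_def integral_complex_of_real of_real_eq_0_iff flip: of_real_mult)
  then have "AE z in M. u z * k (- z + (y + s)) = 0"
    using integral_nonneg_eq_0_iff_AE[OF int] u(2) k(2) by simp
  then have "AE z in M. z \<in> ?W \<longrightarrow> complex_of_real (u z) = 0"
    by eventually_elim auto
  moreover have "open ?W"
    by (intro open_Collect_less continuous_on_compose2[OF Cc_continuous[OF k(1)]] continuous_on_minus_plus continuous_on_const) simp
  moreover have "y \<in> ?W"
    using k(3) by (simp add: add.assoc[symmetric])
  ultimately show False
    using y unfolding esupp_def by blast
qed

end

subsection \<open>Convolution as a limit of combinations of translates\<close>

context weighted_haar
begin

lemma conv_Cc_Cc_support:
  assumes f: "\<And>x. x \<notin> K \<Longrightarrow> f x = 0" and k: "\<And>x. x \<notin> Q \<Longrightarrow> k x = 0"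
    and z: "z \<notin> {x + y |x y. x \<in> K \<and> y \<in> Q}"
  shows "conv M f k z = 0"
proof -
  have "f y * k (- y + z) = 0" for y
  proof (cases "y \<in> K")
    case True
    have "ltrans y k z = 0"
      by (rule ltrans_eq_0_off_plus[OF k True z])
    then show ?thesis
      by (simp add: ltrans_def)
  qed (simp add: f)
  then show ?thesis
    unfolding conv_def by (simp only: integral_zero)
qed

lemma conv_Cc:
  assumes f: "f \<in> Cc" and k: "k \<in> Cc"
  shows "conv M f k \<in> Cc"
proof -
  obtain K where K: "compact K" "\<And>x. x \<notin> K \<Longrightarrow> f x = 0"
    using f by (rule CcE) blast
  obtain Q where Q: "compact Q" "\<And>x. x \<notin> Q \<Longrightarrow> k x = 0"
    using k by (rule CcE) blast
  show ?thesis
    by (rule CcI[OF conv_Cc_continuous[OF Lp_Cc[OF f] k] compact_plus[OF K(1) Q(1)] conv_Cc_Cc_support[OF K(2) Q(2)]])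
qed

lemma reflect_locally_integrable:
  assumes g: "g \<in> Lp"
  shows "locally_integrable (\<lambda>y. g (- y + x))"
  unfolding locally_integrable_def
proof (intro allI impI)
  fix K :: "'g set" assume K: "compact K"
  have "set_integrable M ((\<lambda>y. - y + x) ` K) g"
    by (rule Lp_set_integrable[OF compact_continuous_image[OF continuous_on_minus_plus K] g])
  then show "set_integrable M K (\<lambda>y. g (- y + x))"
    using set_integral_minus_plus_le[OF K] Lp_borel_measurable[OF g] by metis
qed

lemma conv_Cc_left_integrable:
  assumes "f \<in> Cc" "g \<in> Lp"
  shows "integrable M (\<lambda>y. f y * g (- y + x))"
  using integrable_mult_Cc[OF reflect_locally_integrable[OF assms(2)] assms(1)] by (simp add: mult.commute)

lemma conv_Cc_left_bound:
  assumes f: "f \<in> Cc"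
  obtains C where "0 \<le> C" "\<And>g. g \<in> Lp \<Longrightarrow> norm (conv M f g x) \<le> C * Lnorm g"
proof -
  obtain K where K: "compact K" "\<And>x. x \<notin> K \<Longrightarrow> f x = 0"
    using f by (rule CcE) blast
  obtain B where B: "0 < B" "\<And>x. norm (f x) \<le> B"
    using f by (rule Cc_bounded) blast
  define L where "L = (\<lambda>y. - y + x) ` K"
  have L: "compact L"
    unfolding L_def by (rule compact_continuous_image[OF continuous_on_minus_plus K(1)])
  obtain C where C: "0 < C" "\<And>g :: 'g \<Rightarrow> complex. g \<in> borel_measurable borel \<Longrightarrow> set_integrable M L g \<Longrightarrow>
      set_integrable M K (\<lambda>y. g (- y + x)) \<and> (LINT y:K|M. norm (g (- y + x))) \<le> C * (LINT y:L|M. norm (g y))"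
    unfolding L_def by (rule set_integral_minus_plus_le[OF K(1)]) blast
  obtain D where D: "0 \<le> D" "\<And>g. g \<in> Lp \<Longrightarrow> (LINT y:L|M. norm (g y)) \<le> D * Lnorm g"
    using Lp_set_integral_bound[OF L] by blast
  show thesis
  proof (rule that[of "C * D * B"])
    fix g assume g: "g \<in> Lp"
    have "norm (conv M f g x) = norm (\<integral>y. g (- y + x) * f y \<partial>M)"
      by (simp add: conv_def mult.commute)
    also have "\<dots> \<le> (LINT y:K|M. norm (g (- y + x))) * B"
      by (rule norm_integral_mult_Cc_le[OF reflect_locally_integrable[OF g] f K B(2)])
    also have "\<dots> \<le> (C * (D * Lnorm g)) * B"
    proof (rule mult_right_mono)
      have "(LINT y:K|M. norm (g (- y + x))) \<le> C * (LINT y:L|M. norm (g y))"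
        using C(2)[OF Lp_borel_measurable[OF g] Lp_set_integrable[OF L g]] by blast
      also have "\<dots> \<le> C * (D * Lnorm g)"
        using C(1) D(2)[OF g] by (intro mult_left_mono) auto
      finally show "(LINT y:K|M. norm (g (- y + x))) \<le> C * (D * Lnorm g)" .
    qed (use B(1) in simp)
    finally show "norm (conv M f g x) \<le> C * D * B * Lnorm g"
      by (simp add: mult_ac)
  qed (use B C(1) D(1) in simp)
qed

lemma conv_diff_right:
  assumes "f \<in> Cc" "g \<in> Lp" "h \<in> Lp"
  shows "conv M f (\<lambda>x. g x - h x) x = conv M f g x - conv M f h x"
  unfolding conv_def using conv_Cc_left_integrable[OF assms(1,2)] conv_Cc_left_integrable[OF assms(1,3)]
  by (simp add: right_diff_distrib)

lemma conv_Cc_left_tendsto: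
  assumes f: "f \<in> Cc" and u: "\<And>n. u n \<in> Lp" and g: "g \<in> Lp" and lim: "((\<lambda>n. Lnorm (\<lambda>x. u n x - g x)) \<longlongrightarrow> 0) F"
  shows "((\<lambda>n. conv M f (u n) x) \<longlongrightarrow> conv M f g x) F"
proof -
  obtain C where C: "0 \<le> C" "\<And>g. g \<in> Lp \<Longrightarrow> norm (conv M f g x) \<le> C * Lnorm g"
    by (rule conv_Cc_left_bound[OF f]) blast
  show ?thesis
  proof (rule LIM_zero_cancel, rule Lim_null_comparison[OF always_eventually tendsto_mult_right_zero[OF lim, of C]], rule allI)
    show "norm (conv M f (u n) x - conv M f g x) \<le> C * Lnorm (\<lambda>x. u n x - g x)" for n
      using C(2)[OF Lp_diff[OF u g]] unfolding conv_diff_right[OF f u g] .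
  qed
qed

end

locale weighted_haar_Cc = weighted_haar M \<omega> p for M :: "'g::{topological_group_add,t2_space} measure" and \<omega> p +
  fixes f :: "'g \<Rightarrow> complex" and K b
  assumes f_Cc: "f \<in> Cc" and K: "compact K" and off_K: "\<And>x. x \<notin> K \<Longrightarrow> f x = 0"
    and b_nonneg: "0 \<le> b" and weight_le_b: "\<And>x. x \<in> K \<Longrightarrow> \<omega> x \<le> b"
begin

abbreviation mass :: real where
  "mass \<equiv> \<integral>x. norm (f x) \<partial>M"

lemma
  assumes P: "subordinate_partition K V n t A" and g: "g \<in> Lp"
  shows Lp_riemann_sum_ltrans: "(\<lambda>z. riemann_sum M f n t A (\<lambda>x. ltrans x g z)) \<in> Lp"
    and Lnorm_riemann_sum_ltrans_le: "Lnorm (\<lambda>z. riemann_sum M f n t A (\<lambda>x. ltrans x g z)) \<le> b * mass * Lnorm g"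
proof -
  let ?c = "\<lambda>i. LINT x:A i|M. f x"
  have Lp: "ltrans (t i) g \<in> Lp" for i
    by (rule Lp_ltrans[OF g])
  show "(\<lambda>z. riemann_sum M f n t A (\<lambda>x. ltrans x g z)) \<in> Lp"
    unfolding riemann_sum_def by (intro Lp_sum finite_lessThan Lp)
  have "Lnorm (\<lambda>z. riemann_sum M f n t A (\<lambda>x. ltrans x g z)) \<le> (\<Sum>i<n. norm (?c i) * Lnorm (ltrans (t i) g))"
    unfolding riemann_sum_def by (intro Lnorm_sum_le finite_lessThan Lp)
  also have "\<dots> \<le> (\<Sum>i<n. norm (?c i) * (b * Lnorm g))"
  proof (intro sum_mono mult_left_mono)
    fix i assume "i \<in> {..<n}"
    then have "\<omega> (t i) \<le> b"
      using P by (intro weight_le_b) (simp add: subordinate_partition_def)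
    then show "Lnorm (ltrans (t i) g) \<le> b * Lnorm g"
      using Lnorm_ltrans_le[OF g, of "t i"] mult_right_mono[of "\<omega> (t i)" b "Lnorm g"] by simp
  qed simp
  also have "\<dots> = (\<Sum>i<n. norm (?c i)) * (b * Lnorm g)"
    by (simp add: sum_distrib_right)
  also have "\<dots> \<le> mass * (b * Lnorm g)"
    using b_nonneg by (intro mult_right_mono sum_norm_set_integral_le[OF integrable_Cc[OF f_Cc] P]) simp
  finally show "Lnorm (\<lambda>z. riemann_sum M f n t A (\<lambda>x. ltrans x g z)) \<le> b * mass * Lnorm g"
    by (simp add: mult_ac)
qed

lemma norm_conv_diff_riemann_sum_le:
  assumes k: "k \<in> Cc" and Q: "\<And>x. x \<notin> Q \<Longrightarrow> k x = 0" and P: "subordinate_partition K V n t A" and d: "0 \<le> d"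
    and close: "\<And>x x' z. x' \<in> V x \<Longrightarrow> z \<in> L \<Longrightarrow> norm (ltrans x' k z - ltrans x k z) \<le> d"
    and L: "L = {x + y |x y. x \<in> K \<and> y \<in> Q}"
  shows "norm (conv M f k z - riemann_sum M f n t A (\<lambda>x. ltrans x k z)) \<le> d * mass * indicator L z"
proof (cases "z \<in> L")
  case True
  have "integrable M (\<lambda>x. f x * ltrans x k z)"
    unfolding ltrans_def by (rule conv_Cc_integrable[OF Lp_Cc[OF f_Cc] k])
  from norm_integral_diff_riemann_sum_le[OF integrable_Cc[OF f_Cc] this off_K P close[OF _ True]] True
  show ?thesis
    by (simp add: conv_def ltrans_def)
next
  case False
  have "ltrans (t i) k z = 0" if "i < n" for i
    using P that False unfolding L by (intro ltrans_eq_0_off_plus[OF Q]) (auto simp: subordinate_partition_def)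
  then have "riemann_sum M f n t A (\<lambda>x. ltrans x k z) = 0"
    unfolding riemann_sum_def by (intro sum.neutral) simp
  moreover have "conv M f k z = 0"
    using False unfolding L by (intro conv_Cc_Cc_support[of K _ Q]) (auto simp: off_K Q)
  ultimately show ?thesis
    by (simp add: False)
qed

lemma conv_riemann_sum_Cc:
  assumes k: "k \<in> Cc" and e: "0 < e"
  obtains V where "\<And>x. open (V x)" "\<And>x. x \<in> V x"
    "\<And>n t A. subordinate_partition K V n t A \<Longrightarrow>
      Lnorm (\<lambda>z. conv M f k z - riemann_sum M f n t A (\<lambda>x. ltrans x k z)) < e"
proof -
  obtain Q where Q: "compact Q" "\<And>x. x \<notin> Q \<Longrightarrow> k x = 0"
    using k by (rule CcE) blast
  define L where "L = {x + y |x y. x \<in> K \<and> y \<in> Q}"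
  have L: "compact L"
    unfolding L_def by (rule compact_plus[OF K Q(1)])
  define d where "d = e / (mass * Lnorm (indicator L) + 1)"
  have pos: "0 < mass * Lnorm (indicator L) + 1"
    by (intro add_nonneg_pos mult_nonneg_nonneg) simp_all
  then have d: "0 < d"
    using e by (simp add: d_def)
  have "\<exists>V. open V \<and> x \<in> V \<and> (\<forall>x'\<in>V. \<forall>z\<in>L. norm (ltrans x' k z - ltrans x k z) \<le> d)" for x
    by (rule ltrans_close_on_compact[OF k L d, of x]) auto
  then obtain V where V: "\<And>x. open (V x)" "\<And>x. x \<in> V x"
    and V_close: "\<And>x x' z. x' \<in> V x \<Longrightarrow> z \<in> L \<Longrightarrow> norm (ltrans x' k z - ltrans x k z) \<le> d"
    by metis
  show thesis
  proof (rule that[OF V])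
    fix n t A assume P: "subordinate_partition K V n t A"
    have "Lnorm (\<lambda>z. conv M f k z - riemann_sum M f n t A (\<lambda>x. ltrans x k z)) \<le> d * mass * Lnorm (indicator L)"
    proof (rule Lnorm_compact_support_le[OF _ L])
      show "(\<lambda>z. conv M f k z - riemann_sum M f n t A (\<lambda>x. ltrans x k z)) \<in> borel_measurable borel"
        by (rule Lp_borel_measurable[OF Lp_diff[OF Lp_Cc[OF conv_Cc[OF f_Cc k]] Lp_riemann_sum_ltrans[OF P Lp_Cc[OF k]]]])
      show "norm (conv M f k z - riemann_sum M f n t A (\<lambda>x. ltrans x k z)) \<le> d * mass * indicator L z" for z
        by (rule norm_conv_diff_riemann_sum_le[OF k Q(2) P less_imp_le[OF d] V_close L_def])
    qed (use d in simp)
    also have "\<dots> < d * (mass * Lnorm (indicator L) + 1)"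
      using d by (simp add: distrib_left mult.assoc)
    also have "\<dots> = e"
      using pos by (simp add: d_def)
    finally show "Lnorm (\<lambda>z. conv M f k z - riemann_sum M f n t A (\<lambda>x. ltrans x k z)) < e" .
  qed
qed

lemma Lnorm_conv_Cc_le:
  assumes k: "k \<in> Cc"
  shows "Lnorm (conv M f k) \<le> b * mass * Lnorm k"
proof (rule field_le_epsilon)
  fix e :: real assume e: "0 < e"
  obtain V where V: "\<And>x. open (V x)" "\<And>x. x \<in> V x" "\<And>n t A. subordinate_partition K V n t A \<Longrightarrow>
      Lnorm (\<lambda>z. conv M f k z - riemann_sum M f n t A (\<lambda>x. ltrans x k z)) < e"
    by (rule conv_riemann_sum_Cc[OF k e]) blast
  obtain n t A where P: "subordinate_partition K V n t A"
    using subordinate_partition_exists[OF K V(1,2)] .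
  let ?R = "\<lambda>z. riemann_sum M f n t A (\<lambda>x. ltrans x k z)"
  have R: "?R \<in> Lp"
    by (rule Lp_riemann_sum_ltrans[OF P Lp_Cc[OF k]])
  have "Lnorm (conv M f k) = Lnorm (\<lambda>z. ?R z + (conv M f k z - ?R z))"
    by simp
  also have "\<dots> \<le> Lnorm ?R + Lnorm (\<lambda>z. conv M f k z - ?R z)"
    by (rule Minkowski[OF R Lp_diff[OF Lp_Cc[OF conv_Cc[OF f_Cc k]] R]])
  also have "\<dots> \<le> b * mass * Lnorm k + e"
    using V(3)[OF P] Lnorm_riemann_sum_ltrans_le[OF P Lp_Cc[OF k]] by simp
  finally show "Lnorm (conv M f k) \<le> b * mass * Lnorm k + e" .
qed

lemma
  assumes g: "g \<in> Lp" and e: "0 < e"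
  shows Lp_conv_Cc_left: "conv M f g \<in> Lp" and Lnorm_conv_le_add: "Lnorm (conv M f g) \<le> b * mass * (Lnorm g + e)"
proof -
  obtain k where k: "\<And>n::nat. k n \<in> Cc" "(\<lambda>n. Lnorm (\<lambda>x. k n x - g x)) \<longlonglongrightarrow> 0"
    by (rule Cc_sequence[OF g]) blast
  obtain N where N: "\<And>n. N \<le> n \<Longrightarrow> Lnorm (\<lambda>x. k n x - g x) < e"
    using order_tendstoD(2)[OF k(2) e] by (auto simp: eventually_sequentially)
  have lim: "(\<lambda>n. conv M f (k n) x) \<longlonglongrightarrow> conv M f g x" for x
    by (rule conv_Cc_left_tendsto[OF f_Cc Lp_Cc[OF k(1)] g k(2)])
  have conv_Lp: "conv M f (k n) \<in> Lp" for n
    by (rule Lp_Cc[OF conv_Cc[OF f_Cc k(1)]])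
  have bound: "Lnorm (conv M f (k (n + N))) \<le> b * mass * (Lnorm g + e)" for n
  proof -
    have "Lnorm (k (n + N)) = Lnorm (\<lambda>x. g x + (k (n + N) x - g x))"
      by simp
    also have "\<dots> \<le> Lnorm g + Lnorm (\<lambda>x. k (n + N) x - g x)"
      by (rule Minkowski[OF g Lp_diff[OF Lp_Cc[OF k(1)] g]])
    also have "\<dots> \<le> Lnorm g + e"
      using N[of "n + N"] by simp
    finally have "b * mass * Lnorm (k (n + N)) \<le> b * mass * (Lnorm g + e)"
      using b_nonneg by (intro mult_left_mono mult_nonneg_nonneg) simp_all
    then show ?thesis
      using Lnorm_conv_Cc_le[OF k(1)[of "n + N"]] by (rule order_trans[rotated])
  qed
  have meas: "conv M f g \<in> borel_measurable M"
    by (rule borel_measurable_LIMSEQ_metric[OF Lp_measurable[OF conv_Lp] lim])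
  have ae: "AE x in M. (\<lambda>n. conv M f (k (n + N)) x) \<longlonglongrightarrow> conv M f g x"
    by (intro AE_I2 LIMSEQ_ignore_initial_segment lim)
  show "conv M f g \<in> Lp" "Lnorm (conv M f g) \<le> b * mass * (Lnorm g + e)"
    by (fact Lp_Fatou[OF conv_Lp bound meas ae] Lnorm_Fatou[OF conv_Lp bound meas ae])+
qed

lemma Lnorm_conv_le:
  assumes g: "g \<in> Lp"
  shows "Lnorm (conv M f g) \<le> b * mass * Lnorm g"
proof (rule tendsto_lowerbound)
  show "((\<lambda>e. b * mass * (Lnorm g + e)) \<longlongrightarrow> b * mass * Lnorm g) (at_right 0)"
    by (auto intro!: tendsto_eq_intros)
  show "\<forall>\<^sub>F e in at_right 0. Lnorm (conv M f g) \<le> b * mass * (Lnorm g + e)"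
    using eventually_at_right_less[of 0] by eventually_elim (rule Lnorm_conv_le_add[OF g])
qed simp

lemma Lnorm_conv_diff_riemann_sum_le:
  assumes P: "subordinate_partition K V n t A" and g: "g \<in> Lp" and k: "k \<in> Lp"
  shows "Lnorm (\<lambda>z. conv M f g z - riemann_sum M f n t A (\<lambda>x. ltrans x g z)) \<le>
    2 * (b * mass * Lnorm (\<lambda>x. g x - k x)) + Lnorm (\<lambda>z. conv M f k z - riemann_sum M f n t A (\<lambda>x. ltrans x k z))"
proof -
  let ?R = "\<lambda>g z. riemann_sum M f n t A (\<lambda>x. ltrans x g z)"
  note conv_Lp = Lp_conv_Cc_left[OF _ zero_less_one] and R_Lp = Lp_riemann_sum_ltrans[OF P] and gk = Lp_diff[OF g k]
  have "Lnorm (\<lambda>z. conv M f g z - ?R g z) \<le> Lnorm (\<lambda>z. conv M f g z - conv M f k z) +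
      (Lnorm (\<lambda>z. conv M f k z - ?R k z) + Lnorm (\<lambda>z. ?R k z - ?R g z))"
    using Lnorm_diff_triangle[OF conv_Lp[OF g] conv_Lp[OF k] R_Lp[OF g]]
      Lnorm_diff_triangle[OF conv_Lp[OF k] R_Lp[OF k] R_Lp[OF g]]
    by linarith
  also have "Lnorm (\<lambda>z. conv M f g z - conv M f k z) \<le> b * mass * Lnorm (\<lambda>x. g x - k x)"
    using Lnorm_conv_le[OF gk] by (simp add: conv_diff_right[OF f_Cc g k, symmetric])
  also have "Lnorm (\<lambda>z. ?R k z - ?R g z) = Lnorm (?R (\<lambda>x. g x - k x))"
    by (subst Lnorm_diff_commute) (simp add: riemann_sum_def ltrans_def right_diff_distrib sum_subtractf)
  also have "\<dots> \<le> b * mass * Lnorm (\<lambda>x. g x - k x)"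
    by (rule Lnorm_riemann_sum_ltrans_le[OF P gk])
  finally show ?thesis
    by simp
qed

theorem conv_riemann_sum:
  assumes g: "g \<in> Lp" and e: "0 < e"
  obtains V where "\<And>x. open (V x)" "\<And>x. x \<in> V x"
    "\<And>n t A. subordinate_partition K V n t A \<Longrightarrow>
      Lnorm (\<lambda>z. conv M f g z - riemann_sum M f n t A (\<lambda>x. ltrans x g z)) < e"
proof -
  define C where "C = b * mass"
  define d where "d = e / (2 * C + 2)"
  have C: "0 \<le> C"
    unfolding C_def using b_nonneg by (intro mult_nonneg_nonneg) simp_all
  then have "0 < d" "d * (2 * C + 2) = e"
    using e by (simp_all add: d_def)
  then have d: "0 < d" "2 * (C * d) + d < e"
    by (simp_all add: algebra_simps)
  obtain k where k: "k \<in> Cc" "Lnorm (\<lambda>x. g x - k x) < d"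
    using Cc_dense[OF g d(1)] by blast
  obtain V where V: "\<And>x. open (V x)" "\<And>x. x \<in> V x" "\<And>n t A. subordinate_partition K V n t A \<Longrightarrow>
      Lnorm (\<lambda>z. conv M f k z - riemann_sum M f n t A (\<lambda>x. ltrans x k z)) < d"
    by (rule conv_riemann_sum_Cc[OF k(1) d(1)]) blast
  show thesis
  proof (rule that[OF V(1,2)])
    fix n t A assume P: "subordinate_partition K V n t A"
    have "C * Lnorm (\<lambda>x. g x - k x) \<le> C * d"
      using k(2) C by (intro mult_left_mono) simp_all
    then show "Lnorm (\<lambda>z. conv M f g z - riemann_sum M f n t A (\<lambda>x. ltrans x g z)) < e"
      using Lnorm_conv_diff_riemann_sum_le[OF P g Lp_Cc[OF k(1)]] V(3)[OF P] d(2) unfolding C_def by linarith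
  qed
qed

end

subsection \<open>Supports under separating multipliers\<close>

definition left_quotients :: "'g::group_add set \<Rightarrow> 'g set \<Rightarrow> 'g set" where
  "left_quotients B A = {- b + a |b a. b \<in> B \<and> a \<in> A}"

lemma left_quotients_mono: "B \<subseteq> B' \<Longrightarrow> A \<subseteq> A' \<Longrightarrow> left_quotients B A \<subseteq> left_quotients B' A'"
  unfolding left_quotients_def by blast

lemma compact_left_quotients:
  fixes A B :: "'g::topological_group_add set"
  assumes "compact A" "compact B"
  shows "compact (left_quotients B A)"
proof -
  have "left_quotients B A = {x + y |x y. x \<in> uminus ` B \<and> y \<in> A}"
    unfolding left_quotients_def by blast
  then show ?thesis
    by (simp only: compact_plus[OF compact_uminus[OF assms(2)] assms(1)])
qed

lemma (in haar_group) mem_closed_if_mem_closure_left_quotients: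
  assumes C: "closed C" and z: "\<And>K. compact K \<Longrightarrow> 0 \<in> interior K \<Longrightarrow> z \<in> closure (left_quotients K C)"
  shows "(z :: 'g) \<in> C"
proof (rule ccontr)
  assume "z \<notin> C"
  then have "open (- C)" "0 + z \<in> - C"
    using C by auto
  then obtain W N where WN: "open W" "open N" "0 \<in> W" "z \<in> N" "\<And>w n. w \<in> W \<Longrightarrow> n \<in> N \<Longrightarrow> w + n \<in> - C"
    by (rule nbhd_plus) blast
  obtain V K where VK: "open V" "compact K" "0 \<in> V" "V \<subseteq> K" "K \<subseteq> W"
    by (rule lc_group_compact_nbhd[OF lc WN(1,3)])
  have "z \<in> closure (left_quotients K C)"
    using VK interior_maximal[of V K] by (intro z) auto
  then have "N \<inter> left_quotients K C \<noteq> {}"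
    using WN(2,4) unfolding closure_iff_nhds_not_empty by blast
  then obtain b c where bc: "b \<in> K" "c \<in> C" "- b + c \<in> N"
    by (auto simp: left_quotients_def)
  then have "b + (- b + c) \<in> - C"
    using VK(5) by (intro WN(5)) auto
  then show False
    using bc(2) by (simp add: add.assoc[symmetric])
qed

context weighted_haar
begin

lemma indicator_not_AE_0:
  assumes "x \<in> interior K"
  shows "\<not> (AE x in M. indicator K x = (0::complex))"
proof
  assume "AE x in M. indicator K x = (0::complex)"
  then have "AE x in M. x \<notin> interior K"
    by eventually_elim (use interior_subset in \<open>auto simp: indicator_def split: if_splits\<close>)
  then show False
    using open_AE_notin[OF open_interior] assms by blast
qed

lemma mem_esupp_if_continuous:
  assumes f: "continuous_on UNIV f" and x: "f x \<noteq> 0"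
  shows "x \<in> esupp f"
  unfolding esupp_def
proof (intro CollectI allI impI notI, elim conjE)
  fix U assume U: "open U" "x \<in> U" and zero: "AE z in M. z \<in> U \<longrightarrow> f z = 0"
  have "open (U \<inter> {z. f z \<noteq> 0})"
    using U f by (intro open_Int open_Collect_neq continuous_on_const)
  moreover have "AE z in M. z \<notin> U \<inter> {z. f z \<noteq> 0}"
    using zero by eventually_elim auto
  ultimately have "U \<inter> {z. f z \<noteq> 0} = {}"
    by (rule open_AE_notin)
  then show False
    using U x by blast
qed

lemma esupp_ltrans:
  assumes y: "y \<in> esupp (ltrans a f)"
  shows "- a + y \<in> esupp f"
  unfolding esupp_def
proof (intro CollectI allI impI notI, elim conjE)
  fix U assume U: "open U" "- a + y \<in> U" and zero: "AE z in M. z \<in> U \<longrightarrow> f z = 0"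
  have "AE z in M. z \<in> (+) (- a) -` U \<longrightarrow> ltrans a f z = 0"
    using AE_plus[OF zero, of "- a"] by (simp add: ltrans_def)
  then show False
    using y U open_vimage_plus[OF U(1), of "- a"] unfolding esupp_def by blast
qed

lemma esupp_norm: "esupp (\<lambda>x. complex_of_real (norm (f x))) = esupp f"
  by (simp add: esupp_def)

lemma conv_nonzero_esupp:
  assumes f: "f \<in> Lp" and g: "AE x in M. f x = 0 \<longrightarrow> g x = 0" and nonzero: "conv M g k x \<noteq> 0"
  obtains a where "a \<in> esupp f" "k (- a + x) \<noteq> 0"
proof (rule ccontr)
  assume "\<not> thesis"
  then have vanish: "k (- a + x) = 0" if "a \<in> esupp f" for a
    using that \<open>\<And>a. a \<in> esupp f \<Longrightarrow> k (- a + x) \<noteq> 0 \<Longrightarrow> thesis\<close> by blast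
  have "AE y in M. g y * k (- y + x) = 0"
    using AE_esupp[OF f] g by eventually_elim (use vanish in auto)
  then show False
    using nonzero unfolding conv_def by (simp add: integral_eq_zero_AE)
qed

end

locale weighted_algebra = weighted_haar M \<omega> p for M :: "'g::{topological_group_add,t2_space} measure" and \<omega> p +
  assumes conv_algebra: "conv_algebra M \<omega> p"
begin

lemma conv_Lp: "f \<in> Lp \<Longrightarrow> g \<in> Lp \<Longrightarrow> conv M f g \<in> Lp"
  using conv_algebra by (simp add: conv_algebra_def)

end

locale separating_multiplier = weighted_algebra M \<omega> p + Lp_operator M \<omega> M \<omega> p S
  for M :: "'g::{topological_group_add,t2_space} measure" and \<omega> p S +
  assumes op_surj: "h \<in> Lp \<Longrightarrow> \<exists>f\<in>Lp. AE x in M. S f x = h x"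
    and op_sep: "f \<in> Lp \<Longrightarrow> g \<in> Lp \<Longrightarrow> AE x in M. f x * g x = 0 \<Longrightarrow> AE x in M. S f x * S g x = 0"
    and op_sep': "f \<in> Lp \<Longrightarrow> g \<in> Lp \<Longrightarrow> AE x in M. S f x * S g x = 0 \<Longrightarrow> AE x in M. f x * g x = 0"
    and op_conv: "f \<in> Lp \<Longrightarrow> g \<in> Lp \<Longrightarrow> AE x in M. S (conv M f g) x = conv M (S f) g x"
begin

lemma op_eq_0D:
  assumes f: "f \<in> Lp" and "AE x in M. S f x = 0"
  shows "AE x in M. f x = 0"
  using op_sep'[OF f f] assms(2) by simp

lemma norm_preimage:
  assumes f: "f \<in> Lp"
  obtains f' where "f' \<in> Lp" "AE x in M. S f' x = complex_of_real (norm (S f x))" "AE x in M. f x = 0 \<longrightarrow> f' x = 0"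
proof -
  obtain f' where f': "f' \<in> Lp" "AE x in M. S f' x = complex_of_real (norm (S f x))"
    using op_surj[OF Lp_norm_of_real[OF op_Lp[OF f]]] by blast
  let ?v = "\<lambda>x. indicator {x. f x = 0} x * f' x"
  have "{x. f x = 0} \<in> sets M"
    using Lp_borel_measurable[OF f] by simp
  then have v: "?v \<in> Lp"
    by (rule Lp_indicator_mult[OF f'(1)])
  have "AE x in M. S ?v x * S f x = 0"
    by (rule op_sep[OF v f]) (auto simp: indicator_def)
  then have "AE x in M. S ?v x * S f' x = 0"
    using f'(2) by eventually_elim auto
  then have "AE x in M. ?v x * f' x = 0"
    by (rule op_sep'[OF v f'(1)])
  then have "AE x in M. f x = 0 \<longrightarrow> f' x = 0"
    by eventually_elim (auto simp: indicator_def)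
  with f' show thesis
    by (rule that)
qed

lemma op_conv_norm_preimage:
  assumes f: "f \<in> Lp" and f': "f' \<in> Lp" "AE x in M. S f' x = complex_of_real (norm (S f x))" and k: "k \<in> Cc"
  shows "AE x in M. S (conv M f' k) x = conv M (\<lambda>x. complex_of_real (norm (S f x))) k x"
proof -
  have "conv M (S f') k = conv M (\<lambda>x. complex_of_real (norm (S f x))) k"
    using f op_Lp f' by (intro conv_cong_left Lp_borel_measurable Lp_norm_of_real Cc_measurable[OF k])
  then show ?thesis
    using op_conv[OF f'(1) Lp_Cc[OF k]] by simp
qed

lemma conv_norm_op_disjoint:
  assumes f: "f \<in> Lp" and g: "g \<in> Lp" and k: "k \<in> Cc" and l: "l \<in> Cc"
    and disjoint: "\<And>a b x. a \<in> esupp f \<Longrightarrow> b \<in> esupp g \<Longrightarrow> k (- a + x) * l (- b + x) = 0"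
  shows "conv M (\<lambda>x. complex_of_real (norm (S f x))) k x * conv M (\<lambda>x. complex_of_real (norm (S g x))) l x = 0"
proof -
  let ?u = "\<lambda>x. complex_of_real (norm (S f x))" and ?w = "\<lambda>x. complex_of_real (norm (S g x))"
  obtain f' where f': "f' \<in> Lp" "AE x in M. S f' x = ?u x" "AE x in M. f x = 0 \<longrightarrow> f' x = 0"
    by (rule norm_preimage[OF f])
  obtain g' where g': "g' \<in> Lp" "AE x in M. S g' x = ?w x" "AE x in M. g x = 0 \<longrightarrow> g' x = 0"
    by (rule norm_preimage[OF g])
  have "conv M f' k x * conv M g' l x = 0" for x
  proof (rule ccontr)
    assume "conv M f' k x * conv M g' l x \<noteq> 0"
    then have "conv M f' k x \<noteq> 0" "conv M g' l x \<noteq> 0"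
      by auto
    then obtain a b where "a \<in> esupp f" "k (- a + x) \<noteq> 0" "b \<in> esupp g" "l (- b + x) \<noteq> 0"
      using conv_nonzero_esupp[OF f f'(3)] conv_nonzero_esupp[OF g g'(3)] by metis
    then show False
      using disjoint[of a b x] by simp
  qed
  then have "AE x in M. S (conv M f' k) x * S (conv M g' l) x = 0"
    by (intro op_sep conv_Lp f' g' Lp_Cc k l) simp
  then have "AE x in M. conv M ?u k x * conv M ?w l x = 0"
    using op_conv_norm_preimage[OF f f'(1,2) k] op_conv_norm_preimage[OF g g'(1,2) l] by eventually_elim simp
  then have "(\<lambda>x. conv M ?u k x * conv M ?w l x) = (\<lambda>_. 0)"
    using f g k l
    by (intro continuous_eq_if_AE_eq continuous_on_mult conv_Cc_continuous continuous_on_const Lp_norm_of_real op_Lp)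
      (auto elim: eventually_mono)
  then show ?thesis
    by (rule fun_cong)
qed

theorem left_quotients_esupp_op:
  assumes f: "f \<in> Lp" and g: "g \<in> Lp"
  shows "left_quotients (esupp (S g)) (esupp (S f)) \<subseteq> closure (left_quotients (esupp g) (esupp f))"
proof (rule subsetI, rule ccontr)
  let ?E = "left_quotients (esupp g) (esupp f)"
  fix t assume "t \<in> left_quotients (esupp (S g)) (esupp (S f))" and t: "t \<notin> closure ?E"
  then obtain y z where y: "y \<in> esupp (S f)" and z: "z \<in> esupp (S g)" and t_eq: "t = - z + y"
    by (auto simp: left_quotients_def)
  have "open ((+) t -` (- closure ?E))" "0 \<in> (+) t -` (- closure ?E)"
    using t by (auto intro: open_vimage_plus)
  then obtain V where V: "open V" "0 \<in> V" "\<And>u v. u \<in> V \<Longrightarrow> v \<in> V \<Longrightarrow> u - v \<in> (+) t -` (- closure ?E)"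
    by (rule nbhd_diff) blast
  obtain k where k: "bump {0} V k"
    by (rule bump_at[OF V(1,2)])
  define l where "l x = k (- t + x)" for x
  have l: "l \<in> Cc"
    unfolding l_def by (rule Cc_plus_left[OF bump_Cc[OF k]])
  have disjoint: "complex_of_real (k (- a + x)) * complex_of_real (l (- b + x)) = 0"
    if a: "a \<in> esupp f" and b: "b \<in> esupp g" for a b x
  proof (rule ccontr)
    assume "\<not> ?thesis"
    then have "- a + x \<in> V" "- t + (- b + x) \<in> V"
      using bump_eq_0[OF k] by (auto simp: l_def)
    then have "t + ((- t + (- b + x)) - (- a + x)) \<notin> closure ?E"
      using V(3) by auto
    also have "t + ((- t + (- b + x)) - (- a + x)) = - b + a"
      by (simp add: minus_add add.assoc diff_conv_add_uminus del: add_uminus_conv_diff)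
    finally show False
      using a b closure_subset[of ?E] by (auto simp: left_quotients_def)
  qed
  have "conv M (\<lambda>x. complex_of_real (norm (S f x))) (\<lambda>x. complex_of_real (k x)) (y + 0) \<noteq> 0"
    using y bump_eq_1[OF k, of 0]
    by (intro conv_pos Lp_norm_of_real op_Lp f bump_Cc[OF k] bump_nonneg[OF k]) (simp_all add: esupp_norm)
  moreover have "conv M (\<lambda>x. complex_of_real (norm (S g x))) (\<lambda>x. complex_of_real (l x)) (z + t) \<noteq> 0"
    using z bump_eq_1[OF k, of 0] bump_nonneg[OF k]
    by (intro conv_pos Lp_norm_of_real op_Lp g l) (simp_all add: esupp_norm l_def)
  moreover have "z + t = y + 0"
    by (simp add: t_eq add.assoc[symmetric])
  ultimately show False
    using conv_norm_op_disjoint[OF f g Cc_of_real[OF bump_Cc[OF k]] Cc_of_real[OF l] disjoint, of y] by simp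
qed

definition image_support :: "'g set \<Rightarrow> 'g set" where
  "image_support K = closure (\<Union>f\<in>{f\<in>Lp. esupp f \<subseteq> K}. esupp (S f))"

lemma image_support_mono: "K \<subseteq> K' \<Longrightarrow> image_support K \<subseteq> image_support K'"
  unfolding image_support_def by (intro closure_mono UN_mono) auto

lemma image_support_nonempty:
  assumes K: "compact K" "0 \<in> interior K"
  shows "image_support K \<noteq> {}"
proof -
  have Lp: "indicator K \<in> Lp"
    by (rule Lp_indicator_compact[OF K(1)])
  have "esupp (indicator K) \<subseteq> K"
    by (rule esupp_subset[OF compact_imp_closed[OF K(1)]]) simp
  then have "esupp (S (indicator K)) \<subseteq> image_support K"
    unfolding image_support_def using Lp by (intro order_trans[OF _ closure_subset]) blast
  moreover have "esupp (S (indicator K)) \<noteq> {}"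
    using op_eq_0D[OF Lp] indicator_not_AE_0[OF K(2)] by (auto simp: esupp_eq_empty_iff[OF op_Lp[OF Lp]])
  ultimately show ?thesis
    by blast
qed

lemma image_support_left_quotient:
  assumes a: "a \<in> image_support K" and f: "f \<in> Lp" and y: "y \<in> esupp (S f)"
  shows "- a + y \<in> closure (left_quotients K (esupp f))"
proof -
  let ?X = "\<Union>f\<in>{f\<in>Lp. esupp f \<subseteq> K}. esupp (S f)"
  have "(\<lambda>a. - a + y) ` closure ?X \<subseteq> closure (left_quotients K (esupp f))"
  proof (rule image_closure_subset[OF continuous_on_minus_plus closed_closure], rule image_subsetI)
    fix a assume "a \<in> ?X"
    then obtain g where g: "g \<in> Lp" "esupp g \<subseteq> K" "a \<in> esupp (S g)"
      by blast
    then have "- a + y \<in> left_quotients (esupp (S g)) (esupp (S f))"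
      using y by (auto simp: left_quotients_def)
    also have "\<dots> \<subseteq> closure (left_quotients (esupp g) (esupp f))"
      by (rule left_quotients_esupp_op[OF f g(1)])
    also have "\<dots> \<subseteq> closure (left_quotients K (esupp f))"
      by (rule closure_mono[OF left_quotients_mono[OF g(2) order_refl]])
    finally show "- a + y \<in> closure (left_quotients K (esupp f))" .
  qed
  then show ?thesis
    using a unfolding image_support_def by blast
qed

lemma compact_image_support:
  assumes K: "compact K" "0 \<in> interior K"
  shows "compact (image_support K)"
proof -
  obtain f y where f: "f \<in> Lp" "esupp f \<subseteq> K" "y \<in> esupp (S f)"
    using image_support_nonempty[OF K] unfolding image_support_def closure_eq_empty by blast
  let ?Q = "left_quotients K K"
  have Q: "compact ?Q"
    by (rule compact_left_quotients[OF K(1) K(1)])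
  have subset: "image_support K \<subseteq> (\<lambda>z. y - z) ` ?Q"
  proof
    fix a assume "a \<in> image_support K"
    then have "- a + y \<in> closure (left_quotients K (esupp f))"
      by (rule image_support_left_quotient[OF _ f(1,3)])
    also have "\<dots> \<subseteq> closure ?Q"
      by (rule closure_mono[OF left_quotients_mono[OF order_refl f(2)]])
    finally have "- a + y \<in> ?Q"
      using compact_imp_closed[OF Q] by simp
    moreover have "a = y - (- a + y)"
      by (simp add: minus_add add.assoc[symmetric] diff_conv_add_uminus del: add_uminus_conv_diff)
    ultimately show "a \<in> (\<lambda>z. y - z) ` ?Q"
      by blast
  qed
  have "compact ((\<lambda>z. y - z) ` ?Q)"
    by (intro compact_continuous_image Q) (auto intro!: continuous_intros)
  moreover have "closed (image_support K)"
    by (simp add: image_support_def)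
  ultimately have "compact ((\<lambda>z. y - z) ` ?Q \<inter> image_support K)"
    by (rule compact_Int_closed)
  then show ?thesis
    by (simp only: Int_absorb1[OF subset])
qed

lemma image_supports_common_point:
  "\<exists>a. \<forall>K. compact K \<and> 0 \<in> interior K \<longrightarrow> a \<in> image_support K"
proof -
  obtain V Q where V: "open V" "compact Q" "(0::'g) \<in> V" "V \<subseteq> Q"
    by (rule lc_group_compact_nbhd[OF lc open_UNIV UNIV_I])
  define \<K> where "\<K> = {K :: 'g set. compact K \<and> 0 \<in> interior K}"
  have Q: "Q \<in> \<K>"
    using V interior_maximal[of V Q] by (auto simp: \<K>_def)
  have "image_support Q \<inter> (\<Inter>K\<in>\<K>. image_support K) \<noteq> {}"
  proof (rule compact_imp_fip_image)
    show "compact (image_support Q)"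
      using Q by (intro compact_image_support) (auto simp: \<K>_def)
    show "closed (image_support K)" for K
      by (simp add: image_support_def)
    fix J assume J: "finite J" "J \<subseteq> \<K>"
    have "finite J \<Longrightarrow> J \<subseteq> \<K> \<Longrightarrow> Q \<inter> \<Inter>J \<in> \<K>" for J
    proof (induction J rule: finite_induct)
      case (insert K J)
      then have "compact (K \<inter> (Q \<inter> \<Inter>J))" "0 \<in> interior (K \<inter> (Q \<inter> \<Inter>J))"
        unfolding interior_Int by (auto simp: \<K>_def compact_Int)
      then show ?case
        by (simp add: \<K>_def Int_left_commute)
    qed (use Q in simp)
    then have "Q \<inter> \<Inter>J \<in> \<K>"
      using J .
    then have "image_support (Q \<inter> \<Inter>J) \<noteq> {}"
      by (intro image_support_nonempty) (auto simp: \<K>_def)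
    moreover have "image_support (Q \<inter> \<Inter>J) \<subseteq> image_support Q \<inter> (\<Inter>K\<in>J. image_support K)"
      by (intro Int_greatest INT_greatest image_support_mono) auto
    ultimately show "image_support Q \<inter> (\<Inter>K\<in>J. image_support K) \<noteq> {}"
      by blast
  qed
  then obtain a where "a \<in> (\<Inter>K\<in>\<K>. image_support K)"
    by blast
  then show ?thesis
    by (intro exI[of _ a]) (simp add: \<K>_def)
qed

theorem esupp_op_shift:
  "\<exists>a. \<forall>f\<in>Lp. \<forall>y\<in>esupp (S f). - a + y \<in> esupp f"
proof -
  obtain a where a: "\<And>K. compact K \<Longrightarrow> 0 \<in> interior K \<Longrightarrow> a \<in> image_support K"
    using image_supports_common_point by blast
  show ?thesis
  proof (intro exI[of _ a] ballI)
    fix f y assume f: "f \<in> Lp" and y: "y \<in> esupp (S f)"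
    show "- a + y \<in> esupp f"
    proof (rule mem_closed_if_mem_closure_left_quotients[OF closed_esupp])
      show "- a + y \<in> closure (left_quotients K (esupp f))" if "compact K" "0 \<in> interior K" for K
        by (rule image_support_left_quotient[OF a[OF that] f y])
    qed
  qed
qed

end

subsection \<open>Local operators\<close>

locale local_operator = weighted_haar M \<omega> p + Lp_operator M \<omega> M \<omega> p U
  for M :: "'g::{topological_group_add,t2_space} measure" and \<omega> p U +
  assumes op_esupp: "f \<in> Lp \<Longrightarrow> esupp (U f) \<subseteq> esupp f"
begin

lemma op_vanish:
  assumes f: "f \<in> Lp"
  shows "AE x in M. f x = 0 \<longrightarrow> U f x = 0"
proof -
  obtain L where L: "\<And>j::nat. compact (L j)" "\<And>j. L j \<subseteq> {x. f x \<noteq> 0}"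
    and lim: "(\<lambda>j. Lnorm (\<lambda>x. indicator (L j) x * f x - f x)) \<longlonglongrightarrow> 0"
    by (rule Lp_cutoff[OF f]) blast
  define u where "u j = (\<lambda>x. indicator (L j) x * f x)" for j
  have u: "u j \<in> Lp" for j
    unfolding u_def using L(1) by (intro Lp_indicator_mult f) (simp add: borel_compact)
  have u_lim: "(\<lambda>j. Lnorm (\<lambda>x. u j x - f x)) \<longlonglongrightarrow> 0"
    unfolding u_def by (rule lim)
  have "esupp (u j) \<subseteq> L j" for j
    by (rule esupp_subset[OF compact_imp_closed[OF L(1)]]) (simp add: u_def)
  then have esupp_U: "esupp (U (u j)) \<subseteq> L j" for j
    by (rule order_trans[OF op_esupp[OF u]])
  have "AE x in M. x \<notin> L j \<longrightarrow> U (u j) x = 0" for j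
    using AE_esupp[OF op_Lp[OF u[of j]]] by eventually_elim (use esupp_U[of j] in blast)
  then have vanish: "AE x in M. \<forall>j. x \<notin> L j \<longrightarrow> U (u j) x = 0"
    by (simp add: AE_all_countable)
  obtain r :: "nat \<Rightarrow> nat" where "AE x in M. (\<lambda>n. U (u (r n)) x) \<longlonglongrightarrow> U f x"
    by (rule Lp_tendsto_AE_subseq[OF op_Lp[OF u] op_Lp[OF f] op_tendsto[OF u f u_lim]]) blast
  with vanish show ?thesis
  proof eventually_elim
    case (elim x)
    show ?case
    proof
      assume "f x = 0"
      then have "U (u (r n)) x = 0" for n
        using elim(1) L(2) by blast
      then show "U f x = 0"
        using elim(2) by (simp add: LIMSEQ_const_iff)
    qed
  qed
qed

lemma op_indicator_mult:
  assumes f: "f \<in> Lp" and A: "A \<in> sets M"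
  shows "AE x in M. U (\<lambda>x. indicator A x * f x) x = indicator A x * U f x"
proof -
  let ?u = "\<lambda>x. indicator A x * f x" and ?v = "\<lambda>x. indicator (- A) x * f x"
  have Lp: "?u \<in> Lp" "?v \<in> Lp"
    using A by (auto intro!: Lp_indicator_mult f)
  have "(\<lambda>x. ?u x + ?v x) = f"
    by (auto simp: indicator_def)
  then have "AE x in M. U f x = U ?u x + U ?v x"
    using op_add[OF Lp] by simp
  then show ?thesis
    using op_vanish[OF Lp(1)] op_vanish[OF Lp(2)] by eventually_elim (auto simp: indicator_def)
qed

lemma op_commute_if_indicator:
  assumes h: "h \<in> Lp"
    and commute: "\<And>A. A \<in> sets M \<Longrightarrow> indicator A \<in> Lp \<Longrightarrow> AE x in M. indicator A x * U h x = h x * U (indicator A) x"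
    and f: "f \<in> Lp"
  shows "AE x in M. f x * U h x = h x * U f x"
  using f
proof (induction f rule: Lp_induct)
  case (indicator a A)
  show ?case
    using commute[OF indicator] op_cmult[OF indicator(2), of a] by eventually_elim simp
next
  case (add f g)
  show ?case
    using add.IH op_add[OF add.hyps] by eventually_elim (simp add: algebra_simps)
next
  case (limit u f)
  note u = limit.hyps(1) and lim = limit.hyps(3)
  obtain r :: "nat \<Rightarrow> nat" where r: "strict_mono r" "AE x in M. (\<lambda>n. u (r n) x) \<longlonglongrightarrow> f x"
    by (rule Lp_tendsto_AE_subseq[OF u limit.hyps(2) lim]) blast
  have "(\<lambda>n. Lnorm (\<lambda>x. U (u (r n)) x - U f x)) \<longlonglongrightarrow> 0"
    using LIMSEQ_subseq_LIMSEQ[OF op_tendsto[OF u limit.hyps(2) lim] r(1)] by (simp add: comp_def)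
  then obtain s :: "nat \<Rightarrow> nat" where s: "strict_mono s" "AE x in M. (\<lambda>n. U (u (r (s n))) x) \<longlonglongrightarrow> U f x"
    by (rule Lp_tendsto_AE_subseq[OF op_Lp[OF u] op_Lp[OF limit.hyps(2)]]) blast
  have "AE x in M. \<forall>n. u n x * U h x = h x * U (u n) x"
    unfolding AE_all_countable using limit.IH by (rule allI)
  with r(2) s(2) show ?case
  proof eventually_elim
    case (elim x)
    have "(\<lambda>n. u (r (s n)) x * U h x) \<longlonglongrightarrow> f x * U h x"
      using LIMSEQ_subseq_LIMSEQ[OF elim(1) s(1)] by (intro tendsto_mult_right) (simp add: comp_def)
    moreover have "(\<lambda>n. u (r (s n)) x * U h x) \<longlonglongrightarrow> h x * U f x"
      using elim(3) tendsto_mult_left[OF elim(2), of "h x"] by simp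
    ultimately show ?case
      by (rule LIMSEQ_unique)
  qed
qed

theorem op_commute:
  assumes f: "f \<in> Lp" and g: "g \<in> Lp"
  shows "AE x in M. f x * U g x = g x * U f x"
proof (rule op_commute_if_indicator[OF g _ f])
  fix A :: "'g set" assume A: "A \<in> sets M" "indicator A \<in> Lp"
  have "AE x in M. g x * U (indicator A) x = indicator A x * U g x"
  proof (rule op_commute_if_indicator[OF A(2) _ g])
    fix B :: "'g set" assume B: "B \<in> sets M" "indicator B \<in> Lp"
    show "AE x in M. indicator B x * U (indicator A) x = indicator A x * U (indicator B) x"
      using op_indicator_mult[OF A(2) B(1)] op_indicator_mult[OF B(2) A(1)]
      by eventually_elim (simp add: mult.commute)
  qed
  then show "AE x in M. indicator A x * U g x = g x * U (indicator A) x"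
    by eventually_elim simp
qed

end

lemma (in weighted_haar) conv_self_nonzero:
  obtains k where "k \<in> Cc" "conv M k k 0 \<noteq> 0"
proof -
  obtain k where k: "bump {0::'g} UNIV k"
    by (rule bump_at[OF open_UNIV UNIV_I])
  let ?k = "\<lambda>x. complex_of_real (k x)"
  have k_Cc: "?k \<in> Cc"
    by (rule Cc_of_real[OF bump_Cc[OF k]])
  have "conv M ?k ?k (0 + 0) \<noteq> 0"
    using bump_eq_1[OF k, of 0]
    by (intro conv_pos Lp_Cc k_Cc bump_Cc[OF k] bump_nonneg[OF k] mem_esupp_if_continuous Cc_continuous) simp_all
  then show thesis
    using that[OF k_Cc] by simp
qed

theorem (in weighted_algebra) local_multiplier_scalar:
  assumes "local_operator M \<omega> p U"
    and op_conv: "\<And>f g. f \<in> Lp \<Longrightarrow> g \<in> Lp \<Longrightarrow> AE x in M. U (conv M f g) x = conv M (U f) g x"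
  shows "\<exists>c. \<forall>f\<in>Lp. AE x in M. U f x = c * f x"
proof -
  interpret U: local_operator M \<omega> p U by fact
  obtain k where k: "k \<in> Cc" and nonzero: "conv M k k 0 \<noteq> 0"
    by (rule conv_self_nonzero)
  note k_Lp = Lp_Cc[OF k]
  show ?thesis
  proof (intro exI[of _ "conv M (U k) k 0 / conv M k k 0"] ballI)
    fix f assume f: "f \<in> Lp"
    show "AE x in M. U f x = conv M (U k) k 0 / conv M k k 0 * f x"
    proof (rule conv_determines[OF U.op_Lp[OF f] Lp_cmult[OF f]])
      fix l :: "'g \<Rightarrow> complex" assume l: "l \<in> Cc"
      have "AE x in M. conv M k k x * conv M (U f) l x = conv M f l x * conv M (U k) k x"
        using U.op_commute[OF conv_Lp[OF k_Lp k_Lp] conv_Lp[OF f Lp_Cc[OF l]]]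
          op_conv[OF f Lp_Cc[OF l]] op_conv[OF k_Lp k_Lp]
        by eventually_elim simp
      then have "(\<lambda>x. conv M k k x * conv M (U f) l x) = (\<lambda>x. conv M f l x * conv M (U k) k x)"
        by (intro continuous_eq_if_AE_eq continuous_on_mult conv_Cc_continuous U.op_Lp f k l k_Lp)
          (auto elim: eventually_mono)
      then have "conv M k k 0 * conv M (U f) l 0 = conv M f l 0 * conv M (U k) k 0"
        by (rule fun_cong)
      then show "conv M (U f) l 0 = conv M (\<lambda>x. conv M (U k) k 0 / conv M k k 0 * f x) l 0"
        using nonzero unfolding conv_cmult_left by (simp add: field_simps)
    qed
  qed
qed

subsection \<open>Separating multipliers are weighted translations\<close>

lemma (in separating_multiplier) local_operator_shift:
  assumes a: "\<And>f y. f \<in> Lp \<Longrightarrow> y \<in> esupp (S f) \<Longrightarrow> - a + y \<in> esupp f"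
  shows "local_operator M \<omega> p (\<lambda>f. ltrans (- a) (S f))"
proof -
  interpret U: Lp_operator M \<omega> M \<omega> p "\<lambda>f. ltrans (- a) (S f)"
    by (rule Lp_operator_compose[OF Lp_operator_axioms Lp_operator_ltrans])
  show ?thesis
  proof unfold_locales
    fix f assume f: "f \<in> Lp"
    show "esupp (ltrans (- a) (S f)) \<subseteq> esupp f"
    proof
      fix y assume "y \<in> esupp (ltrans (- a) (S f))"
      then have "a + y \<in> esupp (S f)"
        using esupp_ltrans[of y "- a" "S f"] by simp
      then have "- a + (a + y) \<in> esupp f"
        by (rule a[OF f])
      then show "y \<in> esupp f"
        by (simp add: add.assoc[symmetric])
    qed
  qed
qed

theorem (in separating_multiplier) weighted_translation:
  "\<exists>a c. c \<noteq> 0 \<and> (\<forall>f\<in>Lp. AE x in M. S f x = c * ltrans a f x)"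
proof -
  obtain a where a: "\<And>f y. f \<in> Lp \<Longrightarrow> y \<in> esupp (S f) \<Longrightarrow> - a + y \<in> esupp f"
    using esupp_op_shift by blast
  have "\<exists>c. \<forall>f\<in>Lp. AE x in M. ltrans (- a) (S f) x = c * f x"
  proof (rule local_multiplier_scalar[OF local_operator_shift[OF a]])
    fix f g assume f: "f \<in> Lp" and g: "g \<in> Lp"
    show "AE x in M. ltrans (- a) (S (conv M f g)) x = conv M (ltrans (- a) (S f)) g x"
      using AE_plus[OF op_conv[OF f g], of a] conv_ltrans[of "S f" g "- a"] Lp_borel_measurable f g op_Lp
      by (simp add: ltrans_def)
  qed
  then obtain c where c: "\<And>f. f \<in> Lp \<Longrightarrow> AE x in M. ltrans (- a) (S f) x = c * f x"
    by blast
  have form: "AE x in M. S f x = c * ltrans a f x" if f: "f \<in> Lp" for f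
    using AE_plus[OF c[OF f], of "- a"] by eventually_elim (simp add: ltrans_def add.assoc[symmetric])
  obtain V K where VK: "open V" "compact K" "(0::'g) \<in> V" "V \<subseteq> K"
    by (rule lc_group_compact_nbhd[OF lc open_UNIV UNIV_I])
  have "\<not> (AE x in M. S (indicator K) x = 0)"
    using op_eq_0D[OF Lp_indicator_compact[OF VK(2)]] indicator_not_AE_0[of 0 K] VK interior_maximal[of V K] by blast
  moreover have "AE x in M. S (indicator K) x = 0" if "c = 0"
    using form[OF Lp_indicator_compact[OF VK(2)]] that by simp
  ultimately have "c \<noteq> 0"
    by blast
  then show ?thesis
    using form by blast
qed

subsection \<open>Weighted translations\<close>

lemma (in haar_group) AE_plus_iff: "(AE y in M. P (x + y)) \<longleftrightarrow> (AE y in M. P y)"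
proof
  assume "AE y in M. P (x + y)"
  from AE_plus[OF this, of "- x"] show "AE y in M. P y"
    by (simp add: add.assoc[symmetric])
qed (rule AE_plus)

context weighted_haar
begin

lemma ltrans_unique:
  assumes c: "c \<noteq> 0" and eq: "\<And>h. h \<in> Lp \<Longrightarrow> AE x in M. c * ltrans b h x = c' * ltrans b' h x"
  shows "b = b'" "c = c'"
proof -
  have pointwise: "c * k (- b + x) = c' * k (- b' + x)" if k: "k \<in> Cc" for k :: "'g \<Rightarrow> complex" and x
  proof -
    have "(\<lambda>x. c * k (- b + x)) = (\<lambda>x. c' * k (- b' + x))"
      using eq[OF Lp_Cc[OF k]] Cc_continuous[OF Cc_plus_left[OF k]]
      by (intro continuous_eq_if_AE_eq continuous_on_mult continuous_on_const) (auto simp: ltrans_def elim: eventually_mono)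
    then show ?thesis
      by (rule fun_cong)
  qed
  show b: "b = b'"
  proof (rule ccontr)
    assume "b \<noteq> b'"
    then have "open (- {- b' + b})" "0 \<in> - {- b' + b}"
      by (auto simp: add_eq_0_iff)
    then obtain k where k: "bump {0} (- {- b' + b}) k"
      by (rule bump_at)
    then have "k 0 = 1" "k (- b' + b) = 0"
      using bump_eq_1[OF k, of 0] bump_eq_0[OF k, of "- b' + b"] by simp_all
    then show False
      using pointwise[OF Cc_of_real[OF bump_Cc[OF k]], of b] c by simp
  qed
  obtain k where k: "bump {0::'g} UNIV k"
    by (rule bump_at[OF open_UNIV UNIV_I])
  show "c = c'"
    using pointwise[OF Cc_of_real[OF bump_Cc[OF k]], of b] bump_eq_1[OF k, of 0] b by simp
qed

lemma Lnorm_le_Lnorm_ltrans: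
  assumes f: "f \<in> Lp" and c: "0 \<le> c" and le: "\<And>y. f y \<noteq> 0 \<Longrightarrow> \<omega> y \<le> c * \<omega> (b + y)"
  shows "Lnorm f \<le> c * Lnorm (ltrans b f)"
proof -
  let ?u = "\<lambda>x. (norm (ltrans b f x) * \<omega> x) powr p"
  have "?u \<in> borel_measurable borel"
    using Lp_integrable[OF Lp_ltrans[OF f], THEN borel_measurable_integrable] by simp
  then have "(\<integral>y. c powr p * ?u (b + y) \<partial>M) = (c * Lnorm (ltrans b f)) powr p"
    by (simp only: integral_mult_right_zero integral_plus[of ?u] powr_mult[of c "Lnorm (ltrans b f)"] Lnorm_powr)
  moreover have "integrable M (\<lambda>y. c powr p * ?u (b + y))"
    by (intro integrable_mult_right integrable_plus Lp_integrable Lp_ltrans f)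
  moreover have "AE y in M. (norm (f y) * \<omega> y) powr p \<le> c powr p * ?u (b + y)"
  proof (rule AE_I2)
    fix y
    have "norm (f y) * \<omega> y \<le> norm (f y) * (c * \<omega> (b + y))"
      using le[of y] by (cases "f y = 0") (auto intro: mult_left_mono)
    then have "(norm (f y) * \<omega> y) powr p \<le> (c * (norm (f y) * \<omega> (b + y))) powr p"
      using p_ge_1 weight_pos[of y] by (intro powr_mono2) (auto simp: mult_ac)
    then show "(norm (f y) * \<omega> y) powr p \<le> c powr p * ?u (b + y)"
      by (simp add: ltrans_def powr_mult add.assoc[symmetric])
  qed
  ultimately show ?thesis
    using c by (intro Lnorm_le_if_integrable_bound[OF Lp_measurable[OF f]]) auto
qed

lemma weight_mult_Lnorm_le:
  assumes f: "f \<in> Lp" and K: "compact K" "\<And>x. x \<notin> K \<Longrightarrow> f x = 0"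
  obtains C where "0 < C" "\<And>b. \<omega> b * Lnorm f \<le> C * Lnorm (ltrans b f)"
proof -
  obtain B where B: "0 < B" "\<And>x. x \<in> K \<Longrightarrow> \<omega> x \<le> B"
    using weight_bounds_compact[OF K(1)] by metis
  obtain D where D: "0 < D" "\<And>x. x \<in> uminus ` K \<Longrightarrow> \<omega> x \<le> D"
    using weight_bounds_compact[OF compact_uminus[OF K(1)]] by metis
  show thesis
  proof (rule that[of "B * D"])
    fix b
    have "\<omega> y \<le> B * D / \<omega> b * \<omega> (b + y)" if "f y \<noteq> 0" for y
    proof -
      have y: "y \<in> K"
        using K(2) that by blast
      have "\<omega> b \<le> \<omega> (b + y) * \<omega> (- y)"
        using weight_plus_le[of "b + y" "- y"] by (simp add: add.assoc)
      also have "\<dots> \<le> \<omega> (b + y) * D"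
        using y D(2) weight_pos[of "b + y"] by (intro mult_left_mono) auto
      finally have "\<omega> y * \<omega> b \<le> B * (\<omega> (b + y) * D)"
        using y B weight_pos[of b] by (intro mult_mono) auto
      then show ?thesis
        using weight_pos[of b] by (simp add: pos_le_divide_eq mult_ac)
    qed
    then have "Lnorm f \<le> B * D / \<omega> b * Lnorm (ltrans b f)"
      using B(1) D(1) weight_pos[of b] by (intro Lnorm_le_Lnorm_ltrans[OF f]) (auto intro: less_imp_le)
    then show "\<omega> b * Lnorm f \<le> B * D * Lnorm (ltrans b f)"
      using weight_pos[of b] by (simp add: pos_le_divide_eq mult_ac)
  qed (use B D in simp)
qed

lemma Lnorm_indicator_pos:
  assumes "compact K" "x \<in> interior K"
  shows "0 < Lnorm (indicator K)"
  using Lnorm_eq_0_iff[OF Lp_indicator_compact[OF assms(1)]] indicator_not_AE_0[OF assms(2)]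
  by (simp add: order_less_le)

end

subsection \<open>Biseparating isomorphisms intertwine translations\<close>

locale algebra_iso =
  G: weighted_algebra M1 \<omega>1 p + H: weighted_algebra M2 \<omega>2 p +
  T: Lp_operator M1 \<omega>1 M2 \<omega>2 p T + S: Lp_operator M2 \<omega>2 M1 \<omega>1 p S
  for M1 :: "'g::{topological_group_add,t2_space} measure" and \<omega>1
    and M2 :: "'h::{topological_group_add,t2_space} measure" and \<omega>2 and p T S +
  assumes S_T: "f \<in> G.Lp \<Longrightarrow> AE x in M1. S (T f) x = f x"
    and T_S: "h \<in> H.Lp \<Longrightarrow> AE y in M2. T (S h) y = h y"
    and T_conv: "f \<in> G.Lp \<Longrightarrow> g \<in> G.Lp \<Longrightarrow> AE y in M2. T (conv M1 f g) y = conv M2 (T f) (T g) y"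
    and T_sep_iff: "f \<in> G.Lp \<Longrightarrow> g \<in> G.Lp \<Longrightarrow>
      (AE y in M2. T f y * T g y = 0) \<longleftrightarrow> (AE x in M1. f x * g x = 0)"
begin

lemma S_conv:
  assumes h: "h \<in> H.Lp" and g: "g \<in> H.Lp"
  shows "AE x in M1. S (conv M2 h g) x = conv M1 (S h) (S g) x"
proof -
  note S_Lp = S.op_Lp[OF h] S.op_Lp[OF g]
  have "conv M2 (T (S h)) (T (S g)) = conv M2 h (T (S g))"
    by (rule H.conv_cong_left[OF _ _ _ T_S[OF h]]) (intro H.Lp_borel_measurable T.op_Lp S_Lp h)+
  also have "\<dots> = conv M2 h g"
    by (rule H.conv_cong_right[OF h _ _ T_S[OF g]]) (intro H.Lp_borel_measurable T.op_Lp S_Lp g)+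
  finally have "AE y in M2. T (conv M1 (S h) (S g)) y = conv M2 h g y"
    using T_conv[OF S_Lp] by simp
  from S.op_cong_AE[OF T.op_Lp[OF G.conv_Lp[OF S_Lp]] H.conv_Lp[OF h g] this] S_T[OF G.conv_Lp[OF S_Lp]]
  show ?thesis
    by eventually_elim simp
qed

lemma S_sep_iff:
  assumes h: "h \<in> H.Lp" and g: "g \<in> H.Lp"
  shows "(AE x in M1. S h x * S g x = 0) \<longleftrightarrow> (AE y in M2. h y * g y = 0)"
proof -
  have "AE y in M2. (T (S h) y * T (S g) y = 0) = (h y * g y = 0)"
    using T_S[OF h] T_S[OF g] by eventually_elim simp
  then have "(AE y in M2. T (S h) y * T (S g) y = 0) \<longleftrightarrow> (AE y in M2. h y * g y = 0)"
    by (rule eventually_subst)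
  then show ?thesis
    using T_sep_iff[OF S.op_Lp[OF h] S.op_Lp[OF g]] by simp
qed

lemma algebra_iso_inverse: "algebra_iso M2 \<omega>2 M1 \<omega>1 p S T"
  by unfold_locales (fact T_S S_T S_conv S_sep_iff)+

lemma separating_multiplier_translation: "separating_multiplier M2 \<omega>2 p (\<lambda>h. T (ltrans a (S h)))"
proof -
  let ?R = "\<lambda>h. T (ltrans a (S h))"
  interpret R: Lp_operator M2 \<omega>2 M2 \<omega>2 p ?R
    by (rule Lp_operator_compose[OF S.Lp_operator_axioms Lp_operator_compose[OF G.Lp_operator_ltrans T.Lp_operator_axioms]])
  show ?thesis
  proof unfold_locales
    fix h g assume h: "h \<in> H.Lp" and g: "g \<in> H.Lp"
    note S_Lp = S.op_Lp[OF h] S.op_Lp[OF g]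
    have "(AE y in M2. ?R h y * ?R g y = 0) \<longleftrightarrow> (AE x in M1. ltrans a (S h) x * ltrans a (S g) x = 0)"
      by (rule T_sep_iff[OF G.Lp_ltrans[OF S_Lp(1)] G.Lp_ltrans[OF S_Lp(2)]])
    also have "\<dots> \<longleftrightarrow> (AE x in M1. S h x * S g x = 0)"
      unfolding ltrans_def by (rule G.AE_plus_iff)
    also have "\<dots> \<longleftrightarrow> (AE y in M2. h y * g y = 0)"
      by (rule S_sep_iff[OF h g])
    finally show "AE y in M2. h y * g y = 0 \<Longrightarrow> AE y in M2. ?R h y * ?R g y = 0"
      and "AE y in M2. ?R h y * ?R g y = 0 \<Longrightarrow> AE y in M2. h y * g y = 0"
      by simp_all
    have "AE x in M1. ltrans a (S (conv M2 h g)) x = conv M1 (ltrans a (S h)) (S g) x"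
      unfolding G.conv_ltrans[OF G.Lp_borel_measurable[OF S_Lp(1)] G.Lp_borel_measurable[OF S_Lp(2)]]
      unfolding ltrans_def by (rule G.AE_plus[OF S_conv[OF h g]])
    moreover have "conv M2 (?R h) (T (S g)) = conv M2 (?R h) g"
      by (rule H.conv_cong_right[OF R.op_Lp[OF h] _ _ T_S[OF g]]) (intro H.Lp_borel_measurable T.op_Lp S_Lp g)+
    ultimately show "AE y in M2. ?R (conv M2 h g) y = conv M2 (?R h) g y"
      using T.op_cong_AE[of "ltrans a (S (conv M2 h g))" "conv M1 (ltrans a (S h)) (S g)"]
        T_conv[of "ltrans a (S h)" "S g"] G.Lp_ltrans G.conv_Lp H.conv_Lp[OF h g] S.op_Lp S_Lp
      by (auto elim: eventually_elim2)
  next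
    fix h assume h: "h \<in> H.Lp"
    define u where "u = ltrans (- a) (S h)"
    have u: "u \<in> G.Lp"
      unfolding u_def by (rule G.Lp_ltrans[OF S.op_Lp[OF h]])
    have "AE x in M1. ltrans a (S (T u)) x = S h x"
      using G.AE_plus[OF S_T[OF u], of "- a"] by (simp add: u_def ltrans_def add.assoc[symmetric])
    from T.op_cong_AE[OF G.Lp_ltrans[OF S.op_Lp[OF T.op_Lp[OF u]]] S.op_Lp[OF h] this] T_S[OF h]
    have "AE y in M2. ?R (T u) y = h y"
      by eventually_elim simp
    then show "\<exists>f\<in>H.Lp. AE y in M2. ?R f y = h y"
      using T.op_Lp[OF u] by blast
  qed
qed

theorem translation_intertwined:
  "\<exists>b c. c \<noteq> 0 \<and> (\<forall>f\<in>G.Lp. AE y in M2. T (ltrans a f) y = c * ltrans b (T f) y)"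
proof -
  interpret R: separating_multiplier M2 \<omega>2 p "\<lambda>h. T (ltrans a (S h))"
    by (rule separating_multiplier_translation)
  obtain b c where c: "c \<noteq> 0" and R: "\<And>h. h \<in> H.Lp \<Longrightarrow> AE y in M2. T (ltrans a (S h)) y = c * ltrans b h y"
    using R.weighted_translation by blast
  have "AE y in M2. T (ltrans a f) y = c * ltrans b (T f) y" if f: "f \<in> G.Lp" for f
  proof -
    have "AE x in M1. ltrans a (S (T f)) x = ltrans a f x"
      unfolding ltrans_def by (rule G.AE_plus[OF S_T[OF f]])
    from T.op_cong_AE[OF G.Lp_ltrans[OF S.op_Lp[OF T.op_Lp[OF f]]] G.Lp_ltrans[OF f] this] R[OF T.op_Lp[OF f]]
    show ?thesis
      by eventually_elim simp
  qed
  with c show ?thesis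
    by blast
qed

end

locale intertwined = algebra_iso M1 \<omega>1 M2 \<omega>2 p T S
  for M1 :: "'g::{topological_group_add,t2_space} measure" and \<omega>1
    and M2 :: "'h::{topological_group_add,t2_space} measure" and \<omega>2 and p T S +
  fixes \<gamma> :: "'g \<Rightarrow> complex" and \<phi> :: "'g \<Rightarrow> 'h"
  assumes \<gamma>_nonzero: "\<gamma> a \<noteq> 0"
    and T_ltrans: "f \<in> G.Lp \<Longrightarrow> AE y in M2. T (ltrans a f) y = \<gamma> a * ltrans (\<phi> a) (T f) y"

lemma (in algebra_iso) intertwined_exists: "\<exists>\<gamma> \<phi>. intertwined M1 \<omega>1 M2 \<omega>2 p T S \<gamma> \<phi>"
proof -
  obtain \<phi> where "\<forall>a. \<exists>c. c \<noteq> 0 \<and> (\<forall>f\<in>G.Lp. AE y in M2. T (ltrans a f) y = c * ltrans (\<phi> a) (T f) y)"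
    using choice[OF allI[OF translation_intertwined]] by (rule exE)
  from choice[OF this] obtain \<gamma>
    where "\<forall>a. \<gamma> a \<noteq> 0 \<and> (\<forall>f\<in>G.Lp. AE y in M2. T (ltrans a f) y = \<gamma> a * ltrans (\<phi> a) (T f) y)"
    by (rule exE)
  then have "intertwined M1 \<omega>1 M2 \<omega>2 p T S \<gamma> \<phi>"
    by unfold_locales simp_all
  then show ?thesis
    by blast
qed

context intertwined
begin

lemma T_ltrans_S:
  assumes h: "h \<in> H.Lp"
  shows "AE y in M2. T (ltrans a (S h)) y = \<gamma> a * ltrans (\<phi> a) h y"
proof -
  have "AE y in M2. ltrans (\<phi> a) (T (S h)) y = ltrans (\<phi> a) h y"
    unfolding ltrans_def by (rule H.AE_plus[OF T_S[OF h]])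
  with T_ltrans[OF S.op_Lp[OF h], of a] show ?thesis
    by eventually_elim simp
qed

lemma \<phi>_plus: "\<phi> (a + b) = \<phi> a + \<phi> b" and \<gamma>_plus: "\<gamma> (a + b) = \<gamma> a * \<gamma> b"
proof -
  have "AE y in M2. \<gamma> (a + b) * ltrans (\<phi> (a + b)) h y = (\<gamma> a * \<gamma> b) * ltrans (\<phi> a + \<phi> b) h y"
    if h: "h \<in> H.Lp" for h
  proof -
    have inner: "AE y in M2. ltrans (\<phi> a) (T (ltrans b (S h))) y = ltrans (\<phi> a) (\<lambda>y. \<gamma> b * ltrans (\<phi> b) h y) y"
      using H.AE_plus[OF T_ltrans_S[OF h, of b], of "- \<phi> a"] by (simp only: ltrans_def)
    have outer: "ltrans (\<phi> a) (\<lambda>y. \<gamma> b * ltrans (\<phi> b) h y) y = \<gamma> b * ltrans (\<phi> a + \<phi> b) h y" for y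
      unfolding ltrans_ltrans[symmetric] by (simp add: ltrans_def)
    show ?thesis
      using inner T_ltrans[OF G.Lp_ltrans[OF S.op_Lp[OF h]], of a b] T_ltrans_S[OF h, of "a + b"]
      unfolding ltrans_ltrans by eventually_elim (simp add: outer mult.assoc)
  qed
  from H.ltrans_unique[OF \<gamma>_nonzero this] show "\<phi> (a + b) = \<phi> a + \<phi> b" "\<gamma> (a + b) = \<gamma> a * \<gamma> b"
    by auto
qed

lemma \<phi>_0: "\<phi> 0 = 0"
  using \<phi>_plus[of 0 0] add_left_cancel[of "\<phi> 0" 0 "\<phi> 0"] by simp

lemma weighted_ltrans_tendsto:
  assumes h: "h \<in> H.Lp"
  shows "((\<lambda>a. H.Lnorm (\<lambda>y. \<gamma> a * ltrans (\<phi> a) h y - h y)) \<longlongrightarrow> 0) (nhds 0)"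
proof -
  note S_Lp = S.op_Lp[OF h]
  have "H.Lnorm (\<lambda>y. T (ltrans a (S h)) y - T (S h) y) = H.Lnorm (\<lambda>y. \<gamma> a * ltrans (\<phi> a) h y - h y)" for a
  proof (rule H.Lnorm_cong_AE)
    show "AE y in M2. T (ltrans a (S h)) y - T (S h) y = \<gamma> a * ltrans (\<phi> a) h y - h y"
      using T_ltrans_S[OF h, of a] T_S[OF h] by eventually_elim simp
  qed (intro H.Lp_measurable H.Lp_diff H.Lp_cmult H.Lp_ltrans T.op_Lp G.Lp_ltrans S_Lp h)+
  then show ?thesis
    using T.op_tendsto[OF G.Lp_ltrans[OF S_Lp] S_Lp G.ltrans_tendsto[OF S_Lp]] by simp
qed

lemma \<phi>_eventually_in_nbhd:
  assumes W: "open W" "0 \<in> W"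
  shows "\<forall>\<^sub>F a in nhds 0. \<phi> a \<in> W"
proof -
  obtain N where N: "open N" "0 \<in> N" "\<And>u v. u \<in> N \<Longrightarrow> v \<in> N \<Longrightarrow> u - v \<in> W"
    using W by (rule nbhd_diff) blast
  obtain V K where K: "open V" "compact K" "0 \<in> V" "V \<subseteq> K" "K \<subseteq> N"
    by (rule lc_group_compact_nbhd[OF H.lc N(1,2)])
  let ?h = "indicator K :: 'h \<Rightarrow> complex"
  have h: "?h \<in> H.Lp"
    by (rule H.Lp_indicator_compact[OF K(2)])
  have "0 < H.Lnorm ?h"
    using K interior_maximal[of V K] by (intro H.Lnorm_indicator_pos) auto
  then have "\<forall>\<^sub>F a in nhds 0. H.Lnorm (\<lambda>y. \<gamma> a * ltrans (\<phi> a) ?h y - ?h y) < H.Lnorm ?h"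
    by (rule order_tendstoD(2)[OF weighted_ltrans_tendsto[OF h]])
  then show ?thesis
  proof eventually_elim
    case (elim a)
    show ?case
    proof (rule ccontr)
      assume a: "\<phi> a \<notin> W"
      have disjoint: "- \<phi> a + y \<notin> K" if "y \<in> K" for y
      proof
        assume "- \<phi> a + y \<in> K"
        then have "y - (- \<phi> a + y) \<in> W"
          using N(3) K(5) that by blast
        then show False
          using a by (simp add: minus_add add.assoc[symmetric] diff_conv_add_uminus del: add_uminus_conv_diff)
      qed
      have "(\<lambda>y. \<gamma> a * ltrans (\<phi> a) ?h y - ?h y) \<in> H.Lp"
        by (intro H.Lp_diff H.Lp_cmult H.Lp_ltrans h)
      then have "H.Lnorm ?h \<le> 1 * H.Lnorm (\<lambda>y. \<gamma> a * ltrans (\<phi> a) ?h y - ?h y)"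
        by (rule H.Lnorm_dominated[OF _ H.Lp_measurable[OF h]]) (use disjoint in \<open>auto simp: ltrans_def indicator_def\<close>)
      then show False
        using elim by simp
    qed
  qed
qed

lemma \<phi>_continuous: "continuous_on UNIV \<phi>"
  by (rule additive_continuous_on_UNIV[OF \<phi>_plus \<phi>_eventually_in_nbhd])

lemma \<gamma>_tendsto_1: "(\<gamma> \<longlongrightarrow> 1) (nhds 0)"
proof -
  obtain k where k: "k \<in> Cc" and nonzero: "conv M2 k k 0 \<noteq> 0"
    by (rule H.conv_self_nonzero)
  note k_Lp = H.Lp_Cc[OF k]
  let ?F = "conv M2 k k"
  have "conv M2 (\<lambda>y. \<gamma> a * ltrans (\<phi> a) k y) k 0 = \<gamma> a * ?F (- \<phi> a)" for a
    using H.conv_ltrans[OF Cc_measurable[OF k] Cc_measurable[OF k], of "\<phi> a"]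
    by (simp add: H.conv_cmult_left ltrans_def)
  then have product: "((\<lambda>a. \<gamma> a * ?F (- \<phi> a)) \<longlongrightarrow> ?F 0) (nhds 0)"
    using H.conv_Cc_tendsto[OF H.Lp_cmult[OF H.Lp_ltrans[OF k_Lp]] k_Lp weighted_ltrans_tendsto[OF k_Lp] k, of 0]
    by simp
  have "continuous_on UNIV (\<lambda>a. ?F (- \<phi> a))"
    by (rule continuous_on_compose2[OF H.conv_Cc_continuous[OF k_Lp k]]) (auto intro!: continuous_intros \<phi>_continuous)
  then have "isCont (\<lambda>a. ?F (- \<phi> a)) 0"
    by (simp add: continuous_on_eq_continuous_at)
  then have "((\<lambda>a. ?F (- \<phi> a)) \<longlongrightarrow> ?F (- \<phi> 0)) (nhds 0)"
    unfolding isCont_def by (rule iffD1[OF tendsto_at_iff_tendsto_nhds])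
  then have F: "((\<lambda>a. ?F (- \<phi> a)) \<longlongrightarrow> ?F 0) (nhds 0)"
    by (simp add: \<phi>_0)
  have "((\<lambda>a. \<gamma> a * ?F (- \<phi> a) / ?F (- \<phi> a)) \<longlongrightarrow> ?F 0 / ?F 0) (nhds 0)"
    by (rule tendsto_divide[OF product F nonzero])
  moreover have "\<forall>\<^sub>F a in nhds 0. \<gamma> a * ?F (- \<phi> a) / ?F (- \<phi> a) = \<gamma> a"
    using tendsto_imp_eventually_ne[OF F nonzero] by eventually_elim simp
  ultimately show ?thesis
    using nonzero by (simp add: tendsto_cong)
qed

lemma \<gamma>_continuous: "continuous_on UNIV \<gamma>"
proof (rule continuous_at_imp_continuous_on, rule ballI)
  fix x :: 'g
  have "isCont ((+) (- x)) x"
    using continuous_on_plus_left[of UNIV "- x"] by (simp add: continuous_on_eq_continuous_at)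
  then have "((\<lambda>z. - x + z) \<longlongrightarrow> 0) (at x)"
    by (simp add: isCont_def)
  then have "((\<lambda>z. \<gamma> x * \<gamma> (- x + z)) \<longlongrightarrow> \<gamma> x * 1) (at x)"
    by (intro tendsto_mult_left filterlim_compose[OF \<gamma>_tendsto_1])
  then show "isCont \<gamma> x"
    unfolding \<gamma>_plus[symmetric] by (simp add: isCont_def add.assoc[symmetric])
qed

lemma ratio_bounded:
  obtains R where "\<And>x. norm (\<gamma> x) * \<omega>2 (\<phi> x) / \<omega>1 x \<le> R"
proof -
  obtain V K where K: "open V" "compact K" "(0::'h) \<in> V" "V \<subseteq> K"
    by (rule lc_group_compact_nbhd[OF H.lc open_UNIV UNIV_I])
  define h :: "'h \<Rightarrow> complex" where "h = indicator K"
  have h: "h \<in> H.Lp"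
    unfolding h_def by (rule H.Lp_indicator_compact[OF K(2)])
  have pos: "0 < H.Lnorm h"
    unfolding h_def using K interior_maximal[of V K] by (intro H.Lnorm_indicator_pos) auto
  obtain D where D: "0 < D" "\<And>b. \<omega>2 b * H.Lnorm h \<le> D * H.Lnorm (ltrans b h)"
    by (rule H.weight_mult_Lnorm_le[OF h K(2)]) (auto simp: h_def)
  obtain C where C: "0 \<le> C" "\<And>f. f \<in> G.Lp \<Longrightarrow> H.Lnorm (T f) \<le> C * G.Lnorm f"
    using T.op_bound by blast
  show thesis
  proof (rule that[of "D * (C * G.Lnorm (S h)) / H.Lnorm h"])
    fix x
    have translate_Lp: "ltrans x (S h) \<in> G.Lp"
      by (rule G.Lp_ltrans[OF S.op_Lp[OF h]])
    have "norm (\<gamma> x) * H.Lnorm (ltrans (\<phi> x) h) = H.Lnorm (\<lambda>y. \<gamma> x * ltrans (\<phi> x) h y)"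
      by (rule H.Lnorm_cmult[OF H.Lp_ltrans[OF h], symmetric])
    also have "\<dots> = H.Lnorm (T (ltrans x (S h)))"
      by (rule H.Lnorm_cong_AE[symmetric, OF _ _ T_ltrans_S[OF h]])
        (intro H.Lp_measurable H.Lp_cmult H.Lp_ltrans T.op_Lp translate_Lp h)+
    also have "\<dots> \<le> C * (\<omega>1 x * G.Lnorm (S h))"
      using C(2)[OF translate_Lp] mult_left_mono[OF G.Lnorm_ltrans_le[OF S.op_Lp[OF h], of x] C(1)]
      by (rule order_trans)
    finally have "D * (norm (\<gamma> x) * H.Lnorm (ltrans (\<phi> x) h)) \<le> D * (C * (\<omega>1 x * G.Lnorm (S h)))"
      using D(1) by (intro mult_left_mono) auto
    moreover have "norm (\<gamma> x) * (\<omega>2 (\<phi> x) * H.Lnorm h) \<le> norm (\<gamma> x) * (D * H.Lnorm (ltrans (\<phi> x) h))"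
      by (intro mult_left_mono D(2)) simp
    ultimately have "(norm (\<gamma> x) * \<omega>2 (\<phi> x)) * H.Lnorm h \<le> (D * (C * G.Lnorm (S h))) * \<omega>1 x"
      by (simp add: mult_ac)
    then show "norm (\<gamma> x) * \<omega>2 (\<phi> x) / \<omega>1 x \<le> D * (C * G.Lnorm (S h)) / H.Lnorm h"
      using pos G.weight_pos[of x] by (simp add: pos_divide_le_eq pos_le_divide_eq)
  qed
qed

lemma inverse_intertwiner:
  assumes "intertwined M2 \<omega>2 M1 \<omega>1 p S T \<delta> \<psi>"
  shows "\<phi> (\<psi> y) = y" "\<gamma> (\<psi> y) * \<delta> y = 1"
proof -
  interpret R: intertwined M2 \<omega>2 M1 \<omega>1 p S T \<delta> \<psi> by fact
  have "AE z in M2. 1 * ltrans y h z = (\<gamma> (\<psi> y) * \<delta> y) * ltrans (\<phi> (\<psi> y)) h z" if h: "h \<in> H.Lp" for h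
  proof -
    have Lp: "ltrans y h \<in> H.Lp" "ltrans (\<psi> y) (S h) \<in> G.Lp"
      by (rule H.Lp_ltrans[OF h] G.Lp_ltrans[OF S.op_Lp[OF h]])+
    have "AE z in M2. T (S (ltrans y h)) z = T (\<lambda>x. \<delta> y * ltrans (\<psi> y) (S h) x) z"
      by (rule T.op_cong_AE[OF S.op_Lp[OF Lp(1)] G.Lp_cmult[OF Lp(2)] R.T_ltrans[OF h]])
    with T_S[OF Lp(1)] T.op_cmult[OF Lp(2), of "\<delta> y"] T_ltrans_S[OF h, of "\<psi> y"] show ?thesis
      by eventually_elim (simp add: mult_ac)
  qed
  from H.ltrans_unique[OF _ this] show "\<phi> (\<psi> y) = y" "\<gamma> (\<psi> y) * \<delta> y = 1"
    by auto
qed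

end

subsection \<open>The standard form\<close>

locale scaled_homeomorphism = homeomorphism_pair \<phi> \<psi>
  for \<phi> :: "'a::t2_space \<Rightarrow> 'b::t2_space" and \<psi> +
  fixes M1 :: "'a measure" and M2 :: "'b measure" and c :: real
  assumes sets_M1: "sets M1 = sets borel" and sets_M2: "sets M2 = sets borel"
    and c_pos: "0 < c" and scale: "A \<in> sets borel \<Longrightarrow> emeasure (distr M1 borel \<phi>) A = ennreal c * emeasure M2 A"
begin

lemma \<phi>_measurable_M1: "\<phi> \<in> M1 \<rightarrow>\<^sub>M borel"
  using \<phi>_measurable by (simp add: measurable_cong_sets[OF sets_M1 refl])

lemma haar_const: "haar_const M1 M2 \<phi> c"
  unfolding haar_const_def
proof (intro ballI impI)
  fix E assume E: "E \<in> sets M1"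
  have "\<phi> ` E \<in> sets borel"
    using measurable_sets[OF \<psi>_measurable, of E] E by (simp add: sets_M1 \<phi>_image)
  moreover have "\<phi> -` \<phi> ` E = E"
    using bij_\<phi> by (intro inj_vimage_image_eq bij_is_inj)
  ultimately show "emeasure M1 E = ennreal c * emeasure M2 (\<phi> ` E)"
    using scale emeasure_distr[OF \<phi>_measurable_M1, of "\<phi> ` E"] sets.sets_into_space[OF E] by (simp add: Int_absorb2)
qed

lemma distr_eq_density: "distr M1 borel \<phi> = density M2 (\<lambda>_. ennreal c)"
  by (rule measure_eqI) (simp_all add: scale emeasure_density_const sets_M2)

lemma
  fixes F :: "'b \<Rightarrow> 'c::{banach,second_countable_topology}"
  assumes F: "F \<in> borel_measurable borel"
  shows integral_compose: "(\<integral>x. F (\<phi> x) \<partial>M1) = c *\<^sub>R (\<integral>y. F y \<partial>M2)"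
    and integrable_compose_iff: "integrable M1 (\<lambda>x. F (\<phi> x)) \<longleftrightarrow> integrable M2 F"
proof -
  have F': "F \<in> borel_measurable M2"
    using F by (simp add: measurable_cong_sets[OF sets_M2 refl])
  show "(\<integral>x. F (\<phi> x) \<partial>M1) = c *\<^sub>R (\<integral>y. F y \<partial>M2)"
    unfolding integral_distr[OF \<phi>_measurable_M1 F, symmetric] distr_eq_density
    using integral_density[OF F', of "\<lambda>_. c"] c_pos by simp
  have "integrable M2 (\<lambda>y. c *\<^sub>R F y) \<longleftrightarrow> integrable M2 F"
    using integrable_scaleR_right[of "1 / c" M2 "\<lambda>y. c *\<^sub>R F y"] c_pos by auto
  then show "integrable M1 (\<lambda>x. F (\<phi> x)) \<longleftrightarrow> integrable M2 F"
    unfolding integrable_distr_eq[OF \<phi>_measurable_M1 F, symmetric] distr_eq_density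
    using integrable_density[OF F', of "\<lambda>_. c"] c_pos by simp
qed

end

locale scaled_intertwined = intertwined M1 \<omega>1 M2 \<omega>2 p T S \<gamma> \<phi> + scaled_homeomorphism \<phi> \<psi> M1 M2 c
  for M1 :: "'g::{topological_group_add,t2_space} measure" and \<omega>1
    and M2 :: "'h::{topological_group_add,t2_space} measure" and \<omega>2 and p T S \<gamma> \<phi> \<psi> c
begin

lemma T_std_eq: "T_std c \<gamma> \<phi> f y = complex_of_real c * \<gamma> (\<psi> y) * f (\<psi> y)"
  by (simp add: T_std_def inv_\<phi>)

lemma T_std_measurable:
  assumes "f \<in> borel_measurable borel"
  shows "T_std c \<gamma> \<phi> f \<in> borel_measurable borel"
  unfolding T_std_eq[abs_def]
  by (intro borel_measurable_times borel_measurable_const measurable_compose[OF \<psi>_measurable] assms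
      borel_measurable_continuous_onI[OF \<gamma>_continuous])

lemma norm_T_std_weight_le:
  assumes R: "norm (\<gamma> (\<psi> y)) * \<omega>2 (\<phi> (\<psi> y)) / \<omega>1 (\<psi> y) \<le> R"
  shows "norm (T_std c \<gamma> \<phi> f y) * \<omega>2 y \<le> c * R * (norm (f (\<psi> y)) * \<omega>1 (\<psi> y))"
proof -
  have "norm (\<gamma> (\<psi> y)) * \<omega>2 y \<le> R * \<omega>1 (\<psi> y)"
    using R G.weight_pos[of "\<psi> y"] by (simp add: \<phi>_\<psi> pos_divide_le_eq)
  then have "(c * norm (f (\<psi> y))) * (norm (\<gamma> (\<psi> y)) * \<omega>2 y) \<le> (c * norm (f (\<psi> y))) * (R * \<omega>1 (\<psi> y))"
    using c_pos by (intro mult_left_mono) auto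
  then show ?thesis
    using c_pos by (simp add: T_std_eq norm_mult mult_ac)
qed

lemma
  assumes f: "f \<in> G.Lp" and R: "0 \<le> R" "\<And>x. norm (\<gamma> x) * \<omega>2 (\<phi> x) / \<omega>1 x \<le> R"
  shows T_std_Lp: "T_std c \<gamma> \<phi> f \<in> H.Lp"
    and Lnorm_T_std_le: "H.Lnorm (T_std c \<gamma> \<phi> f) \<le> (c * R * (1 / c) powr (1 / p)) * G.Lnorm f"
proof -
  let ?F = "\<lambda>y. (norm (f (\<psi> y)) * \<omega>1 (\<psi> y)) powr p"
  have "(\<lambda>x. (norm (f x) * \<omega>1 x) powr p) \<in> borel_measurable borel"
    using G.Lp_integrable[OF f, THEN borel_measurable_integrable] by simp
  then have F: "?F \<in> borel_measurable borel"
    by (rule measurable_compose[OF \<psi>_measurable])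
  have int_F: "integrable M2 ?F"
    using G.Lp_integrable[OF f] by (simp add: integrable_compose_iff[OF F, symmetric] \<psi>_\<phi>)
  have "(\<integral>y. ?F y \<partial>M2) = (1 / c) * G.Lnorm f powr p"
    using integral_compose[OF F] c_pos by (simp add: \<psi>_\<phi> G.Lnorm_powr)
  then have integral: "(\<integral>y. (c * R) powr p * ?F y \<partial>M2) \<le> ((c * R * (1 / c) powr (1 / p)) * G.Lnorm f) powr p"
    using c_pos G.p_ge_1 by (simp add: powr_mult powr_powr)
  have bound: "AE y in M2. (norm (T_std c \<gamma> \<phi> f y) * \<omega>2 y) powr p \<le> (c * R) powr p * ?F y"
  proof (rule AE_I2)
    fix y
    have "(norm (T_std c \<gamma> \<phi> f y) * \<omega>2 y) powr p \<le> (c * R * (norm (f (\<psi> y)) * \<omega>1 (\<psi> y))) powr p"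
      using norm_T_std_weight_le[OF R(2), of f y] G.p_ge_1 H.weight_pos[of y] by (intro powr_mono2) auto
    then show "(norm (T_std c \<gamma> \<phi> f y) * \<omega>2 y) powr p \<le> (c * R) powr p * ?F y"
      by (simp only: powr_mult[of "c * R"])
  qed
  have meas: "T_std c \<gamma> \<phi> f \<in> borel_measurable M2"
    using T_std_measurable[OF G.Lp_borel_measurable[OF f]] by simp
  have int: "integrable M2 (\<lambda>y. (c * R) powr p * ?F y)"
    by (intro integrable_mult_right int_F)
  have nonneg: "0 \<le> (c * R * (1 / c) powr (1 / p)) * G.Lnorm f"
    using c_pos R(1) by simp
  show "T_std c \<gamma> \<phi> f \<in> H.Lp" "H.Lnorm (T_std c \<gamma> \<phi> f) \<le> (c * R * (1 / c) powr (1 / p)) * G.Lnorm f"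
    by (fact H.Lp_if_integrable_bound[OF meas int bound integral nonneg]
        H.Lnorm_le_if_integrable_bound[OF meas int bound integral nonneg])+
qed

lemma Lp_operator_T_std: "Lp_operator M1 \<omega>1 M2 \<omega>2 p (T_std c \<gamma> \<phi>)"
proof -
  obtain R where R: "\<And>x. norm (\<gamma> x) * \<omega>2 (\<phi> x) / \<omega>1 x \<le> R"
    by (rule ratio_bounded) blast
  note R_abs = abs_ge_zero[of R] order_trans[OF R abs_ge_self]
  show ?thesis
  proof unfold_locales
    show "\<exists>C\<ge>0. \<forall>f\<in>G.Lp. H.Lnorm (T_std c \<gamma> \<phi> f) \<le> C * G.Lnorm f"
      using Lnorm_T_std_le[OF _ R_abs] c_pos by (intro exI[of _ "c * \<bar>R\<bar> * (1 / c) powr (1 / p)"]) simp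
  qed (simp_all add: T_std_Lp[OF _ R_abs] T_std_eq algebra_simps)
qed

lemma conv_T_std:
  assumes f: "f \<in> borel_measurable borel" and k: "k \<in> Cc"
  shows "conv M2 (T_std c \<gamma> \<phi> f) k y = (\<integral>x. f x * (\<gamma> x * ltrans (\<phi> x) k y) \<partial>M1)"
proof -
  have "(\<lambda>z. T_std c \<gamma> \<phi> f z * k (- z + y)) \<in> borel_measurable borel"
    by (intro borel_measurable_times T_std_measurable f H.borel_measurable_reflect Cc_measurable k)
  from integral_compose[OF this]
  have "complex_of_real c * conv M2 (T_std c \<gamma> \<phi> f) k y = (\<integral>x. T_std c \<gamma> \<phi> f (\<phi> x) * k (- \<phi> x + y) \<partial>M1)"
    by (simp add: conv_def scaleR_conv_of_real)
  also have "\<dots> = (\<integral>x. complex_of_real c * (f x * (\<gamma> x * ltrans (\<phi> x) k y)) \<partial>M1)"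
    by (simp add: T_std_eq \<psi>_\<phi> ltrans_def mult_ac)
  finally show ?thesis
    using c_pos by simp
qed

lemma kernel_Cc:
  assumes k: "k \<in> Cc"
  shows "(\<lambda>x. \<gamma> x * ltrans (\<phi> x) k y) \<in> Cc"
proof -
  have "(\<lambda>x. k (- \<phi> x + y)) \<in> Cc"
  proof (rule Cc_compose[OF k])
    show "continuous_on UNIV (\<lambda>x. - \<phi> x + y)"
      by (intro continuous_intros \<phi>_continuous)
    show "continuous_on UNIV (\<lambda>z. \<psi> (y - z))"
      by (rule continuous_on_compose2[OF \<psi>_homeo]) (auto intro!: continuous_intros)
    show "\<psi> (y - (- \<phi> x + y)) = x" for x
      by (simp add: minus_add add.assoc[symmetric] diff_conv_add_uminus \<psi>_\<phi> del: add_uminus_conv_diff)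
  qed
  from Cc_mult[OF this \<gamma>_continuous] show ?thesis
    by (simp add: ltrans_def mult.commute)
qed

lemma T_riemann_sum:
  assumes h: "h \<in> H.Lp"
  shows "AE y in M2. T (\<lambda>z. riemann_sum M1 f n t A (\<lambda>x. ltrans x (S h) z)) y =
    riemann_sum M1 f n t A (\<lambda>x. \<gamma> x * ltrans (\<phi> x) h y)"
proof -
  have "AE y in M2. \<forall>i\<in>{..<n}. T (ltrans (t i) (S h)) y = \<gamma> (t i) * ltrans (\<phi> (t i)) h y"
    by (intro AE_finite_allI finite_lessThan T_ltrans_S[OF h])
  then show ?thesis
    using T.op_sum[OF finite_lessThan[of n] G.Lp_ltrans[OF S.op_Lp[OF h]], of "\<lambda>i. LINT x:A i|M1. f x" t]
    unfolding riemann_sum_def by eventually_elim simp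
qed

lemma conv_T_std_riemann_sum:
  assumes f: "f \<in> Cc" and K: "\<And>x. x \<notin> K \<Longrightarrow> f x = 0" and k: "k \<in> Cc" and B: "compact B" and e: "0 < e"
  obtains W where "\<And>x. open (W x)" "\<And>x. x \<in> W x"
    "\<And>n t A y. subordinate_partition K W n t A \<Longrightarrow> y \<in> B \<Longrightarrow>
      norm (conv M2 (T_std c \<gamma> \<phi> f) k y - riemann_sum M1 f n t A (\<lambda>x. \<gamma> x * ltrans (\<phi> x) k y)) \<le> e * (\<integral>x. norm (f x) \<partial>M1)"
proof -
  let ?\<kappa> = "\<lambda>x y. \<gamma> x * ltrans (\<phi> x) k y"
  have "continuous_on UNIV (\<lambda>z. ?\<kappa> (fst z) (snd z))"
    unfolding ltrans_def
    by (auto intro!: continuous_intros continuous_on_compose2[OF \<gamma>_continuous]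
        continuous_on_compose2[OF Cc_continuous[OF k]] continuous_on_compose2[OF \<phi>_continuous])
  from continuous_on_compact_tube[OF this B e]
  have "\<exists>W. open W \<and> x \<in> W \<and> (\<forall>x'\<in>W. \<forall>y\<in>B. dist (?\<kappa> x' y) (?\<kappa> x y) \<le> e)" for x
    by (metis fst_conv snd_conv)
  then obtain W where W: "\<And>x. open (W x)" "\<And>x. x \<in> W x"
    and W_close: "\<And>x x' y. x' \<in> W x \<Longrightarrow> y \<in> B \<Longrightarrow> dist (?\<kappa> x' y) (?\<kappa> x y) \<le> e"
    by metis
  show thesis
  proof (rule that[OF W])
    fix n t A y assume P: "subordinate_partition K W n t A" and y: "y \<in> B"
    have int: "integrable M1 (\<lambda>x. f x * ?\<kappa> x y)"
      by (intro G.integrable_Cc Cc_mult[OF f] Cc_continuous[OF kernel_Cc[OF k]])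
    show "norm (conv M2 (T_std c \<gamma> \<phi> f) k y - riemann_sum M1 f n t A (\<lambda>x. ?\<kappa> x y)) \<le> e * (\<integral>x. norm (f x) \<partial>M1)"
      unfolding conv_T_std[OF Cc_measurable[OF f] k]
      by (rule G.norm_integral_diff_riemann_sum_le[OF G.integrable_Cc[OF f] int K P W_close[OF _ y, unfolded dist_norm]])
  qed
qed

text \<open>One combination of translates approximates both sides: $f * T^{-1}k$ in norm, and, after applying $T$,
  the convolution $T_{\gamma,\phi} f * k$ uniformly on $B$.\<close>

lemma simultaneous_approximation:
  assumes f: "f \<in> Cc" and k: "k \<in> Cc" and B: "compact B" and e: "0 < e"
  obtains u where "u \<in> G.Lp" "G.Lnorm (\<lambda>x. u x - conv M1 f (S k) x) < e"
    "AE y in M2. y \<in> B \<longrightarrow> norm (T u y - conv M2 (T_std c \<gamma> \<phi> f) k y) \<le> e * (\<integral>x. norm (f x) \<partial>M1)"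
proof -
  note k_Lp = H.Lp_Cc[OF k]
  obtain K where K: "compact K" "\<And>x. x \<notin> K \<Longrightarrow> f x = 0"
    using f by (rule CcE) blast
  obtain b where b: "0 < b" "\<And>x. x \<in> K \<Longrightarrow> \<omega>1 x \<le> b"
    using G.weight_bounds_compact[OF K(1)] by metis
  interpret F: weighted_haar_Cc M1 \<omega>1 p f K b
    by unfold_locales (use f K b in auto)
  obtain V where V: "\<And>x. open (V x)" "\<And>x. x \<in> V x" "\<And>n t A. subordinate_partition K V n t A \<Longrightarrow>
      G.Lnorm (\<lambda>z. conv M1 f (S k) z - riemann_sum M1 f n t A (\<lambda>x. ltrans x (S k) z)) < e"
    by (rule F.conv_riemann_sum[OF S.op_Lp[OF k_Lp] e]) blast
  obtain W where W: "\<And>x. open (W x)" "\<And>x. x \<in> W x"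
    and W_close: "\<And>n t A y. subordinate_partition K W n t A \<Longrightarrow> y \<in> B \<Longrightarrow>
      norm (conv M2 (T_std c \<gamma> \<phi> f) k y - riemann_sum M1 f n t A (\<lambda>x. \<gamma> x * ltrans (\<phi> x) k y)) \<le> e * (\<integral>x. norm (f x) \<partial>M1)"
    by (rule conv_T_std_riemann_sum[where K = K, OF f K(2) k B e]) blast+
  obtain n t A where P: "subordinate_partition K (\<lambda>x. V x \<inter> W x) n t A"
    using subordinate_partition_exists[OF K(1), of "\<lambda>x. V x \<inter> W x"] V(1,2) W by blast
  have PV: "subordinate_partition K V n t A" and PW: "subordinate_partition K W n t A"
    by (rule subordinate_partition_mono[OF P]; simp)+
  show thesis
  proof (rule that[OF F.Lp_riemann_sum_ltrans[OF PV S.op_Lp[OF k_Lp]]])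
    show "G.Lnorm (\<lambda>z. riemann_sum M1 f n t A (\<lambda>x. ltrans x (S k) z) - conv M1 f (S k) z) < e"
      by (subst G.Lnorm_diff_commute) (rule V(3)[OF PV])
    show "AE y in M2. y \<in> B \<longrightarrow> norm (T (\<lambda>z. riemann_sum M1 f n t A (\<lambda>x. ltrans x (S k) z)) y -
        conv M2 (T_std c \<gamma> \<phi> f) k y) \<le> e * (\<integral>x. norm (f x) \<partial>M1)"
      using T_riemann_sum[OF k_Lp, of f n t A] by eventually_elim (use W_close[OF PW] in \<open>simp add: norm_minus_commute\<close>)
  qed
qed

lemma simultaneous_approximating_sequence:
  assumes f: "f \<in> Cc" and k: "k \<in> Cc" and B: "compact B"
  obtains u where "\<And>n::nat. u n \<in> G.Lp" "(\<lambda>n. G.Lnorm (\<lambda>x. u n x - conv M1 f (S k) x)) \<longlonglongrightarrow> 0"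
    "AE y in M2. y \<in> B \<longrightarrow> (\<lambda>n. T (u n) y) \<longlonglongrightarrow> conv M2 (T_std c \<gamma> \<phi> f) k y"
proof -
  let ?Q = "conv M2 (T_std c \<gamma> \<phi> f) k" and ?m = "\<integral>x. norm (f x) \<partial>M1"
  have "\<forall>n::nat. \<exists>u. u \<in> G.Lp \<and> G.Lnorm (\<lambda>x. u x - conv M1 f (S k) x) < 1 / real (Suc n) \<and>
      (AE y in M2. y \<in> B \<longrightarrow> norm (T u y - ?Q y) \<le> 1 / real (Suc n) * ?m)" (is "\<forall>n. \<exists>u. ?approx n u")
  proof
    show "\<exists>u. ?approx n u" for n
      by (rule simultaneous_approximation[OF f k B, of "1 / real (Suc n)"]) auto
  qed
  from choice[OF this] obtain u where u: "\<And>n. u n \<in> G.Lp"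
    and u_close: "\<And>n. G.Lnorm (\<lambda>x. u n x - conv M1 f (S k) x) < 1 / real (Suc n)"
    and Tu_close: "\<And>n. AE y in M2. y \<in> B \<longrightarrow> norm (T (u n) y - ?Q y) \<le> 1 / real (Suc n) * ?m"
    by blast
  show thesis
  proof (rule that[OF u])
    show "(\<lambda>n. G.Lnorm (\<lambda>x. u n x - conv M1 f (S k) x)) \<longlonglongrightarrow> 0"
      by (rule Lim_null_comparison[OF _ LIMSEQ_Suc[OF lim_inverse_n']], rule always_eventually, rule allI)
        (use u_close in \<open>simp add: less_imp_le\<close>)
    have "AE y in M2. \<forall>n. y \<in> B \<longrightarrow> norm (T (u n) y - ?Q y) \<le> 1 / real (Suc n) * ?m"
      unfolding AE_all_countable by (rule allI[OF Tu_close])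
    then show "AE y in M2. y \<in> B \<longrightarrow> (\<lambda>n. T (u n) y) \<longlonglongrightarrow> ?Q y"
    proof eventually_elim
      case (elim y)
      show ?case
      proof
        assume y: "y \<in> B"
        show "(\<lambda>n. T (u n) y) \<longlonglongrightarrow> ?Q y"
        proof (rule LIM_zero_cancel,
            rule Lim_null_comparison[OF always_eventually tendsto_mult_left_zero[OF LIMSEQ_Suc[OF lim_inverse_n']]], rule allI)
          show "norm (T (u n) y - ?Q y) \<le> 1 / real (Suc n) * ?m" for n
            using elim y by blast
        qed
      qed
    qed
  qed
qed

lemma conv_T_AE_eq:
  assumes f: "f \<in> Cc" and k: "k \<in> Cc" and B: "compact B"
  shows "AE y in M2. y \<in> B \<longrightarrow> conv M2 (T f) k y = conv M2 (T_std c \<gamma> \<phi> f) k y"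
proof -
  note k_Lp = H.Lp_Cc[OF k] and f_Lp = G.Lp_Cc[OF f]
  note conv_Lp = G.conv_Lp[OF f_Lp S.op_Lp[OF k_Lp]]
  obtain u where u: "\<And>n::nat. u n \<in> G.Lp" "(\<lambda>n. G.Lnorm (\<lambda>x. u n x - conv M1 f (S k) x)) \<longlonglongrightarrow> 0"
    and lim: "AE y in M2. y \<in> B \<longrightarrow> (\<lambda>n. T (u n) y) \<longlonglongrightarrow> conv M2 (T_std c \<gamma> \<phi> f) k y"
    by (rule simultaneous_approximating_sequence[OF f k B]) blast
  obtain r :: "nat \<Rightarrow> nat" where r: "strict_mono r" "AE y in M2. (\<lambda>n. T (u (r n)) y) \<longlonglongrightarrow> T (conv M1 f (S k)) y"
    by (rule H.Lp_tendsto_AE_subseq[OF T.op_Lp[OF u(1)] T.op_Lp[OF conv_Lp] T.op_tendsto[OF u(1) conv_Lp u(2)]]) blast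
  have "conv M2 (T f) (T (S k)) = conv M2 (T f) k"
    by (rule H.conv_cong_right[OF T.op_Lp[OF f_Lp] _ Cc_measurable[OF k] T_S[OF k_Lp]])
      (intro H.Lp_borel_measurable T.op_Lp S.op_Lp k_Lp)
  then have "AE y in M2. T (conv M1 f (S k)) y = conv M2 (T f) k y"
    using T_conv[OF f_Lp S.op_Lp[OF k_Lp]] by simp
  with lim r(2) show ?thesis
  proof eventually_elim
    case (elim y)
    show ?case
    proof
      assume "y \<in> B"
      then have "(\<lambda>n. T (u (r n)) y) \<longlonglongrightarrow> conv M2 (T_std c \<gamma> \<phi> f) k y"
        using elim(1) LIMSEQ_subseq_LIMSEQ[OF _ r(1)] by (auto simp: comp_def)
      then show "conv M2 (T f) k y = conv M2 (T_std c \<gamma> \<phi> f) k y"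
        using elim(2,3) LIMSEQ_unique by metis
    qed
  qed
qed

theorem T_eq_T_std:
  assumes f: "f \<in> G.Lp"
  shows "AE y in M2. T f y = T_std c \<gamma> \<phi> f y"
proof -
  interpret R: Lp_operator M1 \<omega>1 M2 \<omega>2 p "T_std c \<gamma> \<phi>"
    by (rule Lp_operator_T_std)
  obtain k where k: "\<And>n::nat. k n \<in> Cc" "(\<lambda>n. G.Lnorm (\<lambda>x. k n x - f x)) \<longlonglongrightarrow> 0"
    by (rule G.Cc_sequence[OF f]) blast
  show ?thesis
  proof (rule Lp_operator_eq_if_eq_on_sequence[OF T.Lp_operator_axioms Lp_operator_T_std G.Lp_Cc[OF k(1)] f k(2)])
    fix n
    have k_Lp: "k n \<in> G.Lp"
      by (rule G.Lp_Cc[OF k(1)])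
    show "AE y in M2. T (k n) y = T_std c \<gamma> \<phi> (k n) y"
    proof (rule H.conv_determines[OF T.op_Lp[OF k_Lp] R.op_Lp[OF k_Lp]])
      fix l :: "'h \<Rightarrow> complex" assume l: "l \<in> Cc"
      have "conv M2 (T (k n)) l = conv M2 (T_std c \<gamma> \<phi> (k n)) l"
        by (rule H.continuous_eq_if_AE_eq[OF H.conv_Cc_continuous[OF T.op_Lp[OF k_Lp] l]
              H.conv_Cc_continuous[OF R.op_Lp[OF k_Lp] l] conv_T_AE_eq[OF k(1) l]])
      then show "conv M2 (T (k n)) l 0 = conv M2 (T_std c \<gamma> \<phi> (k n)) l 0"
        by (rule fun_cong)
    qed
  qed
qed

end

context intertwined
begin

lemma ratio_bounded_below:
  assumes "intertwined M2 \<omega>2 M1 \<omega>1 p S T \<delta> \<psi>"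
  obtains r where "0 < r" "\<And>x. r \<le> norm (\<gamma> x) * \<omega>2 (\<phi> x) / \<omega>1 x"
proof -
  interpret R: intertwined M2 \<omega>2 M1 \<omega>1 p S T \<delta> \<psi> by fact
  obtain B where B: "\<And>y. norm (\<delta> y) * \<omega>1 (\<psi> y) / \<omega>2 y \<le> B"
    by (rule R.ratio_bounded) blast
  have inverse: "norm (\<delta> (\<phi> x)) * \<omega>1 (\<psi> (\<phi> x)) / \<omega>2 (\<phi> x) = 1 / (norm (\<gamma> x) * \<omega>2 (\<phi> x) / \<omega>1 x)" for x
  proof -
    have "norm (\<delta> (\<phi> x)) * norm (\<gamma> x) = 1"
      using R.inverse_intertwiner(2)[OF intertwined_axioms, of x] by (metis norm_mult norm_one)
    then have "norm (\<delta> (\<phi> x)) = 1 / norm (\<gamma> x)"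
      using \<gamma>_nonzero[of x] by (simp add: field_simps)
    then show ?thesis
      by (simp add: R.inverse_intertwiner(1)[OF intertwined_axioms])
  qed
  have pos: "0 < norm (\<gamma> x) * \<omega>2 (\<phi> x) / \<omega>1 x" for x
    using \<gamma>_nonzero[of x] G.weight_pos[of x] H.weight_pos[of "\<phi> x"] by simp
  have B_ge: "1 / (norm (\<gamma> x) * \<omega>2 (\<phi> x) / \<omega>1 x) \<le> B" for x
    using B[of "\<phi> x"] by (simp only: inverse)
  have B_pos: "0 < B"
    using less_le_trans[OF divide_pos_pos[OF zero_less_one pos] B_ge[of 0]] .
  show thesis
  proof (rule that[of "1 / B"])
    show "1 / B \<le> norm (\<gamma> x) * \<omega>2 (\<phi> x) / \<omega>1 x" for x
      using B_ge[of x] pos[of x] B_pos by (simp only: pos_divide_le_eq mult.commute)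
  qed (use B_pos in simp)
qed

end

lemma (in scaled_intertwined) standard_iso:
  assumes inverse: "intertwined M2 \<omega>2 M1 \<omega>1 p S T \<delta> \<psi>"
  shows "standard_iso \<omega>1 \<omega>2 \<gamma> \<phi>"
proof -
  obtain r where r: "0 < r" "\<And>x. r \<le> norm (\<gamma> x) * \<omega>2 (\<phi> x) / \<omega>1 x"
    by (rule ratio_bounded_below[OF inverse]) blast
  then have "r \<le> (INF x. norm (\<gamma> x) * \<omega>2 (\<phi> x) / \<omega>1 x)"
    by (intro cINF_greatest) auto
  moreover obtain R where "\<And>x. norm (\<gamma> x) * \<omega>2 (\<phi> x) / \<omega>1 x \<le> R"
    by (rule ratio_bounded) blast
  then have "bdd_above (range (\<lambda>x. norm (\<gamma> x) * \<omega>2 (\<phi> x) / \<omega>1 x))"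
    by (intro bdd_aboveI2)
  ultimately show ?thesis
    using r(1) \<phi>_homeo \<psi>_homeo \<gamma>_continuous bij_\<phi>
    by (simp add: standard_iso_def inv_\<phi> \<phi>_plus \<gamma>_plus \<gamma>_nonzero)
qed

theorem (in algebra_iso) standard_form:
  "\<exists>\<gamma> \<phi>. standard_iso \<omega>1 \<omega>2 \<gamma> \<phi> \<and>
    (\<exists>c>0. haar_const M1 M2 \<phi> c \<and> (\<forall>f\<in>G.Lp. ae_eq M2 (T f) (T_std c \<gamma> \<phi> f)))"
proof -
  obtain \<gamma> \<phi> where forward: "intertwined M1 \<omega>1 M2 \<omega>2 p T S \<gamma> \<phi>"
    using intertwined_exists by blast
  obtain \<delta> \<psi> where backward: "intertwined M2 \<omega>2 M1 \<omega>1 p S T \<delta> \<psi>"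
    using algebra_iso.intertwined_exists[OF algebra_iso_inverse] by blast
  interpret I: intertwined M1 \<omega>1 M2 \<omega>2 p T S \<gamma> \<phi> by (rule forward)
  interpret J: intertwined M2 \<omega>2 M1 \<omega>1 p S T \<delta> \<psi> by (rule backward)
  note inverse = I.inverse_intertwiner(1)[OF backward] J.inverse_intertwiner(1)[OF forward]
  interpret haar_group_homeomorphism M1 \<phi> \<psi>
    by unfold_locales (simp_all add: I.\<phi>_continuous J.\<phi>_continuous inverse I.\<phi>_plus)
  obtain c where "0 < c" "\<And>A. A \<in> sets borel \<Longrightarrow> emeasure (distr M1 borel \<phi>) A = ennreal c * emeasure M2 A"
    by (rule H.haar_measure_unique[OF haar_measure_distr]) blast
  then interpret scaled_intertwined M1 \<omega>1 M2 \<omega>2 p T S \<gamma> \<phi> \<psi> c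
    by unfold_locales simp_all
  show ?thesis
    using standard_iso[OF backward] haar_const c_pos T_eq_T_std by (auto simp: ae_eq_def)
qed

lemma bicontinuousE:
  assumes "bicontinuous M1 \<omega>1 M2 \<omega>2 p T"
  obtains C where "0 \<le> C" "\<And>f. f \<in> Lp_w M1 \<omega>1 p \<Longrightarrow> Lp_norm M2 \<omega>2 p (T f) \<le> C * Lp_norm M1 \<omega>1 p f"
    "\<And>f. f \<in> Lp_w M1 \<omega>1 p \<Longrightarrow> Lp_norm M1 \<omega>1 p f \<le> C * Lp_norm M2 \<omega>2 p (T f)"
proof -
  obtain C D where C: "\<And>f. f \<in> Lp_w M1 \<omega>1 p \<Longrightarrow> Lp_norm M2 \<omega>2 p (T f) \<le> C * Lp_norm M1 \<omega>1 p f"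
    and D: "\<And>f. f \<in> Lp_w M1 \<omega>1 p \<Longrightarrow> Lp_norm M1 \<omega>1 p f \<le> D * Lp_norm M2 \<omega>2 p (T f)"
    using assms unfolding bicontinuous_def by blast
  define B where "B = max 0 (max C D)"
  have B: "0 \<le> B" "C \<le> B" "D \<le> B"
    by (simp_all add: B_def)
  have nonneg: "0 \<le> Lp_norm M \<omega> p f" for M :: "'c measure" and \<omega> f
    by (simp add: Lp_norm_def)
  show thesis
    by (rule that[OF B(1) order_trans[OF C mult_right_mono[OF B(2) nonneg]] order_trans[OF D mult_right_mono[OF B(3) nonneg]]])
qed

lemma algebra_iso_exists:
  fixes M1 :: "'g::{topological_group_add,t2_space} measure" and M2 :: "'h::{topological_group_add,t2_space} measure"
  assumes "weighted_algebra M1 \<omega>1 p" "weighted_algebra M2 \<omega>2 p"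
    and iso: "alg_iso M1 \<omega>1 M2 \<omega>2 p T" and "bicontinuous M1 \<omega>1 M2 \<omega>2 p T" and sep: "biseparating M1 \<omega>1 M2 \<omega>2 p T"
  obtains S where "algebra_iso M1 \<omega>1 M2 \<omega>2 p T S"
proof -
  interpret G: weighted_algebra M1 \<omega>1 p by fact
  interpret H: weighted_algebra M2 \<omega>2 p by fact
  obtain C where C: "0 \<le> C" "\<And>f. f \<in> G.Lp \<Longrightarrow> H.Lnorm (T f) \<le> C * G.Lnorm f"
    and below: "\<And>f. f \<in> G.Lp \<Longrightarrow> G.Lnorm f \<le> C * H.Lnorm (T f)"
    using assms(4) by (rule bicontinuousE) blast
  interpret T: Lp_operator M1 \<omega>1 M2 \<omega>2 p T
    by unfold_locales (use iso C in \<open>auto simp: alg_iso_def ae_eq_def\<close>)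
  have "\<forall>h\<in>H.Lp. \<exists>f. f \<in> G.Lp \<and> (AE y in M2. T f y = h y)"
    using iso unfolding alg_iso_def ae_eq_def by blast
  then obtain S where S: "\<And>h. h \<in> H.Lp \<Longrightarrow> S h \<in> G.Lp" "\<And>h. h \<in> H.Lp \<Longrightarrow> AE y in M2. T (S h) y = h y"
    by metis
  interpret S: Lp_operator M2 \<omega>2 M1 \<omega>1 p S
    by (rule Lp_operator_inverse[OF T.Lp_operator_axioms below C(1) S])
  have inj: "AE x in M1. f x = g x" if "f \<in> G.Lp" "g \<in> G.Lp" "AE y in M2. T f y = T g y" for f g
    using iso that unfolding alg_iso_def ae_eq_def by blast
  have "algebra_iso M1 \<omega>1 M2 \<omega>2 p T S"
  proof unfold_locales
    show "AE x in M1. S (T f) x = f x" if "f \<in> G.Lp" for f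
      using that by (intro inj S T.op_Lp)
  qed (use S iso sep in \<open>auto simp: alg_iso_def biseparating_def ae_eq_def\<close>)
  then show thesis
    by (rule that)
qed

theorem theorem2p5:
  fixes M1 :: "'g::{topological_group_add,t2_space} measure"
    and M2 :: "'h::{topological_group_add,t2_space} measure"
    and \<omega>1 :: "'g \<Rightarrow> real" and \<omega>2 :: "'h \<Rightarrow> real"
    and p :: real
    and T :: "('g \<Rightarrow> complex) \<Rightarrow> ('h \<Rightarrow> complex)"
  assumes "lc_group TYPE('g)" and "lc_group TYPE('h)"
    and "haar_measure M1" and "haar_measure M2"
    and "weight \<omega>1" and "weight \<omega>2"
    and "1 \<le> p"
    and "conv_algebra M1 \<omega>1 p" and "conv_algebra M2 \<omega>2 p"
    and "alg_iso M1 \<omega>1 M2 \<omega>2 p T"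
    and "bicontinuous M1 \<omega>1 M2 \<omega>2 p T"
    and "biseparating M1 \<omega>1 M2 \<omega>2 p T"
  shows "\<exists>\<gamma> \<phi>. standard_iso \<omega>1 \<omega>2 \<gamma> \<phi> \<and>
           (\<exists>c>0. haar_const M1 M2 \<phi> c \<and>
              (\<forall>f\<in>Lp_w M1 \<omega>1 p. ae_eq M2 (T f) (T_std c \<gamma> \<phi> f)))"
proof -
  have "weighted_algebra M1 \<omega>1 p" "weighted_algebra M2 \<omega>2 p"
    using assms by unfold_locales
  then obtain S where "algebra_iso M1 \<omega>1 M2 \<omega>2 p T S"
    by (rule algebra_iso_exists) (use assms in blast)+
  then interpret algebra_iso M1 \<omega>1 M2 \<omega>2 p T S .
  show ?thesis
    by (rule standard_form)
qed

end
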